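(* Let $k$ be a field of characteristic $0$ and $p$ a prime. The spectrum of prime Serre ideals of the tensor abelian category of finitely generated $\mathrm{VI}$-modules over $k$ is homeomorphic to $\mathbb{N}^{*}$, the one-point compactification of (discrete) $\mathbb{N}$.
   Context: $\mathrm{VI}$ is the category of finite-dimensional $\mathbb{F}_p$-vector spaces and injective linear maps. A $\mathrm{VI}$-module over $k$ is a functor $\mathrm{VI}\to\mathrm{Mod}\,k$; it is finitely generated if it is a quotient of a finite direct sum of functors $k[\mathrm{Hom}_{\mathrm{VI}}(V,-)]$. The tensor product is pointwise over $k$, with unit the constant functor $k$. (By Pontryagin duality this is equivalent to the category of functors $\mathcal{U}^{op}\to\mathrm{Mod}\,k$ where $\mathcal{U}$ is the category of elementary abelian $p$-groups and surjective homomorphisms.) The finitely generated $\mathrm{VI}$-modules form a tensor abelian category: an abelian category with a symmetric monoidal structure whose tensor product is exact in each variable. A Serre subcategory of an abelian category is a nonempty full subcategory $\mathcal{D}$ such that for every short exact sequence $0\to A\to B\to C\to 0$, $B\in\mathcal{D}$ iff $A,C\in\mathcal{D}$. A Serre ideal of a tensor abelian category $\mathcal{A}$ is a Serre subcategory $\mathcal{D}$ with $X\otimes Y\in\mathcal{D}$ for all $X\in\mathcal{D}$, $Y\in\mathcal{A}$. A proper Serre ideal $P$ is prime if $X\otimes Y\in P$ implies $X\in P$ or $Y\in P$. The spectrum $\mathrm{Spc}(\mathcal{A})$ is the set of prime Serre ideals, with the Zariski topology: the closed subsets are those of the form $Z(S)=\{P\mid P\cap S=\varnothing\}$ for a family $S$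 of objects of $\mathcal{A}$. *)

theory Defs
  imports
    "HOL-Analysis.Analysis"
    "HOL-Number_Theory.Residues"
    "Jordan_Normal_Form.Missing_VectorSpace"
begin

section \<open>Prime Serre ideals and their spectrum\<close>

text \<open>
  Serre ideals of a tensor abelian category depend only on its objects, on the triples that
  fit into a short exact sequence \<open>0 \<rightarrow> A \<rightarrow> B \<rightarrow> C \<rightarrow> 0\<close>, and on the relation
  ``\<open>Z\<close> is a tensor product of \<open>X\<close> and \<open>Y\<close>''. The last one is a relation because tensor
  products are only determined up to isomorphism; Serre subcategories are closed under
  isomorphism, so the choice of \<open>Z\<close> is immaterial.
\<close>

record 'o tensor_abelian =
  Ob :: "'o set"
  short_exact :: "'o \<Rightarrow> 'o \<Rightarrow> 'o \<Rightarrow> bool"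
  tensor :: "'o \<Rightarrow> 'o \<Rightarrow> 'o \<Rightarrow> bool"

definition serre_subcategory :: "'o tensor_abelian \<Rightarrow> 'o set \<Rightarrow> bool" where
  "serre_subcategory \<A> D \<longleftrightarrow> D \<subseteq> Ob \<A> \<and> D \<noteq> {} \<and>
     (\<forall>A\<in>Ob \<A>. \<forall>B\<in>Ob \<A>. \<forall>C\<in>Ob \<A>. short_exact \<A> A B C \<longrightarrow> (B \<in> D \<longleftrightarrow> A \<in> D \<and> C \<in> D))"

definition serre_ideal :: "'o tensor_abelian \<Rightarrow> 'o set \<Rightarrow> bool" where
  "serre_ideal \<A> D \<longleftrightarrow> serre_subcategory \<A> D \<and>
     (\<forall>X\<in>D. \<forall>Y\<in>Ob \<A>. \<forall>Z\<in>Ob \<A>. tensor \<A> X Y Z \<longrightarrow> Z \<in> D)"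

definition prime_serre_ideal :: "'o tensor_abelian \<Rightarrow> 'o set \<Rightarrow> bool" where
  "prime_serre_ideal \<A> P \<longleftrightarrow> serre_ideal \<A> P \<and> P \<noteq> Ob \<A> \<and>
     (\<forall>X\<in>Ob \<A>. \<forall>Y\<in>Ob \<A>. \<forall>Z\<in>Ob \<A>. tensor \<A> X Y Z \<longrightarrow> Z \<in> P \<longrightarrow> X \<in> P \<or> Y \<in> P)"

definition Spc :: "'o tensor_abelian \<Rightarrow> 'o set set" where
  "Spc \<A> = {P. prime_serre_ideal \<A> P}"

definition Spc_closed :: "'o tensor_abelian \<Rightarrow> 'o set \<Rightarrow> 'o set set" where
  "Spc_closed \<A> S = {P \<in> Spc \<A>. P \<inter> S = {}}"

definition zariski :: "'o tensor_abelian \<Rightarrow> 'o set topology" where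
  "zariski \<A> = topology (\<lambda>U. U \<subseteq> Spc \<A> \<and> (\<exists>S\<subseteq>Ob \<A>. Spc \<A> - U = Spc_closed \<A> S))"

text \<open>
  The predicate above really is a topology as soon as there are a zero object and binary
  direct sums.
\<close>

lemma istopology_zariski:
  assumes zero: "\<And>A. A \<in> Ob \<A> \<Longrightarrow> \<exists>Z\<in>Ob \<A>. short_exact \<A> A A Z"
    and zero_unique: "\<And>A B Z. A \<in> Ob \<A> \<Longrightarrow> B \<in> Ob \<A> \<Longrightarrow> Z \<in> Ob \<A> \<Longrightarrow>
            short_exact \<A> A A Z \<Longrightarrow> short_exact \<A> B B Z"
    and sum: "\<And>A C. A \<in> Ob \<A> \<Longrightarrow> C \<in> Ob \<A> \<Longrightarrow> \<exists>B\<in>Ob \<A>. short_exact \<A> A B C"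
  shows "istopology (\<lambda>U. U \<subseteq> Spc \<A> \<and> (\<exists>S\<subseteq>Ob \<A>. Spc \<A> - U = Spc_closed \<A> S))"
    (is "istopology ?open")
proof -
  have serre: "serre_subcategory \<A> P" if "P \<in> Spc \<A>" for P
    using that by (simp add: Spc_def prime_serre_ideal_def serre_ideal_def)
  have "?open (U \<inter> V)" if "?open U" "?open V" for U V
  proof -
    from that obtain S T where S: "S \<subseteq> Ob \<A>" "Spc \<A> - U = Spc_closed \<A> S"
      and T: "T \<subseteq> Ob \<A>" "Spc \<A> - V = Spc_closed \<A> T" by blast
    define R where "R = {B \<in> Ob \<A>. \<exists>A\<in>S. \<exists>C\<in>T. short_exact \<A> A B C}"
    have "P \<inter> R = {} \<longleftrightarrow> P \<inter> S = {} \<or> P \<inter> T = {}" if P: "P \<in> Spc \<A>" for P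
    proof -
      have iff: "B \<in> P \<longleftrightarrow> A \<in> P \<and> C \<in> P"
        if "A \<in> S" "C \<in> T" "B \<in> Ob \<A>" "short_exact \<A> A B C" for A B C
        using serre[OF P] that S(1) T(1) unfolding serre_subcategory_def by blast
      show ?thesis
      proof
        assume R: "P \<inter> R = {}"
        show "P \<inter> S = {} \<or> P \<inter> T = {}"
        proof (rule ccontr)
          assume "\<not> ?thesis"
          then obtain A C where AC: "A \<in> P" "A \<in> S" "C \<in> P" "C \<in> T" by blast
          then obtain B where "B \<in> Ob \<A>" "short_exact \<A> A B C" using sum S(1) T(1) by blast
          with AC R iff[of A C B] show False by (auto simp: R_def)
        qed
      next
        assume "P \<inter> S = {} \<or> P \<inter> T = {}"
        then show "P \<inter> R = {}" using iff by (fastforce simp: R_def)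
      qed
    qed
    then have "Spc_closed \<A> R = Spc_closed \<A> S \<union> Spc_closed \<A> T"
      by (auto simp: Spc_closed_def)
    then have "Spc \<A> - (U \<inter> V) = Spc_closed \<A> R" using S T by blast
    moreover have "R \<subseteq> Ob \<A>" by (auto simp: R_def)
    ultimately show ?thesis using that by blast
  qed
  moreover have "?open (\<Union>\<U>)" if "\<forall>U\<in>\<U>. ?open U" for \<U>
  proof (cases "\<U> = {}")
    case True
    show ?thesis
    proof (cases "Ob \<A> = {}")
      case True
      then have "Spc \<A> = {}"
        by (auto simp: Spc_def prime_serre_ideal_def serre_ideal_def serre_subcategory_def)
      with \<open>\<U> = {}\<close> show ?thesis by (auto simp: Spc_closed_def)
    next
      case False
      then obtain A Z where Z: "A \<in> Ob \<A>" "Z \<in> Ob \<A>" "short_exact \<A> A A Z" using zero by blast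
      have "Z \<in> P" if P: "P \<in> Spc \<A>" for P
      proof -
        obtain B where B: "B \<in> P" "B \<in> Ob \<A>"
          using serre[OF P] unfolding serre_subcategory_def by blast
        with Z zero_unique have "short_exact \<A> B B Z" by blast
        with serre[OF P] B Z(2) show ?thesis unfolding serre_subcategory_def by blast
      qed
      then have "Spc_closed \<A> (Ob \<A>) = {}" using Z(2) by (auto simp: Spc_closed_def)
      then have "Spc_closed \<A> {} = Spc \<A>" by (auto simp: Spc_closed_def)
      with \<open>\<U> = {}\<close> show ?thesis by auto
    qed
  next
    case False
    from that obtain s where s: "\<And>U. U \<in> \<U> \<Longrightarrow> s U \<subseteq> Ob \<A> \<and> Spc \<A> - U = Spc_closed \<A> (s U)"
      by metis
    have "Spc \<A> - \<Union>\<U> = (\<Inter>U\<in>\<U>. Spc_closed \<A> (s U))" using s False by blast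
    also have "\<dots> = Spc_closed \<A> (\<Union>U\<in>\<U>. s U)" using False by (auto simp: Spc_closed_def)
    finally show ?thesis using s that by (intro conjI exI[of _ "\<Union>U\<in>\<U>. s U"]) blast+
  qed
  ultimately show ?thesis unfolding istopology_def by blast
qed

section \<open>The category VI\<close>

text \<open>
  Finite-dimensional vector spaces over \<open>\<F>\<^sub>p\<close> are finite, so up to isomorphism they all
  occur with carrier a set of natural numbers. Morphisms are extensional functions, so that
  equal morphisms are equal as HOL functions. The \<^const>\<open>mult\<close> and \<^const>\<open>one\<close> components of
  a module record carry no meaning.
\<close>

type_synonym vi_ob = "(int, nat) module"

definition VI_ob :: "nat \<Rightarrow> vi_ob set" where
  "VI_ob p = {V. vectorspace (residue_ring (int p)) V \<and>
                 vectorspace.fin_dim (residue_ring (int p)) V}"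

definition VI_hom :: "nat \<Rightarrow> vi_ob \<Rightarrow> vi_ob \<Rightarrow> (nat \<Rightarrow> nat) set" where
  "VI_hom p V W = {f \<in> module_hom (residue_ring (int p)) V W.
                     inj_on f (carrier V) \<and> f \<in> extensional (carrier V)}"

section \<open>VI-modules\<close>

text \<open>
  The type parameter \<open>'u\<close> is the type of which the carriers of the values are subsets.
\<close>

record ('k, 'u) vi_module =
  obj :: "vi_ob \<Rightarrow> ('k, 'u) module"
  arr :: "vi_ob \<Rightarrow> vi_ob \<Rightarrow> (nat \<Rightarrow> nat) \<Rightarrow> 'u \<Rightarrow> 'u"

definition VI_module :: "nat \<Rightarrow> 'k ring \<Rightarrow> ('k, 'u) vi_module \<Rightarrow> bool" where
  "VI_module p K X \<longleftrightarrow>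
     (\<forall>V\<in>VI_ob p. Module.module K (obj X V)) \<and>
     (\<forall>V\<in>VI_ob p. \<forall>W\<in>VI_ob p. \<forall>f\<in>VI_hom p V W.
        arr X V W f \<in> module_hom K (obj X V) (obj X W)) \<and>
     (\<forall>V\<in>VI_ob p. \<forall>x\<in>carrier (obj X V). arr X V V (\<lambda>v\<in>carrier V. v) x = x) \<and>
     (\<forall>U\<in>VI_ob p. \<forall>V\<in>VI_ob p. \<forall>W\<in>VI_ob p. \<forall>f\<in>VI_hom p U V. \<forall>g\<in>VI_hom p V W.
        \<forall>x\<in>carrier (obj X U).
          arr X U W (compose (carrier U) g f) x = arr X V W g (arr X U V f x))"

definition VI_nat_trans ::
  "nat \<Rightarrow> 'k ring \<Rightarrow> ('k, 'u) vi_module \<Rightarrow> ('k, 'w) vi_module \<Rightarrow> (vi_ob \<Rightarrow> 'u \<Rightarrow> 'w) \<Rightarrow> bool" where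
  "VI_nat_trans p K X Y \<eta> \<longleftrightarrow>
     (\<forall>V\<in>VI_ob p. \<eta> V \<in> module_hom K (obj X V) (obj Y V)) \<and>
     (\<forall>V\<in>VI_ob p. \<forall>W\<in>VI_ob p. \<forall>f\<in>VI_hom p V W. \<forall>x\<in>carrier (obj X V).
        \<eta> W (arr X V W f x) = arr Y V W f (\<eta> V x))"

text \<open>
  The functor \<open>K[Hom(A, -)]\<close>. As \<open>Hom(A, W)\<close> is finite, the free module on it consists of
  all functions \<open>Hom(A, W) \<rightarrow> K\<close>, the basis element \<open>h\<close> being the indicator function of \<open>h\<close>.
  A morphism \<open>f\<close> sends the basis element \<open>g\<close> to \<open>f \<circ> g\<close>.
\<close>

definition VI_free :: "nat \<Rightarrow> 'k ring \<Rightarrow> vi_ob \<Rightarrow> ('k, (nat \<Rightarrow> nat) \<Rightarrow> 'k) vi_module" where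
  "VI_free p K A =
     \<lparr>obj = (\<lambda>W. ring.func_space K (VI_hom p A W)),
      arr = (\<lambda>V W f c. \<lambda>h\<in>VI_hom p A W.
               \<Oplus>\<^bsub>K\<^esub>g\<in>{g \<in> VI_hom p A V. compose (carrier A) f g = h}. c g)\<rparr>"

definition VI_direct_sum ::
  "nat \<Rightarrow> (nat \<Rightarrow> ('k, 'u) vi_module) \<Rightarrow> ('k, nat \<Rightarrow> 'u) vi_module" where
  "VI_direct_sum n X =
     \<lparr>obj = (\<lambda>V. \<lparr>carrier = (\<Pi>\<^sub>E i\<in>{..<n}. carrier (obj (X i) V)),
                  monoid.mult = (\<lambda>x y. \<lambda>i\<in>{..<n}. \<zero>\<^bsub>obj (X i) V\<^esub>),
                  one = (\<lambda>i\<in>{..<n}. \<zero>\<^bsub>obj (X i) V\<^esub>),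
                  zero = (\<lambda>i\<in>{..<n}. \<zero>\<^bsub>obj (X i) V\<^esub>),
                  add = (\<lambda>x y. \<lambda>i\<in>{..<n}. x i \<oplus>\<^bsub>obj (X i) V\<^esub> y i),
                  smult = (\<lambda>a x. \<lambda>i\<in>{..<n}. a \<odot>\<^bsub>obj (X i) V\<^esub> x i)\<rparr>),
      arr = (\<lambda>V W f x. \<lambda>i\<in>{..<n}. arr (X i) V W f (x i))\<rparr>"

definition VI_fin_gen :: "nat \<Rightarrow> 'k ring \<Rightarrow> ('k, 'u) vi_module \<Rightarrow> bool" where
  "VI_fin_gen p K X \<longleftrightarrow>
     (\<exists>n A \<eta>. (\<forall>i<n. A i \<in> VI_ob p) \<and>
        VI_nat_trans p K (VI_direct_sum n (\<lambda>i. VI_free p K (A i))) X \<eta> \<and>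
        (\<forall>V\<in>VI_ob p.
           \<eta> V ` carrier (obj (VI_direct_sum n (\<lambda>i. VI_free p K (A i))) V) = carrier (obj X V)))"

text \<open>Kernels, images and hence exactness of VI-modules are computed pointwise.\<close>

definition VI_short_exact ::
  "nat \<Rightarrow> 'k ring \<Rightarrow> ('k, 'u) vi_module \<Rightarrow> ('k, 'u) vi_module \<Rightarrow> ('k, 'u) vi_module \<Rightarrow> bool" where
  "VI_short_exact p K A B C \<longleftrightarrow>
     (\<exists>\<alpha> \<beta>. VI_nat_trans p K A B \<alpha> \<and> VI_nat_trans p K B C \<beta> \<and>
        (\<forall>V\<in>VI_ob p.
           inj_on (\<alpha> V) (carrier (obj A V)) \<and>
           \<alpha> V ` carrier (obj A V) = {b \<in> carrier (obj B V). \<beta> V b = \<zero>\<^bsub>obj C V\<^esub>} \<and>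
           \<beta> V ` carrier (obj B V) = carrier (obj C V)))"

section \<open>Pointwise tensor products\<close>

definition bilinear_on ::
  "'k ring \<Rightarrow> ('k, 'a) module \<Rightarrow> ('k, 'b) module \<Rightarrow> ('k, 'c) module \<Rightarrow> ('a \<Rightarrow> 'b \<Rightarrow> 'c) \<Rightarrow> bool" where
  "bilinear_on K M N T b \<longleftrightarrow>
     (\<forall>x\<in>carrier M. b x \<in> module_hom K N T) \<and>
     (\<forall>y\<in>carrier N. (\<lambda>x. b x y) \<in> module_hom K M T)"

text \<open>
  The universal bilinear map. The test modules \<open>Q\<close> range over modules whose carriers live in
  the same type as that of \<open>T\<close>; this determines \<open>T\<close> up to isomorphism whenever the type is
  large enough to contain a copy of the tensor product, which is the case for
  finite-dimensional vector spaces over \<open>K\<close> and the type \<^typ>\<open>'k list\<close> used below.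
\<close>

definition is_tensor_product ::
  "'k ring \<Rightarrow> ('k, 'a) module \<Rightarrow> ('k, 'b) module \<Rightarrow> ('k, 'c) module \<Rightarrow> ('a \<Rightarrow> 'b \<Rightarrow> 'c) \<Rightarrow> bool" where
  "is_tensor_product K M N T b \<longleftrightarrow> bilinear_on K M N T b \<and>
     (\<forall>(Q :: ('k, 'c) module) c. Module.module K Q \<and> bilinear_on K M N Q c \<longrightarrow>
        (\<exists>h\<in>module_hom K T Q.
           (\<forall>x\<in>carrier M. \<forall>y\<in>carrier N. h (b x y) = c x y) \<and>
           (\<forall>h'\<in>module_hom K T Q.
              (\<forall>x\<in>carrier M. \<forall>y\<in>carrier N. h' (b x y) = c x y) \<longrightarrow>
              (\<forall>t\<in>carrier T. h' t = h t))))"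

definition VI_tensor ::
  "nat \<Rightarrow> 'k ring \<Rightarrow> ('k, 'u) vi_module \<Rightarrow> ('k, 'u) vi_module \<Rightarrow> ('k, 'u) vi_module \<Rightarrow> bool" where
  "VI_tensor p K X Y Z \<longleftrightarrow>
     (\<exists>\<beta>. (\<forall>V\<in>VI_ob p. is_tensor_product K (obj X V) (obj Y V) (obj Z V) (\<beta> V)) \<and>
        (\<forall>V\<in>VI_ob p. \<forall>W\<in>VI_ob p. \<forall>f\<in>VI_hom p V W.
           \<forall>x\<in>carrier (obj X V). \<forall>y\<in>carrier (obj Y V).
             arr Z V W f (\<beta> V x y) = \<beta> W (arr X V W f x) (arr Y V W f y)))"

section \<open>The tensor abelian category of finitely generated VI-modules\<close>

text \<open>
  A finitely generated VI-module over a field has finite-dimensional values, and every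
  finite-dimensional vector space over \<open>K\<close> is isomorphic to one whose carrier consists of
  lists over \<open>K\<close>. So no isomorphism class is lost by fixing the carrier type \<^typ>\<open>'k list\<close>.
\<close>

definition VI_fg :: "nat \<Rightarrow> 'k ring \<Rightarrow> ('k, 'k list) vi_module tensor_abelian" where
  "VI_fg p K = \<lparr>Ob = {X. VI_module p K X \<and> VI_fin_gen p K X},
                short_exact = VI_short_exact p K,
                tensor = VI_tensor p K\<rparr>"

end

theory Submission
  imports Defs
begin

text \<open>
  Let \<open>P\<close> be a prime Serre ideal and \<open>1\<^sub>S\<close> the subquotient of the unit supported on the
  dimensions in \<open>S\<close>. If \<open>X \<in> P\<close> and \<open>x \<in> X(W)\<close>, then inside \<open>X \<otimes> K[Hom(W, -)]\<close> the elements
  \<open>h x \<otimes> h\<close> with \<open>h x \<noteq> 0\<close> are linearly independent and span a copy of a truncation of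
  \<open>K[Hom(W, -)]\<close>, which maps onto \<open>1\<^sub>S\<close> for \<open>S\<close> the set of dimensions in which \<open>x\<close> survives.
  Hence \<open>1\<^sub>S \<in> P\<close>. If some \<open>1\<^bsub>{n}\<^esub>\<close> is not in \<open>P\<close>, this forces \<open>P\<close> to consist of the modules vanishing
  in dimension \<open>n\<close>. Otherwise \<open>P\<close> contains all modules of finite support; if it contained any other
  module, that module would have an element \<open>x\<close> which no injection kills, so \<open>P\<close> would contain
  \<open>1\<^bsub>{n..}\<^esub>\<close> for some \<open>n\<close> and with it the unit. So the spectrum is \<open>\<nat> \<union> {\<infinity>}\<close>, and the closed sets are the
  intersections of supports of objects, each of which is finite or contains \<open>\<infinity>\<close>.
\<close>

text \<open>The delicate point is closure under quotients. The Serre condition only speaks of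
  sequences whose three terms are objects, so a quotient map helps only once its kernel is known to
  be finitely generated. Instead of a general finiteness theorem for submodules, the argument uses
  few and explicit kernels. The main one is the kernel of the coefficient sum from the truncated
  free module on \<open>W\<close> onto the truncated unit. It is spanned by differences of
  injections \<open>g\<close>, \<open>h\<close> out of \<open>W\<close>, and every such pair factors
  through the sum of their images, of dimension at most twice that of \<open>W\<close>; hence
  finitely many differences generate. Passing to subobjects costs nothing, since cokernels stay
  finitely generated. The case of a dimension \<open>n\<close> whose one-dimensional truncation of
  the unit is not in the prime rests on tensoring with that truncation, which cuts \<open>X\<close>
  down to dimension \<open>n\<close>: if the result is zero, primality puts \<open>X\<close> into
  the prime; if not, a nonzero element of it would put the truncated unit there.\<close>

lemma module_homI:
  assumes "\<And>x. x \<in> carrier M \<Longrightarrow> f x \<in> carrier N"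
    and "\<And>x y. x \<in> carrier M \<Longrightarrow> y \<in> carrier M \<Longrightarrow> f (x \<oplus>\<^bsub>M\<^esub> y) = f x \<oplus>\<^bsub>N\<^esub> f y"
    and "\<And>a x. a \<in> carrier R \<Longrightarrow> x \<in> carrier M \<Longrightarrow> f (a \<odot>\<^bsub>M\<^esub> x) = a \<odot>\<^bsub>N\<^esub> f x"
  shows "f \<in> module_hom R M N"
  using assms by (auto simp: module_hom_def)

lemma module_homD:
  assumes "f \<in> module_hom R M N"
  shows "x \<in> carrier M \<Longrightarrow> f x \<in> carrier N"
    and "x \<in> carrier M \<Longrightarrow> y \<in> carrier M \<Longrightarrow> f (x \<oplus>\<^bsub>M\<^esub> y) = f x \<oplus>\<^bsub>N\<^esub> f y"
    and "a \<in> carrier R \<Longrightarrow> x \<in> carrier M \<Longrightarrow> f (a \<odot>\<^bsub>M\<^esub> x) = a \<odot>\<^bsub>N\<^esub> f x"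
  using assms by (auto simp: module_hom_def)

lemma module_closed:
  assumes "Module.module R M"
  shows "\<zero>\<^bsub>M\<^esub> \<in> carrier M"
    and "x \<in> carrier M \<Longrightarrow> y \<in> carrier M \<Longrightarrow> x \<oplus>\<^bsub>M\<^esub> y \<in> carrier M"
    and "a \<in> carrier R \<Longrightarrow> x \<in> carrier M \<Longrightarrow> a \<odot>\<^bsub>M\<^esub> x \<in> carrier M"
proof -
  interpret Module.module R M by fact
  show "\<zero>\<^bsub>M\<^esub> \<in> carrier M"
    and "x \<in> carrier M \<Longrightarrow> y \<in> carrier M \<Longrightarrow> x \<oplus>\<^bsub>M\<^esub> y \<in> carrier M"
    and "a \<in> carrier R \<Longrightarrow> x \<in> carrier M \<Longrightarrow> a \<odot>\<^bsub>M\<^esub> x \<in> carrier M"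
    by auto
qed

lemma module_hom_zero:
  assumes "Module.module R M" "Module.module R N" "f \<in> module_hom R M N"
  shows "f \<zero>\<^bsub>M\<^esub> = \<zero>\<^bsub>N\<^esub>"
proof -
  interpret mod_hom R M N f
    using assms by (simp add: mod_hom_def mod_hom_axioms_def)
  show ?thesis by simp
qed

lemma module_hom_minus:
  assumes "Module.module R M" "Module.module R N" "f \<in> module_hom R M N"
    and "x \<in> carrier M" "y \<in> carrier M"
  shows "f (x \<ominus>\<^bsub>M\<^esub> y) = f x \<ominus>\<^bsub>N\<^esub> f y"
proof -
  interpret mod_hom R M N f
    using assms by (simp add: mod_hom_def mod_hom_axioms_def)
  show ?thesis using assms by simp
qed

lemma module_hom_inj_onI:
  assumes "Module.module R M" "Module.module R N" "f \<in> module_hom R M N"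
    and "\<And>x. x \<in> carrier M \<Longrightarrow> f x = \<zero>\<^bsub>N\<^esub> \<Longrightarrow> x = \<zero>\<^bsub>M\<^esub>"
  shows "inj_on f (carrier M)"
proof
  interpret mod_hom R M N f
    using assms by (simp add: mod_hom_def mod_hom_axioms_def)
  fix x y assume xy: "x \<in> carrier M" "y \<in> carrier M" "f x = f y"
  then have "f (x \<ominus>\<^bsub>M\<^esub> y) = \<zero>\<^bsub>N\<^esub>"
    using assms by (simp add: module_homD(1)[OF assms(3)])
  then show "x = y"
    using xy assms(4)[of "x \<ominus>\<^bsub>M\<^esub> y"] by simp
qed

lemma submodule_iff:
  assumes "Module.module R M"
  shows "submodule R N M \<longleftrightarrow> N \<subseteq> carrier M \<and> \<zero>\<^bsub>M\<^esub> \<in> N \<and>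
    (\<forall>x\<in>N. \<forall>y\<in>N. x \<oplus>\<^bsub>M\<^esub> y \<in> N) \<and> (\<forall>a\<in>carrier R. \<forall>x\<in>N. a \<odot>\<^bsub>M\<^esub> x \<in> N)"
  using assms by (auto simp: submodule_def)

lemma submodule_kernel:
  assumes M: "Module.module R M" and N: "Module.module R N" and f: "f \<in> module_hom R M N"
  shows "submodule R {x \<in> carrier M. f x = \<zero>\<^bsub>N\<^esub>} M"
proof -
  interpret M: Module.module R M by fact
  interpret N: Module.module R N by fact
  show ?thesis unfolding submodule_iff[OF M]
    using module_homD[OF f] module_hom_zero[OF M N f] by auto
qed

lemma submodule_image:
  assumes M: "Module.module R M" and N: "Module.module R N" and f: "f \<in> module_hom R M N"
  shows "submodule R (f ` carrier M) N"
proof -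
  interpret M: Module.module R M by fact
  interpret N: Module.module R N by fact
  note hom = module_homD[OF f]
  show ?thesis unfolding submodule_iff[OF N]
    using hom(1) module_hom_zero[OF M N f]
    by (auto intro: rev_image_eqI simp: hom(2,3)[symmetric])
qed

lemma func_space_simps [simp]:
  "carrier (ring.func_space R S) = S \<rightarrow>\<^sub>E carrier R"
  "\<zero>\<^bsub>ring.func_space R S\<^esub> = (\<lambda>v\<in>S. \<zero>\<^bsub>R\<^esub>)"
  "f \<oplus>\<^bsub>ring.func_space R S\<^esub> g = (\<lambda>v\<in>S. f v \<oplus>\<^bsub>R\<^esub> g v)"
  "a \<odot>\<^bsub>ring.func_space R S\<^esub> f = (\<lambda>v\<in>S. a \<otimes>\<^bsub>R\<^esub> f v)"
  if "ring R"
  using that by (simp_all add: ring.func_space_def)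

section \<open>Images of modules under maps compatible with the operations\<close>

text \<open>Structure transported along \<open>r\<close> and computed on the representatives picked
  by \<open>inv_into\<close>. An injective \<open>r\<close> moves a module to another carrier type;
  an \<open>r\<close> that chooses coset representatives yields a quotient.\<close>

definition img_mod :: "('a \<Rightarrow> 'b) \<Rightarrow> ('k, 'a) module \<Rightarrow> ('k, 'b) module" where
  "img_mod r M = \<lparr>carrier = r ` carrier M, monoid.mult = (\<lambda>x y. r \<zero>\<^bsub>M\<^esub>), one = r \<zero>\<^bsub>M\<^esub>,
     zero = r \<zero>\<^bsub>M\<^esub>,
     add = (\<lambda>x y. r (inv_into (carrier M) r x \<oplus>\<^bsub>M\<^esub> inv_into (carrier M) r y)),
     smult = (\<lambda>a x. r (a \<odot>\<^bsub>M\<^esub> inv_into (carrier M) r x))\<rparr>"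

definition mod_congruence :: "'k ring \<Rightarrow> ('k, 'a) module \<Rightarrow> ('a \<Rightarrow> 'b) \<Rightarrow> bool" where
  "mod_congruence R M r \<longleftrightarrow>
     (\<forall>x\<in>carrier M. \<forall>x'\<in>carrier M. r x = r x' \<longrightarrow>
        (\<forall>y\<in>carrier M. r (x \<oplus>\<^bsub>M\<^esub> y) = r (x' \<oplus>\<^bsub>M\<^esub> y)) \<and>
        (\<forall>a\<in>carrier R. r (a \<odot>\<^bsub>M\<^esub> x) = r (a \<odot>\<^bsub>M\<^esub> x')))"

lemma mod_congruence_inj: "inj_on r (carrier M) \<Longrightarrow> mod_congruence R M r"
  by (simp add: mod_congruence_def inj_on_eq_iff)

lemma img_mod_simps [simp]:
  "carrier (img_mod r M) = r ` carrier M" "\<zero>\<^bsub>img_mod r M\<^esub> = r \<zero>\<^bsub>M\<^esub>"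
  by (simp_all add: img_mod_def)

lemma img_mod_ops:
  assumes M: "Module.module R M" and r: "mod_congruence R M r"
  shows "x \<in> carrier M \<Longrightarrow> y \<in> carrier M \<Longrightarrow> r x \<oplus>\<^bsub>img_mod r M\<^esub> r y = r (x \<oplus>\<^bsub>M\<^esub> y)"
    and "a \<in> carrier R \<Longrightarrow> x \<in> carrier M \<Longrightarrow> a \<odot>\<^bsub>img_mod r M\<^esub> r x = r (a \<odot>\<^bsub>M\<^esub> x)"
proof -
  interpret Module.module R M by fact
  let ?i = "\<lambda>x. inv_into (carrier M) r (r x)"
  have i: "?i x \<in> carrier M" "r (?i x) = r x" if "x \<in> carrier M" for x
    using that by (auto intro: inv_into_into f_inv_into_f)
  show "r x \<oplus>\<^bsub>img_mod r M\<^esub> r y = r (x \<oplus>\<^bsub>M\<^esub> y)" if "x \<in> carrier M" "y \<in> carrier M"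
  proof -
    have "r (?i x \<oplus>\<^bsub>M\<^esub> ?i y) = r (x \<oplus>\<^bsub>M\<^esub> ?i y)"
      using r i that unfolding mod_congruence_def by blast
    \<comment> \<open>\<open>mod_congruence\<close> only replaces the left summand, so commutativity
      first brings the other one to the left.\<close>
    also have "\<dots> = r (?i y \<oplus>\<^bsub>M\<^esub> x)" using that i by (simp add: M.a_comm)
    also have "\<dots> = r (y \<oplus>\<^bsub>M\<^esub> x)"
      using r i that unfolding mod_congruence_def by blast
    finally show ?thesis using that by (simp add: img_mod_def M.a_comm)
  qed
  show "a \<odot>\<^bsub>img_mod r M\<^esub> r x = r (a \<odot>\<^bsub>M\<^esub> x)" if "a \<in> carrier R" "x \<in> carrier M"
  proof -
    have "r (a \<odot>\<^bsub>M\<^esub> ?i x) = r (a \<odot>\<^bsub>M\<^esub> x)"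
      using r i that unfolding mod_congruence_def by blast
    then show ?thesis by (simp add: img_mod_def)
  qed
qed

lemma img_mod_hom:
  assumes "Module.module R M" "mod_congruence R M r"
  shows "r \<in> module_hom R M (img_mod r M)"
  by (rule module_homI) (auto simp: img_mod_ops[OF assms])

lemma img_mod_module:
  assumes M: "Module.module R M" and r: "mod_congruence R M r"
  shows "Module.module R (img_mod r M)"
proof -
  interpret Module.module R M by fact
  note ops = img_mod_ops[OF M r]
  show ?thesis
  proof (rule moduleI)
    show "abelian_group (img_mod r M)"
    proof (rule abelian_groupI)
      fix x assume "x \<in> carrier (img_mod r M)"
      then obtain x' where "x' \<in> carrier M" "x = r x'" by auto
      then show "\<exists>y\<in>carrier (img_mod r M). y \<oplus>\<^bsub>img_mod r M\<^esub> x = \<zero>\<^bsub>img_mod r M\<^esub>"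
        by (intro bexI[of _ "r (\<ominus>\<^bsub>M\<^esub> x')"]) (auto simp: ops M.l_neg)
    qed (auto simp: ops M.a_assoc intro!: arg_cong[of _ _ r] M.a_comm)
  qed (auto simp: ops smult_l_distr smult_r_distr smult_assoc1 intro: R.is_cring)
qed

section \<open>VI-modules\<close>

definition VI_sub :: "nat \<Rightarrow> 'k ring \<Rightarrow> ('k, 'u) vi_module \<Rightarrow> (vi_ob \<Rightarrow> 'u set) \<Rightarrow> bool" where
  "VI_sub p K X N \<longleftrightarrow> (\<forall>V\<in>VI_ob p. submodule K (N V) (obj X V)) \<and>
     (\<forall>V\<in>VI_ob p. \<forall>W\<in>VI_ob p. \<forall>f\<in>VI_hom p V W. \<forall>x\<in>N V. arr X V W f x \<in> N W)"

definition sub_vi :: "('k, 'u) vi_module \<Rightarrow> (vi_ob \<Rightarrow> 'u set) \<Rightarrow> ('k, 'u) vi_module" where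
  "sub_vi X N = \<lparr>obj = (\<lambda>V. (obj X V)\<lparr>carrier := N V\<rparr>), arr = arr X\<rparr>"

definition img_vi :: "(vi_ob \<Rightarrow> 'u \<Rightarrow> 'w) \<Rightarrow> ('k, 'u) vi_module \<Rightarrow> ('k, 'w) vi_module" where
  "img_vi r X = \<lparr>obj = (\<lambda>V. img_mod (r V) (obj X V)),
     arr = (\<lambda>V W f y. r W (arr X V W f (inv_into (carrier (obj X V)) (r V) y)))\<rparr>"

definition VI_congruence ::
  "nat \<Rightarrow> 'k ring \<Rightarrow> ('k, 'u) vi_module \<Rightarrow> (vi_ob \<Rightarrow> 'u \<Rightarrow> 'w) \<Rightarrow> bool" where
  "VI_congruence p K X r \<longleftrightarrow> (\<forall>V\<in>VI_ob p. mod_congruence K (obj X V) (r V)) \<and>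
     (\<forall>V\<in>VI_ob p. \<forall>W\<in>VI_ob p. \<forall>f\<in>VI_hom p V W. \<forall>x\<in>carrier (obj X V). \<forall>y\<in>carrier (obj X V).
        r V x = r V y \<longrightarrow> r W (arr X V W f x) = r W (arr X V W f y))"

text \<open>Generation is phrased through all submodules containing \<open>G\<close>, so no span has
  to be written down: a generation proof takes an arbitrary \<open>N\<close> and shows that it
  contains everything.\<close>

definition VI_generates ::
  "nat \<Rightarrow> 'k ring \<Rightarrow> ('k, 'u) vi_module \<Rightarrow> (vi_ob \<times> 'u) set \<Rightarrow> bool" where
  "VI_generates p K X G \<longleftrightarrow>
     G \<subseteq> (SIGMA A:VI_ob p. carrier (obj X A)) \<and>
     (\<forall>N. VI_sub p K X N \<longrightarrow> (\<forall>(A, x)\<in>G. x \<in> N A) \<longrightarrow> (\<forall>V\<in>VI_ob p. carrier (obj X V) \<subseteq> N V))"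

lemma VI_generatesI:
  assumes "\<And>A x. (A, x) \<in> G \<Longrightarrow> A \<in> VI_ob p \<and> x \<in> carrier (obj X A)"
    and "\<And>N V x. VI_sub p K X N \<Longrightarrow> (\<And>A x. (A, x) \<in> G \<Longrightarrow> x \<in> N A) \<Longrightarrow> V \<in> VI_ob p \<Longrightarrow>
      x \<in> carrier (obj X V) \<Longrightarrow> x \<in> N V"
  shows "VI_generates p K X G"
  unfolding VI_generates_def
proof (intro conjI allI impI ballI subsetI)
  show "z \<in> (SIGMA A:VI_ob p. carrier (obj X A))" if "z \<in> G" for z
    using assms(1) that by (cases z) auto
  show "x \<in> N V" if "VI_sub p K X N" "\<forall>(A, x)\<in>G. x \<in> N A" "V \<in> VI_ob p"
    "x \<in> carrier (obj X V)" for N V x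
    by (rule assms(2)) (use that in auto)
qed

lemma VI_generatesD:
  assumes "VI_generates p K X G"
  shows "(A, x) \<in> G \<Longrightarrow> A \<in> VI_ob p" "(A, x) \<in> G \<Longrightarrow> x \<in> carrier (obj X A)"
    and "VI_sub p K X N \<Longrightarrow> (\<And>A x. (A, x) \<in> G \<Longrightarrow> x \<in> N A) \<Longrightarrow> V \<in> VI_ob p \<Longrightarrow>
      x \<in> carrier (obj X V) \<Longrightarrow> x \<in> N V"
proof -
  show "(A, x) \<in> G \<Longrightarrow> A \<in> VI_ob p" "(A, x) \<in> G \<Longrightarrow> x \<in> carrier (obj X A)"
    using assms unfolding VI_generates_def by auto
  assume N: "VI_sub p K X N" "\<And>A x. (A, x) \<in> G \<Longrightarrow> x \<in> N A" "V \<in> VI_ob p" "x \<in> carrier (obj X V)"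
  from N(2) have "\<forall>(A, x)\<in>G. x \<in> N A" by auto
  with assms N(1,3,4) show "x \<in> N V" unfolding VI_generates_def by blast
qed

lemma VI_homD:
  assumes "f \<in> VI_hom p V W"
  shows "f \<in> module_hom (residue_ring (int p)) V W" "inj_on f (carrier V)"
    "f \<in> extensional (carrier V)" "v \<in> carrier V \<Longrightarrow> f v \<in> carrier W"
  using assms by (auto simp: VI_hom_def dest: module_homD)

lemma VI_hom_compose:
  assumes f: "f \<in> VI_hom p U V" and g: "g \<in> VI_hom p V W" and U: "U \<in> VI_ob p"
  shows "compose (carrier U) g f \<in> VI_hom p U W"
proof -
  have fc: "f ` carrier U \<subseteq> carrier V" using f by (auto dest: VI_homD)
  have "Module.module (residue_ring (int p)) U"
    using U by (simp add: VI_ob_def vectorspace_def)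
  then interpret Module.module "residue_ring (int p)" U .
  note hf = module_homD[OF VI_homD(1)[OF f]] and hg = module_homD[OF VI_homD(1)[OF g]]
  have "compose (carrier U) g f \<in> module_hom (residue_ring (int p)) U W"
    using hf hg by (intro module_homI) (auto simp: compose_def)
  moreover have "inj_on (compose (carrier U) g f) (carrier U)"
    using VI_homD(2)[OF f] inj_on_subset[OF VI_homD(2)[OF g] fc]
    by (auto simp: compose_def inj_on_def)
  ultimately show ?thesis by (simp add: VI_hom_def)
qed

lemma VI_hom_id: "V \<in> VI_ob p \<Longrightarrow> (\<lambda>v\<in>carrier V. v) \<in> VI_hom p V V"
proof -
  assume V: "V \<in> VI_ob p"
  then interpret Module.module "residue_ring (int p)" V
    by (simp add: VI_ob_def vectorspace_def)
  show ?thesis by (auto simp: VI_hom_def inj_on_def intro: module_homI)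
qed

lemma compose_VI_hom_id:
  assumes "f \<in> VI_hom p V W"
  shows "compose (carrier V) f (\<lambda>v\<in>carrier V. v) = f"
    "compose (carrier V) (\<lambda>w\<in>carrier W. w) f = f"
  using VI_homD(3,4)[OF assms] by (auto simp: compose_def fun_eq_iff extensional_def)

lemma VI_hom_compose_cancel:
  assumes "f \<in> VI_hom p V W" "g \<in> VI_hom p U V" "h \<in> VI_hom p U V"
    and "compose (carrier U) f g = compose (carrier U) f h"
  shows "g = h"
proof (rule extensionalityI)
  fix u assume u: "u \<in> carrier U"
  then have "f (g u) = f (h u)" using assms(4) by (metis compose_eq)
  then show "g u = h u"
    using inj_onD[OF VI_homD(2)[OF assms(1)]] VI_homD(4)[OF assms(2) u] VI_homD(4)[OF assms(3) u]
    by blast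
qed (use assms in \<open>auto dest: VI_homD\<close>)

lemma VI_moduleD:
  assumes "VI_module p K X"
  shows "V \<in> VI_ob p \<Longrightarrow> Module.module K (obj X V)"
    and "V \<in> VI_ob p \<Longrightarrow> W \<in> VI_ob p \<Longrightarrow> f \<in> VI_hom p V W \<Longrightarrow>
           arr X V W f \<in> module_hom K (obj X V) (obj X W)"
    and "V \<in> VI_ob p \<Longrightarrow> x \<in> carrier (obj X V) \<Longrightarrow> arr X V V (\<lambda>v\<in>carrier V. v) x = x"
    and "U \<in> VI_ob p \<Longrightarrow> V \<in> VI_ob p \<Longrightarrow> W \<in> VI_ob p \<Longrightarrow> f \<in> VI_hom p U V \<Longrightarrow> g \<in> VI_hom p V W \<Longrightarrow>
           x \<in> carrier (obj X U) \<Longrightarrow>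
           arr X U W (compose (carrier U) g f) x = arr X V W g (arr X U V f x)"
  using assms unfolding VI_module_def by blast+

lemma VI_module_arrD:
  assumes "VI_module p K X" "V \<in> VI_ob p" "W \<in> VI_ob p" "f \<in> VI_hom p V W"
  shows "x \<in> carrier (obj X V) \<Longrightarrow> arr X V W f x \<in> carrier (obj X W)"
    and "x \<in> carrier (obj X V) \<Longrightarrow> y \<in> carrier (obj X V) \<Longrightarrow>
      arr X V W f (x \<oplus>\<^bsub>obj X V\<^esub> y) = arr X V W f x \<oplus>\<^bsub>obj X W\<^esub> arr X V W f y"
    and "a \<in> carrier K \<Longrightarrow> x \<in> carrier (obj X V) \<Longrightarrow>
      arr X V W f (a \<odot>\<^bsub>obj X V\<^esub> x) = a \<odot>\<^bsub>obj X W\<^esub> arr X V W f x"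
    and "arr X V W f \<zero>\<^bsub>obj X V\<^esub> = \<zero>\<^bsub>obj X W\<^esub>"
  using module_homD[OF VI_moduleD(2)[OF assms]]
    module_hom_zero[OF VI_moduleD(1)[OF assms(1,2)] VI_moduleD(1)[OF assms(1,3)] VI_moduleD(2)[OF assms]]
  by auto

lemma VI_nat_transD:
  assumes "VI_nat_trans p K X Y \<eta>" "V \<in> VI_ob p"
  shows "\<eta> V \<in> module_hom K (obj X V) (obj Y V)"
    and "W \<in> VI_ob p \<Longrightarrow> f \<in> VI_hom p V W \<Longrightarrow> x \<in> carrier (obj X V) \<Longrightarrow>
      \<eta> W (arr X V W f x) = arr Y V W f (\<eta> V x)"
  using assms unfolding VI_nat_trans_def by blast+

lemma VI_subD:
  assumes "VI_sub p K X N" "V \<in> VI_ob p"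
  shows "submodule K (N V) (obj X V)"
    and "W \<in> VI_ob p \<Longrightarrow> f \<in> VI_hom p V W \<Longrightarrow> x \<in> N V \<Longrightarrow> arr X V W f x \<in> N W"
  using assms unfolding VI_sub_def by blast+

lemma VI_sub_iff:
  assumes "VI_module p K X"
  shows "VI_sub p K X N \<longleftrightarrow>
    (\<forall>V\<in>VI_ob p. N V \<subseteq> carrier (obj X V) \<and> \<zero>\<^bsub>obj X V\<^esub> \<in> N V \<and>
       (\<forall>x\<in>N V. \<forall>y\<in>N V. x \<oplus>\<^bsub>obj X V\<^esub> y \<in> N V) \<and>
       (\<forall>a\<in>carrier K. \<forall>x\<in>N V. a \<odot>\<^bsub>obj X V\<^esub> x \<in> N V)) \<and>
    (\<forall>V\<in>VI_ob p. \<forall>W\<in>VI_ob p. \<forall>f\<in>VI_hom p V W. \<forall>x\<in>N V. arr X V W f x \<in> N W)"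
  unfolding VI_sub_def using submodule_iff[OF VI_moduleD(1)[OF assms]] by simp

lemma VI_sub_closed:
  assumes "VI_module p K X" "VI_sub p K X N" "V \<in> VI_ob p"
  shows "x \<in> N V \<Longrightarrow> x \<in> carrier (obj X V)" "\<zero>\<^bsub>obj X V\<^esub> \<in> N V"
    "x \<in> N V \<Longrightarrow> y \<in> N V \<Longrightarrow> x \<oplus>\<^bsub>obj X V\<^esub> y \<in> N V"
    "a \<in> carrier K \<Longrightarrow> x \<in> N V \<Longrightarrow> a \<odot>\<^bsub>obj X V\<^esub> x \<in> N V"
  using assms unfolding VI_sub_iff[OF assms(1)] by auto

lemma VI_sub_image:
  assumes X: "VI_module p K X" and Y: "VI_module p K Y" and \<eta>: "VI_nat_trans p K X Y \<eta>"
  shows "VI_sub p K Y (\<lambda>V. \<eta> V ` carrier (obj X V))"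
  unfolding VI_sub_def
  using submodule_image[OF VI_moduleD(1)[OF X] VI_moduleD(1)[OF Y] VI_nat_transD(1)[OF \<eta>]]
    VI_module_arrD(1)[OF X] VI_nat_transD(2)[OF \<eta>, symmetric]
  by (auto simp: image_iff)

lemma VI_sub_vimage:
  assumes X: "VI_module p K X" and Y: "VI_module p K Y" and \<eta>: "VI_nat_trans p K X Y \<eta>"
    and N: "VI_sub p K Y N"
  shows "VI_sub p K X (\<lambda>V. {x \<in> carrier (obj X V). \<eta> V x \<in> N V})"
proof -
  note hom = module_homD[OF VI_nat_transD(1)[OF \<eta>]]
  have "\<eta> V \<zero>\<^bsub>obj X V\<^esub> = \<zero>\<^bsub>obj Y V\<^esub>" if "V \<in> VI_ob p" for V
    using module_hom_zero[OF VI_moduleD(1)[OF X that] VI_moduleD(1)[OF Y that] VI_nat_transD(1)[OF \<eta> that]] .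
  then show ?thesis
    unfolding VI_sub_iff[OF X]
    using VI_sub_closed[OF Y N] VI_module_arrD(1)[OF X] VI_nat_transD(2)[OF \<eta>] VI_subD(2)[OF N] hom
      module_closed[OF VI_moduleD(1)[OF X]]
    by auto
qed

lemma VI_sub_kernel:
  assumes X: "VI_module p K X" and Y: "VI_module p K Y" and \<eta>: "VI_nat_trans p K X Y \<eta>"
  shows "VI_sub p K X (\<lambda>V. {x \<in> carrier (obj X V). \<eta> V x = \<zero>\<^bsub>obj Y V\<^esub>})"
  unfolding VI_sub_def
  using submodule_kernel[OF VI_moduleD(1)[OF X] VI_moduleD(1)[OF Y] VI_nat_transD(1)[OF \<eta>]]
    VI_module_arrD(1,4)[OF X] VI_module_arrD(4)[OF Y] VI_nat_transD(2)[OF \<eta>]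
  by auto

lemma sub_vi_simps [simp]:
  "carrier (obj (sub_vi X N) V) = N V" "\<zero>\<^bsub>obj (sub_vi X N) V\<^esub> = \<zero>\<^bsub>obj X V\<^esub>"
  "x \<oplus>\<^bsub>obj (sub_vi X N) V\<^esub> y = x \<oplus>\<^bsub>obj X V\<^esub> y" "a \<odot>\<^bsub>obj (sub_vi X N) V\<^esub> x = a \<odot>\<^bsub>obj X V\<^esub> x"
  "arr (sub_vi X N) = arr X"
  by (simp_all add: sub_vi_def)

lemma VI_module_sub_vi:
  assumes X: "VI_module p K X" and N: "VI_sub p K X N"
  shows "VI_module p K (sub_vi X N)"
proof -
  have "Module.module K (obj (sub_vi X N) V)" if "V \<in> VI_ob p" for V
  proof -
    interpret Module.module K "obj X V" using VI_moduleD(1)[OF X that] .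
    show ?thesis
      using submodule_is_module[OF VI_subD(1)[OF N that]] by (simp add: sub_vi_def)
  qed
  moreover note VI_module_arrD[OF X] VI_sub_closed(1)[OF X N] VI_subD(2)[OF N]
  then have "arr X V W f \<in> module_hom K (obj (sub_vi X N) V) (obj (sub_vi X N) W)"
    if "V \<in> VI_ob p" "W \<in> VI_ob p" "f \<in> VI_hom p V W" for V W f
    using that by (intro module_homI) simp_all
  ultimately show ?thesis
    unfolding VI_module_def
    using VI_sub_closed(1)[OF X N] VI_moduleD(3,4)[OF X] by simp
qed

lemma img_vi_simps [simp]: "obj (img_vi r X) V = img_mod (r V) (obj X V)"
  by (simp add: img_vi_def)

lemma img_vi_arr:
  assumes "VI_congruence p K X r" "V \<in> VI_ob p" "W \<in> VI_ob p" "f \<in> VI_hom p V W"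
    and "x \<in> carrier (obj X V)"
  shows "arr (img_vi r X) V W f (r V x) = r W (arr X V W f x)"
proof -
  let ?i = "inv_into (carrier (obj X V)) (r V) (r V x)"
  have "?i \<in> carrier (obj X V)" "r V ?i = r V x"
    using assms(5) by (auto intro: inv_into_into f_inv_into_f)
  then have "r W (arr X V W f ?i) = r W (arr X V W f x)"
    using assms unfolding VI_congruence_def by blast
  then show ?thesis by (simp add: img_vi_def)
qed

lemma VI_congruence_inj:
  assumes "\<And>V. V \<in> VI_ob p \<Longrightarrow> inj_on (r V) (carrier (obj X V))"
  shows "VI_congruence p K X r"
  unfolding VI_congruence_def
proof (intro conjI ballI impI)
  show "mod_congruence K (obj X V) (r V)" if "V \<in> VI_ob p" for V
    using mod_congruence_inj assms[OF that] .
qed (simp add: inj_on_eq_iff[OF assms])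

lemma VI_congruenceD: "VI_congruence p K X r \<Longrightarrow> V \<in> VI_ob p \<Longrightarrow> mod_congruence K (obj X V) (r V)"
  unfolding VI_congruence_def by blast

lemma VI_nat_trans_img_vi:
  assumes X: "VI_module p K X" and r: "VI_congruence p K X r"
  shows "VI_nat_trans p K X (img_vi r X) r"
  unfolding VI_nat_trans_def
  using img_vi_arr[OF r] img_mod_hom[OF VI_moduleD(1)[OF X] VI_congruenceD[OF r]] by auto

lemma VI_module_img_vi:
  assumes X: "VI_module p K X" and r: "VI_congruence p K X r"
  shows "VI_module p K (img_vi r X)"
proof -
  note ops = img_mod_ops[OF VI_moduleD(1)[OF X] VI_congruenceD[OF r]]
  note arr = img_vi_arr[OF r] and arrX = VI_module_arrD[OF X]
  have 1: "arr (img_vi r X) V W f \<in> module_hom K (obj (img_vi r X) V) (obj (img_vi r X) W)"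
    if that: "V \<in> VI_ob p" "W \<in> VI_ob p" "f \<in> VI_hom p V W" for V W f
  proof -
    interpret M: Module.module K "obj X V" using VI_moduleD(1)[OF X that(1)] .
    show ?thesis
      by (rule module_homI) (auto simp: ops arr arrX that)
  qed
  show ?thesis
    unfolding VI_module_def
  proof (intro conjI ballI)
    fix V assume V: "V \<in> VI_ob p"
    show "Module.module K (obj (img_vi r X) V)"
      using img_mod_module[OF VI_moduleD(1)[OF X V] VI_congruenceD[OF r V]] by simp
    fix y assume "y \<in> carrier (obj (img_vi r X) V)"
    then obtain x where "x \<in> carrier (obj X V)" "y = r V x" by auto
    then show "arr (img_vi r X) V V (\<lambda>v\<in>carrier V. v) y = y"
      by (simp add: V arr VI_hom_id VI_moduleD(3)[OF X])
  next
    fix U V W f g y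
    assume *: "U \<in> VI_ob p" "V \<in> VI_ob p" "W \<in> VI_ob p" "f \<in> VI_hom p U V" "g \<in> VI_hom p V W"
      and "y \<in> carrier (obj (img_vi r X) U)"
    then obtain x where "x \<in> carrier (obj X U)" "y = r U x" by auto
    with * show "arr (img_vi r X) U W (compose (carrier U) g f) y
        = arr (img_vi r X) V W g (arr (img_vi r X) U V f y)"
      by (simp add: arr arrX VI_moduleD(4)[OF X] VI_hom_compose)
  qed (rule 1)
qed

text \<open>A submodule of \<open>Y\<close> containing the images of \<open>G\<close> pulls back
  along \<open>\<eta>\<close> to a submodule of \<open>X\<close> containing \<open>G\<close>, hence
  to all of \<open>X\<close>.\<close>

lemma VI_generates_surj:
  assumes X: "VI_module p K X" and Y: "VI_module p K Y" and \<eta>: "VI_nat_trans p K X Y \<eta>"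
    and surj: "\<And>V. V \<in> VI_ob p \<Longrightarrow> \<eta> V ` carrier (obj X V) = carrier (obj Y V)"
    and G: "VI_generates p K X G"
  shows "VI_generates p K Y ((\<lambda>(A, x). (A, \<eta> A x)) ` G)"
proof (rule VI_generatesI)
  fix A y assume "(A, y) \<in> (\<lambda>(A, x). (A, \<eta> A x)) ` G"
  then obtain x where "(A, x) \<in> G" "y = \<eta> A x" by auto
  then show "A \<in> VI_ob p \<and> y \<in> carrier (obj Y A)"
    using VI_generatesD(1,2)[OF G] surj[of A] by auto
next
  fix N V y
  assume N: "VI_sub p K Y N" and gen: "\<And>A x. (A, x) \<in> (\<lambda>(A, x). (A, \<eta> A x)) ` G \<Longrightarrow> x \<in> N A"
    and V: "V \<in> VI_ob p" and y: "y \<in> carrier (obj Y V)"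
  from y surj[OF V] obtain x where x: "x \<in> carrier (obj X V)" "y = \<eta> V x" by blast
  have "x \<in> {x \<in> carrier (obj X V). \<eta> V x \<in> N V}"
  proof (rule VI_generatesD(3)[OF G VI_sub_vimage[OF X Y \<eta> N] _ V x(1)])
    show "x \<in> {x \<in> carrier (obj X A). \<eta> A x \<in> N A}" if "(A, x) \<in> G" for A x
      using VI_generatesD(2)[OF G that] gen that by force
  qed
  then show "y \<in> N V" using x by blast
qed

section \<open>Finite vector spaces\<close>

lemma module_hom_comp:
  "f \<in> module_hom R M N \<Longrightarrow> g \<in> module_hom R N P \<Longrightarrow> (\<lambda>x. g (f x)) \<in> module_hom R M P"
  by (auto simp: module_homD intro!: module_homI)

lemma module_hom_inv_into:
  assumes M: "Module.module R M" and f: "f \<in> module_hom R M N" and bij: "bij_betw f (carrier M) (carrier N)"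
  shows "inv_into (carrier M) f \<in> module_hom R N M"
proof -
  let ?g = "inv_into (carrier M) f"
  have g: "?g y \<in> carrier M" "f (?g y) = y" if "y \<in> carrier N" for y
    using bij that by (auto simp: bij_betw_def intro: inv_into_into f_inv_into_f)
  have gf: "?g (f x) = x" if "x \<in> carrier M" for x
    using bij that by (simp add: bij_betw_def)
  note hom = module_homD[OF f] and cl = module_closed[OF M]
  show ?thesis
  proof (rule module_homI)
    fix x y assume "x \<in> carrier N" "y \<in> carrier N"
    then show "?g (x \<oplus>\<^bsub>N\<^esub> y) = ?g x \<oplus>\<^bsub>M\<^esub> ?g y"
      using gf[of "?g x \<oplus>\<^bsub>M\<^esub> ?g y"] by (simp add: g hom cl)
  next
    fix a x assume "a \<in> carrier R" "x \<in> carrier N"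
    then show "?g (a \<odot>\<^bsub>N\<^esub> x) = a \<odot>\<^bsub>M\<^esub> ?g x"
      using gf[of "a \<odot>\<^bsub>M\<^esub> ?g x"] by (simp add: g hom cl)
  qed (rule g)
qed

text \<open>A finite basis, re-indexed by an initial segment of \<open>nat\<close>, gives linear
  coordinates. They serve over \<open>F\<close> to classify the objects of VI and over
  \<open>K\<close> to produce functionals.\<close>

lemma fin_dim_coordinates:
  assumes V: "vectorspace F V" and fd: "vectorspace.fin_dim F V"
  obtains n \<phi> where "\<phi> \<in> module_hom F (ring.func_space F {..<n::nat}) V"
    "bij_betw \<phi> ({..<n} \<rightarrow>\<^sub>E carrier F) (carrier V)"
proof -
  interpret V: vectorspace F V by fact
  have ring: "ring F" ..
  obtain B where B: "finite B" "V.basis B" using V.finite_basis_exists fd by blast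
  then have BV: "B \<subseteq> carrier V" by (simp add: V.basis_def)
  interpret L: linear_map F "ring.func_space F B" V "\<lambda>a. V.lincomb a B"
    by (rule V.lincomb_is_linear) fact+
  have ex1: "\<exists>!a. a \<in> B \<rightarrow>\<^sub>E carrier F \<and> V.lincomb a B = v" if "v \<in> carrier V" for v
    using V.basis_criterion[OF B(1) BV] B(2) that by blast
  have bij: "bij_betw (\<lambda>a. V.lincomb a B) (B \<rightarrow>\<^sub>E carrier F) (carrier V)"
  proof (rule bij_betwI')
    fix x y assume xy: "x \<in> B \<rightarrow>\<^sub>E carrier F" "y \<in> B \<rightarrow>\<^sub>E carrier F"
    have "V.lincomb x B \<in> carrier V" using xy BV by (intro V.lincomb_closed) auto
    then show "V.lincomb x B = V.lincomb y B \<longleftrightarrow> x = y" using ex1 xy by metis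
  next
    show "V.lincomb x B \<in> carrier V" if "x \<in> B \<rightarrow>\<^sub>E carrier F" for x
      using that BV by (intro V.lincomb_closed) auto
    show "\<exists>x\<in>B \<rightarrow>\<^sub>E carrier F. y = V.lincomb x B" if "y \<in> carrier V" for y
      using ex1[OF that] by blast
  qed
  obtain h where h: "bij_betw h B {..<card B}"
    using B(1) by (metis atLeast0LessThan ex_bij_betw_finite_nat)
  then have hB: "h b < card B" if "b \<in> B" for b using that by (auto simp: bij_betw_def)
  define \<psi> where "\<psi> c = (\<lambda>b\<in>B. c (h b))" for c :: "nat \<Rightarrow> 'a"
  have \<psi>: "\<psi> \<in> module_hom F (ring.func_space F {..<card B}) (ring.func_space F B)"
  proof (rule module_homI)
    show "\<psi> x \<in> carrier (ring.func_space F B)" if "x \<in> carrier (ring.func_space F {..<card B})" for x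
      using that hB by (auto simp: ring \<psi>_def)
  qed (use hB in \<open>simp_all add: ring \<psi>_def cong: restrict_cong\<close>)
  define \<theta> where "\<theta> c = (\<lambda>i\<in>{..<card B}. c (inv_into B h i))" for c :: "'c \<Rightarrow> 'a"
  have hi: "inv_into B h i \<in> B" "h (inv_into B h i) = i" if "i < card B" for i
    using h that by (auto simp: bij_betw_def intro: inv_into_into f_inv_into_f)
  have hb: "inv_into B h (h b) = b" if "b \<in> B" for b
    using h that by (simp add: bij_betw_def)
  have "\<theta> (\<psi> c) = c" if "c \<in> {..<card B} \<rightarrow>\<^sub>E carrier F" for c
  proof
    fix i show "\<theta> (\<psi> c) i = c i"
      using that hi by (cases "i < card B") (auto simp: \<theta>_def \<psi>_def PiE_def extensional_def)
  qed
  moreover have "\<psi> (\<theta> c) = c" if "c \<in> B \<rightarrow>\<^sub>E carrier F" for c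
  proof
    fix b show "\<psi> (\<theta> c) b = c b"
      using that hb hB by (cases "b \<in> B") (auto simp: \<theta>_def \<psi>_def PiE_def extensional_def)
  qed
  moreover have "\<psi> ` ({..<card B} \<rightarrow>\<^sub>E carrier F) \<subseteq> B \<rightarrow>\<^sub>E carrier F"
    unfolding \<psi>_def
    by (intro image_subsetI restrict_PiE_iff[THEN iffD2] ballI, rule PiE_mem) (use hB in auto)
  moreover have "\<theta> ` (B \<rightarrow>\<^sub>E carrier F) \<subseteq> {..<card B} \<rightarrow>\<^sub>E carrier F"
    unfolding \<theta>_def
    by (intro image_subsetI restrict_PiE_iff[THEN iffD2] ballI, rule PiE_mem) (use hi in auto)
  ultimately have "bij_betw \<psi> ({..<card B} \<rightarrow>\<^sub>E carrier F) (B \<rightarrow>\<^sub>E carrier F)"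
    by (intro bij_betw_byWitness[where f' = \<theta>]) auto
  from bij_betw_trans[OF this bij]
  have "bij_betw (\<lambda>c. V.lincomb (\<psi> c) B) ({..<card B} \<rightarrow>\<^sub>E carrier F) (carrier V)"
    by (simp add: comp_def)
  with module_hom_comp[OF \<psi> L.f_hom] show ?thesis by (rule that)
qed

section \<open>Dimensions, standard spaces and factorisations in VI\<close>

locale VI_category =
  fixes p :: nat
  assumes p_prime: "prime p"
begin

abbreviation "F \<equiv> residue_ring (int p)"

sublocale F: field F
proof -
  interpret residues_prime p "residue_ring (int p)" by (simp add: residues_prime_def p_prime)
  show "field (residue_ring (int p))" by (rule field_axioms)
qed

lemma finite_F: "finite (carrier F)" and card_F: "card (carrier F) = p"
  using prime_gt_0_nat[OF p_prime] by (auto simp: residue_ring_def)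

lemma p_gt_1: "1 < p" using p_prime prime_gt_1_nat by blast

lemma F_ring: "ring F" ..

lemma VI_ob_module: "V \<in> VI_ob p \<Longrightarrow> Module.module F V"
  by (simp add: VI_ob_def vectorspace_def)

lemma VI_ob_coordinates:
  assumes "V \<in> VI_ob p"
  obtains n \<phi> where "\<phi> \<in> module_hom F (ring.func_space F {..<n::nat}) V"
    "bij_betw \<phi> ({..<n} \<rightarrow>\<^sub>E carrier F) (carrier V)"
  using fin_dim_coordinates[of F V] assms that by (auto simp: VI_ob_def)

lemma card_coordinates: "card ({..<n} \<rightarrow>\<^sub>E carrier F) = p ^ n"
  by (simp add: card_PiE card_F)

lemma VI_ob_card:
  assumes "V \<in> VI_ob p"
  obtains n where "card (carrier V) = p ^ n"
  using VI_ob_coordinates[OF assms] card_coordinates bij_betw_same_card by metis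

text \<open>The dimension is read off from the cardinality, so that comparing dimensions becomes
  counting points.\<close>

definition vdim :: "vi_ob \<Rightarrow> nat" where
  "vdim V = (THE n. card (carrier V) = p ^ n)"

lemma vdimI: "card (carrier V) = p ^ n \<Longrightarrow> vdim V = n"
  unfolding vdim_def using p_gt_1 by (auto intro!: the_equality)

lemma card_vdim: "V \<in> VI_ob p \<Longrightarrow> card (carrier V) = p ^ vdim V"
  using VI_ob_card vdimI by metis

lemma VI_ob_finite: "V \<in> VI_ob p \<Longrightarrow> finite (carrier V)"
  using card_vdim p_gt_1 by (metis card.infinite not_one_less_zero power_not_zero)

lemma VI_obI: "Module.module F V \<Longrightarrow> finite (carrier V) \<Longrightarrow> V \<in> VI_ob p"
proof -
  assume V: "Module.module F V" and finV: "finite (carrier V)"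
  have vs: "vectorspace F V" using V F.field_axioms by (simp add: vectorspace_def)
  interpret vectorspace F V by (rule vs)
  \<comment> \<open>The whole carrier serves as a finite spanning set.\<close>
  have "span (carrier V) = carrier V"
    using in_own_span[of "carrier V"] span_is_subset2[of "carrier V"] by blast
  then have "fin_dim" using finV unfolding fin_dim_def by (intro exI[of _ "carrier V"]) simp
  with vs show ?thesis by (simp add: VI_ob_def)
qed

lemma VI_hom_restrict:
  assumes V: "V \<in> VI_ob p" and f: "f \<in> module_hom F V W" and inj: "inj_on f (carrier V)"
  shows "restrict f (carrier V) \<in> VI_hom p V W"
  using inj module_homD[OF f] module_closed[OF VI_ob_module[OF V]]
  by (auto simp: VI_hom_def inj_on_restrict_eq intro!: module_homI)

lemma finite_VI_hom:
  assumes V: "V \<in> VI_ob p" and W: "W \<in> VI_ob p"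
  shows "finite (VI_hom p V W)"
proof (rule finite_subset)
  show "VI_hom p V W \<subseteq> carrier V \<rightarrow>\<^sub>E carrier W"
  proof
    fix f assume f: "f \<in> VI_hom p V W"
    show "f \<in> carrier V \<rightarrow>\<^sub>E carrier W" using VI_homD(3,4)[OF f] by (auto simp: PiE_def)
  qed
  show "finite (carrier V \<rightarrow>\<^sub>E carrier W)"
    using VI_ob_finite[OF V] VI_ob_finite[OF W] by (intro finite_PiE) auto
qed

lemma VI_hom_inverse:
  assumes V: "V \<in> VI_ob p" and W: "W \<in> VI_ob p" and f: "f \<in> VI_hom p V W"
    and surj: "f ` carrier V = carrier W"
  obtains g where "g \<in> VI_hom p W V" "compose (carrier V) g f = (\<lambda>v\<in>carrier V. v)"
    "compose (carrier W) f g = (\<lambda>w\<in>carrier W. w)"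
proof -
  have bij: "bij_betw f (carrier V) (carrier W)"
    using VI_homD(2)[OF f] surj by (simp add: bij_betw_def)
  let ?g = "inv_into (carrier V) f"
  have "?g \<in> module_hom F W V"
    using module_hom_inv_into[OF VI_ob_module[OF V] VI_homD(1)[OF f] bij] .
  then have "restrict ?g (carrier W) \<in> VI_hom p W V"
    using bij by (intro VI_hom_restrict W) (auto simp: bij_betw_def intro: inj_on_inv_into)
  moreover have "compose (carrier V) (restrict ?g (carrier W)) f = (\<lambda>v\<in>carrier V. v)"
    using bij by (auto simp: compose_def fun_eq_iff bij_betw_def)
  moreover have "compose (carrier W) f (restrict ?g (carrier W)) = (\<lambda>w\<in>carrier W. w)"
    using bij by (auto simp: compose_def fun_eq_iff bij_betw_def f_inv_into_f)
  ultimately show ?thesis by (rule that)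
qed

lemma VI_hom_vdim_le:
  assumes "V \<in> VI_ob p" "W \<in> VI_ob p" "f \<in> VI_hom p V W"
  shows "vdim V \<le> vdim W"
proof -
  have "card (carrier V) \<le> card (carrier W)"
    using assms VI_ob_finite by (intro card_inj_on_le[of f]) (auto dest: VI_homD)
  then show ?thesis using assms p_gt_1 by (simp add: card_vdim)
qed

lemma VI_hom_surj:
  assumes "V \<in> VI_ob p" "W \<in> VI_ob p" "f \<in> VI_hom p V W" "vdim V = vdim W"
  shows "f ` carrier V = carrier W"
  using assms VI_ob_finite card_image[of f "carrier V"]
  by (intro card_subset_eq) (auto dest: VI_homD simp: card_vdim)

text \<open>Coordinate space of dimension \<open>n\<close>, moved into \<open>nat\<close> by an
  arbitrary injection. One representative per dimension is needed because \<open>VI_ob\<close>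
  contains infinitely many isomorphic copies of each space, while generating sets have to be
  finite.\<close>

definition std :: "nat \<Rightarrow> vi_ob" where
  "std n = img_mod (SOME r. inj_on r ({..<n} \<rightarrow>\<^sub>E carrier F)) (ring.func_space F {..<n})"

lemma std_coordinates:
  obtains r where "r \<in> module_hom F (ring.func_space F {..<n}) (std n)"
    "bij_betw r ({..<n} \<rightarrow>\<^sub>E carrier F) (carrier (std n))"
    "Module.module F (std n)"
proof -
  let ?M = "ring.func_space F {..<n}"
  let ?r = "SOME r :: (nat \<Rightarrow> int) \<Rightarrow> nat. inj_on r ({..<n} \<rightarrow>\<^sub>E carrier F)"
  have "finite ({..<n} \<rightarrow>\<^sub>E carrier F)" by (intro finite_PiE) (auto simp: finite_F)
  then obtain r where "inj_on (r :: (nat \<Rightarrow> int) \<Rightarrow> nat) ({..<n} \<rightarrow>\<^sub>E carrier F)"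
    using finite_imp_inj_to_nat_seg by blast
  then have inj: "inj_on ?r ({..<n} \<rightarrow>\<^sub>E carrier F)" 
    by (rule someI[where P = "\<lambda>r. inj_on r ({..<n} \<rightarrow>\<^sub>E carrier F)"])
  have M: "Module.module F ?M" by (rule F.func_space_is_module)
  have cong: "mod_congruence F ?M ?r" using inj by (intro mod_congruence_inj) (simp add: F_ring)
  show ?thesis
  proof (rule that)
    show "?r \<in> module_hom F ?M (std n)" unfolding std_def by (rule img_mod_hom[OF M cong])
    show "bij_betw ?r ({..<n} \<rightarrow>\<^sub>E carrier F) (carrier (std n))"
      using inj by (simp add: std_def bij_betw_def F_ring)
    show "Module.module F (std n)" unfolding std_def by (rule img_mod_module[OF M cong])
  qed
qed

lemma std_VI_ob [simp]: "std n \<in> VI_ob p" and vdim_std [simp]: "vdim (std n) = n"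
proof -
  obtain r where r: "bij_betw r ({..<n} \<rightarrow>\<^sub>E carrier F) (carrier (std n))"
    and M: "Module.module F (std n)" by (rule std_coordinates)
  have card: "card (carrier (std n)) = p ^ n"
    using bij_betw_same_card[OF r] card_coordinates by simp
  then have "finite (carrier (std n))" using p_gt_1 by (metis card.infinite not_one_less_zero power_not_zero)
  with M show "std n \<in> VI_ob p" by (rule VI_obI)
  show "vdim (std n) = n" using card by (rule vdimI)
qed

lemma std_iso:
  assumes V: "V \<in> VI_ob p"
  obtains f where "f \<in> VI_hom p (std (vdim V)) V" "f ` carrier (std (vdim V)) = carrier V"
proof -
  obtain n \<phi> where \<phi>: "\<phi> \<in> module_hom F (ring.func_space F {..<n::nat}) V"
    "bij_betw \<phi> ({..<n} \<rightarrow>\<^sub>E carrier F) (carrier V)" using VI_ob_coordinates[OF V] .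
  have n: "vdim V = n" using bij_betw_same_card[OF \<phi>(2)] card_coordinates by (intro vdimI) simp
  obtain r where r: "r \<in> module_hom F (ring.func_space F {..<n}) (std n)"
    "bij_betw r ({..<n} \<rightarrow>\<^sub>E carrier F) (carrier (std n))" "Module.module F (std n)" by (rule std_coordinates)
  let ?g = "inv_into ({..<n} \<rightarrow>\<^sub>E carrier F) r"
  have "?g \<in> module_hom F (std n) (ring.func_space F {..<n})"
    using module_hom_inv_into[OF F.func_space_is_module r(1)] r(2) by (simp add: F_ring)
  then have hom: "(\<lambda>x. \<phi> (?g x)) \<in> module_hom F (std n) V" using \<phi>(1) by (rule module_hom_comp)
  have bij: "bij_betw (\<lambda>x. \<phi> (?g x)) (carrier (std n)) (carrier V)"
    using bij_betw_trans[OF bij_betw_inv_into[OF r(2)] \<phi>(2)] by (simp add: comp_def)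
  show ?thesis
  proof (rule that)
    show "restrict (\<lambda>x. \<phi> (?g x)) (carrier (std (vdim V))) \<in> VI_hom p (std (vdim V)) V"
      using hom bij unfolding n by (intro VI_hom_restrict) (auto simp: bij_betw_def)
    show "restrict (\<lambda>x. \<phi> (?g x)) (carrier (std (vdim V))) ` carrier (std (vdim V)) = carrier V"
      using bij unfolding n by (auto simp: bij_betw_def)
  qed
qed

text \<open>Coordinate vectors of length \<open>m\<close> are padded with zeros to length
  \<open>n\<close>.\<close>

lemma std_hom_std:
  assumes "m \<le> n"
  shows "VI_hom p (std m) (std n) \<noteq> {}"
proof -
  obtain r where r: "r \<in> module_hom F (ring.func_space F {..<m}) (std m)"
    "bij_betw r ({..<m} \<rightarrow>\<^sub>E carrier F) (carrier (std m))" "Module.module F (std m)" by (rule std_coordinates)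
  obtain s where s: "s \<in> module_hom F (ring.func_space F {..<n}) (std n)"
    "bij_betw s ({..<n} \<rightarrow>\<^sub>E carrier F) (carrier (std n))" "Module.module F (std n)" by (rule std_coordinates)
  let ?g = "inv_into ({..<m} \<rightarrow>\<^sub>E carrier F) r"
  have g: "?g \<in> module_hom F (std m) (ring.func_space F {..<m})"
    using module_hom_inv_into[OF F.func_space_is_module r(1)] r(2) by (simp add: F_ring)
  let ?e = "\<lambda>c. \<lambda>i\<in>{..<n}. if i < m then c i else \<zero>\<^bsub>F\<^esub>"
  have e: "?e \<in> module_hom F (ring.func_space F {..<m}) (ring.func_space F {..<n})"
  proof (rule module_homI)
    show "?e x \<in> carrier (ring.func_space F {..<n})"
      if "x \<in> carrier (ring.func_space F {..<m})" for x
      using that unfolding func_space_simps[OF F_ring]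
      by (intro restrict_PiE_iff[THEN iffD2] ballI) (auto dest: PiE_mem)
  qed (rule ext; simp add: F_ring)+
  have inj_e: "inj_on ?e ({..<m} \<rightarrow>\<^sub>E carrier F)"
  proof (rule inj_onI)
    fix c d assume cd: "c \<in> {..<m} \<rightarrow>\<^sub>E carrier F" "d \<in> {..<m} \<rightarrow>\<^sub>E carrier F" "?e c = ?e d"
    have "c i = d i" if "i < m" for i using fun_cong[OF cd(3), of i] that assms by simp
    with cd show "c = d" by (intro PiE_ext) auto
  qed
  have "(\<lambda>x. s (?e (?g x))) \<in> module_hom F (std m) (std n)"
    by (rule module_hom_comp[OF module_hom_comp[OF g e] s(1)])
  moreover have "inj_on (\<lambda>x. s (?e (?g x))) (carrier (std m))"
  proof -
    have g': "bij_betw ?g (carrier (std m)) ({..<m} \<rightarrow>\<^sub>E carrier F)" by (rule bij_betw_inv_into[OF r(2)])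
    have e': "?e ` ({..<m} \<rightarrow>\<^sub>E carrier F) \<subseteq> {..<n} \<rightarrow>\<^sub>E carrier F"
      using module_homD(1)[OF e] unfolding func_space_simps(1)[OF F_ring] by blast
    have "inj_on (s \<circ> (?e \<circ> ?g)) (carrier (std m))"
    proof (intro comp_inj_on)
      show "inj_on s ((?e \<circ> ?g) ` carrier (std m))"
        unfolding image_comp[symmetric] bij_betw_imp_surj_on[OF g']
        by (rule inj_on_subset[OF bij_betw_imp_inj_on[OF s(2)] e'])
      show "inj_on ?e (?g ` carrier (std m))"
        unfolding bij_betw_imp_surj_on[OF g'] by (rule inj_e)
    qed (rule bij_betw_imp_inj_on[OF g'])
    then show ?thesis by (simp only: comp_def)
  qed
  ultimately show ?thesis using VI_hom_restrict[OF std_VI_ob] by blast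
qed

lemma VI_hom_nonempty:
  assumes "V \<in> VI_ob p" "W \<in> VI_ob p" "vdim V \<le> vdim W"
  obtains f where "f \<in> VI_hom p V W"
proof -
  obtain a where a: "a \<in> VI_hom p (std (vdim V)) V" "a ` carrier (std (vdim V)) = carrier V"
    using std_iso[OF assms(1)] .
  obtain a' where a': "a' \<in> VI_hom p V (std (vdim V))"
    using VI_hom_inverse[OF std_VI_ob assms(1) a] .
  obtain b where b: "b \<in> VI_hom p (std (vdim W)) W" using std_iso[OF assms(2)] .
  obtain h where h: "h \<in> VI_hom p (std (vdim V)) (std (vdim W))" using std_hom_std[OF assms(3)] by blast
  show ?thesis
    using that VI_hom_compose[OF VI_hom_compose[OF a' h assms(1)] b assms(1)] .
qed

text \<open>Both maps land in the sum of their images, which is a quotient of the direct sum of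
  \<open>V\<close> and \<open>W\<close>. The bound on \<open>m\<close> does not depend on
  \<open>U\<close>; all proofs below that a generating set of pairs can be chosen finite rest on
  it.\<close>

lemma VI_hom_pair_factor:
  assumes ob: "V \<in> VI_ob p" "W \<in> VI_ob p" "U \<in> VI_ob p"
    and f: "f \<in> VI_hom p V U" and g: "g \<in> VI_hom p W U"
  obtains m j f' g' where "m \<le> vdim V + vdim W" "j \<in> VI_hom p (std m) U"
    "f' \<in> VI_hom p V (std m)" "g' \<in> VI_hom p W (std m)"
    "f = compose (carrier V) j f'" "g = compose (carrier W) j g'"
proof -
  interpret V: Module.module F V using VI_ob_module[OF ob(1)] .
  interpret W: Module.module F W using VI_ob_module[OF ob(2)] .
  interpret U: Module.module F U using VI_ob_module[OF ob(3)] .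
  let ?N = "(\<lambda>(v, w). f v \<oplus>\<^bsub>U\<^esub> g w) ` (carrier V \<times> carrier W)"
  note hf = module_homD[OF VI_homD(1)[OF f]] and hg = module_homD[OF VI_homD(1)[OF g]]
  have f0: "f \<zero>\<^bsub>V\<^esub> = \<zero>\<^bsub>U\<^esub>" and g0: "g \<zero>\<^bsub>W\<^esub> = \<zero>\<^bsub>U\<^esub>"
    using module_hom_zero[OF _ _ VI_homD(1)[OF f]] module_hom_zero[OF _ _ VI_homD(1)[OF g]] VI_ob_module ob
    by auto
  have fN: "f v \<in> ?N" if "v \<in> carrier V" for v
    using that g0 hf by (intro image_eqI[of _ _ "(v, \<zero>\<^bsub>W\<^esub>)"]) auto
  have gN: "g w \<in> ?N" if "w \<in> carrier W" for w
    using that f0 hg by (intro image_eqI[of _ _ "(\<zero>\<^bsub>V\<^esub>, w)"]) auto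
  have NU: "?N \<subseteq> carrier U" using hf hg by auto
  have sub: "submodule F ?N U"
    unfolding submodule_iff[OF VI_ob_module[OF ob(3)]]
  proof (intro conjI ballI NU)
    show "\<zero>\<^bsub>U\<^esub> \<in> ?N" using fN[of "\<zero>\<^bsub>V\<^esub>"] f0 by simp
  next
    fix x y assume "x \<in> ?N" "y \<in> ?N"
    then obtain v w v' w' where *: "v \<in> carrier V" "v' \<in> carrier V" "w \<in> carrier W" "w' \<in> carrier W"
      "x = f v \<oplus>\<^bsub>U\<^esub> g w" "y = f v' \<oplus>\<^bsub>U\<^esub> g w'" by auto
    then show "x \<oplus>\<^bsub>U\<^esub> y \<in> ?N"
      by (intro image_eqI[of _ _ "(v \<oplus>\<^bsub>V\<^esub> v', w \<oplus>\<^bsub>W\<^esub> w')"]) (auto simp: hf hg U.M.add.m_ac)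
  next
    fix a x assume a: "a \<in> carrier F" and "x \<in> ?N"
    then obtain v w where *: "v \<in> carrier V" "w \<in> carrier W" "x = f v \<oplus>\<^bsub>U\<^esub> g w" by auto
    with a show "a \<odot>\<^bsub>U\<^esub> x \<in> ?N"
      by (intro image_eqI[of _ _ "(a \<odot>\<^bsub>V\<^esub> v, a \<odot>\<^bsub>W\<^esub> w)"]) (auto simp: hf hg U.smult_r_distr)
  qed
  let ?U = "U\<lparr>carrier := ?N\<rparr>"
  have finN: "finite ?N" using VI_ob_finite ob by simp
  have U': "?U \<in> VI_ob p" using U.submodule_is_module[OF sub] finN by (intro VI_obI) auto
  define m where "m = vdim ?U"
  obtain a where a: "a \<in> VI_hom p (std m) ?U" "a ` carrier (std m) = carrier ?U"
    using std_iso[OF U'] unfolding m_def .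
  obtain b where b: "b \<in> VI_hom p ?U (std m)" "compose (carrier ?U) a b = (\<lambda>u\<in>carrier ?U. u)"
    using VI_hom_inverse[OF std_VI_ob U' a] .
  have ab: "a (b u) = u" if "u \<in> ?N" for u
    using fun_cong[OF b(2), of u] that by (simp add: compose_def)
  have f': "f \<in> VI_hom p V ?U" and g': "g \<in> VI_hom p W ?U"
    using VI_homD[OF f] VI_homD[OF g] fN gN by (auto simp: VI_hom_def module_hom_def)
  show ?thesis
  proof (rule that)
    \<comment> \<open>Counting bounds the dimension: \<open>?N\<close> is an image of the product of
      the carriers, and all cardinalities are powers of \<open>p\<close>.\<close>
    have "card ?N \<le> card (carrier V \<times> carrier W)"
      using VI_ob_finite ob by (intro card_image_le) simp
    then have "p ^ m \<le> card (carrier V \<times> carrier W)"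
      using card_vdim[OF U'] unfolding m_def[symmetric] by simp
    then have "p ^ m \<le> p ^ (vdim V + vdim W)"
      using card_vdim ob by (simp add: card_cartesian_product power_add)
    then show "m \<le> vdim V + vdim W" using p_gt_1 by simp
    show "a \<in> VI_hom p (std m) U"
      using a NU VI_homD[OF a(1)] by (auto simp: VI_hom_def module_hom_def)
    show "compose (carrier V) b f \<in> VI_hom p V (std m)"
      by (rule VI_hom_compose[OF f' b(1) ob(1)])
    show "compose (carrier W) b g \<in> VI_hom p W (std m)"
      by (rule VI_hom_compose[OF g' b(1) ob(2)])
    show "f = compose (carrier V) a (compose (carrier V) b f)"
      using VI_homD(3)[OF f] fN by (auto simp: compose_def fun_eq_iff extensional_def ab)
    show "g = compose (carrier W) a (compose (carrier W) b g)"
      using VI_homD(3)[OF g] gN by (auto simp: compose_def fun_eq_iff extensional_def ab)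
  qed
qed

end

section \<open>Finite generation\<close>

lemma module_hom_finsum:
  assumes M: "Module.module R M" and N: "Module.module R N" and f: "f \<in> module_hom R M N"
    and I: "finite I" and x: "\<And>i. i \<in> I \<Longrightarrow> x i \<in> carrier M"
  shows "f (\<Oplus>\<^bsub>M\<^esub>i\<in>I. x i) = (\<Oplus>\<^bsub>N\<^esub>i\<in>I. f (x i))"
  using I x
proof induction
  interpret M: Module.module R M by fact
  interpret N: Module.module R N by fact
  case empty
  show ?case using module_hom_zero[OF M N f] by simp
next
  interpret M: Module.module R M by fact
  interpret N: Module.module R N by fact
  case (insert i I)
  then have "(\<lambda>i. x i) \<in> I \<rightarrow> carrier M" "(\<lambda>i. f (x i)) \<in> I \<rightarrow> carrier N"
    using module_homD(1)[OF f] by auto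
  with insert show ?case
    using module_homD[OF f] by (simp add: M.M.finsum_insert N.M.finsum_insert)
qed

lemma submodule_finsum_closed:
  assumes M: "Module.module R M" and N: "submodule R N M" and I: "finite I"
    and x: "\<And>i. i \<in> I \<Longrightarrow> x i \<in> N"
  shows "(\<Oplus>\<^bsub>M\<^esub>i\<in>I. x i) \<in> N"
  using I x
proof induction
  interpret M: Module.module R M by fact
  case empty
  show ?case using N by (simp add: submodule_def)
next
  interpret M: Module.module R M by fact
  case (insert i I)
  then have "(\<lambda>i. x i) \<in> I \<rightarrow> carrier M" "x i \<in> carrier M"
    using N by (auto simp: submodule_def)
  with insert N show ?case
    by (simp add: M.M.finsum_insert submodule_def)
qed

locale VI_setting = VI_category p + K?: field K for p and K :: "'k ring" (structure)
begin

lemma K_ring: "ring K" ..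

abbreviation free_sum :: "nat \<Rightarrow> (nat \<Rightarrow> vi_ob) \<Rightarrow> ('k, nat \<Rightarrow> (nat \<Rightarrow> nat) \<Rightarrow> 'k) vi_module" where
  "free_sum n A \<equiv> VI_direct_sum n (\<lambda>i. VI_free p K (A i))"

lemma free_sum_simps:
  "carrier (obj (free_sum n A) V) = (\<Pi>\<^sub>E i\<in>{..<n}. VI_hom p (A i) V \<rightarrow>\<^sub>E carrier K)"
  "d \<oplus>\<^bsub>obj (free_sum n A) V\<^esub> d' = (\<lambda>i\<in>{..<n}. \<lambda>g\<in>VI_hom p (A i) V. d i g \<oplus> d' i g)"
  "a \<odot>\<^bsub>obj (free_sum n A) V\<^esub> d = (\<lambda>i\<in>{..<n}. \<lambda>g\<in>VI_hom p (A i) V. a \<otimes> d i g)"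
  "arr (free_sum n A) V W f d = (\<lambda>i\<in>{..<n}. \<lambda>h\<in>VI_hom p (A i) W.
     \<Oplus>g\<in>{g \<in> VI_hom p (A i) V. compose (carrier (A i)) f g = h}. d i g)"
  by (simp_all add: VI_direct_sum_def VI_free_def K_ring cong: restrict_cong)

lemma free_sum_mem:
  assumes "\<And>i g. i < n \<Longrightarrow> g \<in> VI_hom p (A i) V \<Longrightarrow> d i g \<in> carrier K"
  shows "(\<lambda>i\<in>{..<n}. \<lambda>g\<in>VI_hom p (A i) V. d i g) \<in> carrier (obj (free_sum n A) V)"
  unfolding free_sum_simps using assms by (intro restrict_PiE_iff[THEN iffD2] ballI) auto

lemma free_sum_memD:
  "d \<in> carrier (obj (free_sum n A) V) \<Longrightarrow> i < n \<Longrightarrow> g \<in> VI_hom p (A i) V \<Longrightarrow> d i g \<in> carrier K"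
  unfolding free_sum_simps by (metis PiE_mem lessThan_iff)

lemma free_sum_restrict:
  assumes "d \<in> carrier (obj (free_sum n A) V)"
  shows "(\<lambda>i\<in>{..<n}. \<lambda>g\<in>VI_hom p (A i) V. d i g) = d"
proof -
  have "(\<lambda>g\<in>VI_hom p (A i) V. d i g) = d i" if "i < n" for i
    using assms that unfolding free_sum_simps by (intro PiE_restrict) auto
  then have "(\<lambda>i\<in>{..<n}. \<lambda>g\<in>VI_hom p (A i) V. d i g) = (\<lambda>i\<in>{..<n}. d i)"
    by (intro restrict_ext) simp
  also have "\<dots> = d" using assms unfolding free_sum_simps by (rule PiE_restrict)
  finally show ?thesis .
qed

definition free_gen :: "nat \<Rightarrow> (nat \<Rightarrow> vi_ob) \<Rightarrow> vi_ob \<Rightarrow> nat \<Rightarrow> (nat \<Rightarrow> nat) \<Rightarrow> nat \<Rightarrow> (nat \<Rightarrow> nat) \<Rightarrow> 'k" where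
  "free_gen n A V i g = (\<lambda>j\<in>{..<n}. \<lambda>h\<in>VI_hom p (A j) V. if j = i \<and> h = g then \<one> else \<zero>)"

lemma free_gen_mem: "free_gen n A V i g \<in> carrier (obj (free_sum n A) V)"
  unfolding free_gen_def by (rule free_sum_mem) simp

text \<open>The Yoneda generator: since \<open>g\<close> is cancellable, the fibre over
  \<open>g\<close> in the sum defining the action consists of the identity alone, and the other
  fibres miss it.\<close>

lemma arr_free_gen:
  assumes A: "A i \<in> VI_ob p" "i < n" and g: "g \<in> VI_hom p (A i) V"
  shows "arr (free_sum n A) (A i) V g (free_gen n A (A i) i (\<lambda>v\<in>carrier (A i). v))
    = free_gen n A V i g"
proof -
  let ?id = "\<lambda>v\<in>carrier (A i). v"
  have id: "?id \<in> VI_hom p (A i) (A i)" using VI_hom_id[OF A(1)] .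
  have "(\<Oplus>u\<in>{u \<in> VI_hom p (A j) (A i). compose (carrier (A j)) g u = h}.
      free_gen n A (A i) i ?id j u) = (if j = i \<and> h = g then \<one> else \<zero>)" (is "finsum K ?f ?S = _")
    if j: "j < n" and h: "h \<in> VI_hom p (A j) V" for j h
  proof (cases "j = i \<and> h = g")
    case True
    have "u = ?id" if "u \<in> VI_hom p (A i) (A i)" "compose (carrier (A i)) g u = g" for u
      by (rule VI_hom_compose_cancel[OF g that(1) id]) (simp only: that(2) compose_VI_hom_id(1)[OF g])
    then have "{u \<in> VI_hom p (A i) (A i). compose (carrier (A i)) g u = g} = {?id}"
      using id compose_VI_hom_id(1)[OF g] by blast
    then have S: "?S = {?id}" using True by simp
    show ?thesis unfolding S using True j id by (simp add: free_gen_def K.finsum_insert)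
  next
    case False
    have "\<not> (j = i \<and> u = ?id)" if "u \<in> ?S" for u
      using that False compose_VI_hom_id(1)[OF g] by blast
    then have "?f u = \<zero>" if "u \<in> ?S" for u
      using that j by (simp add: free_gen_def)
    then have "finsum K ?f ?S = \<zero>" by (rule K.add.finprod_one_eqI)
    with False show ?thesis by simp
  qed
  then show ?thesis
    unfolding free_sum_simps(4) by (subst (2) free_gen_def) (intro restrict_ext, simp)
qed

text \<open>By \<open>arr_free_gen\<close>, the images \<open>x i\<close> of the identities reach
  the image of every basis vector, and every element of the free sum is a finite combination of
  basis vectors.\<close>

lemma fin_gen_imp_generates:
  assumes X: "VI_module p K X" and fg: "VI_fin_gen p K X"
  obtains G where "finite G" "VI_generates p K X G"
proof -
  obtain n A \<eta> where A: "\<And>i. i < n \<Longrightarrow> A i \<in> VI_ob p"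
    and \<eta>: "VI_nat_trans p K (free_sum n A) X \<eta>"
    and surj: "\<And>V. V \<in> VI_ob p \<Longrightarrow> \<eta> V ` carrier (obj (free_sum n A) V) = carrier (obj X V)"
    using fg unfolding VI_fin_gen_def by blast
  define x where "x i = \<eta> (A i) (free_gen n A (A i) i (\<lambda>v\<in>carrier (A i). v))" for i
  have x: "x i \<in> carrier (obj X (A i))" if "i < n" for i
    unfolding x_def using module_homD(1)[OF VI_nat_transD(1)[OF \<eta> A[OF that]] free_gen_mem] .
  have "VI_generates p K X ((\<lambda>i. (A i, x i)) ` {..<n})"
  proof (rule VI_generatesI)
    show "B \<in> VI_ob p \<and> y \<in> carrier (obj X B)" if "(B, y) \<in> (\<lambda>i. (A i, x i)) ` {..<n}" for B y
      using that A x by auto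
  next
    fix N V y
    assume N: "VI_sub p K X N" and gen: "\<And>B y. (B, y) \<in> (\<lambda>i. (A i, x i)) ` {..<n} \<Longrightarrow> y \<in> N B"
      and V: "V \<in> VI_ob p" and y: "y \<in> carrier (obj X V)"
    from y surj[OF V] obtain d where d: "d \<in> carrier (obj (free_sum n A) V)" "y = \<eta> V d" by blast
    interpret M: Module.module K "obj X V" using VI_moduleD(1)[OF X V] .
    note hom = module_homD[OF VI_nat_transD(1)[OF \<eta> V]] and cl = VI_sub_closed[OF X N V]
    have e: "\<eta> V (free_gen n A V i g) \<in> N V" if "i < n" "g \<in> VI_hom p (A i) V" for i g
    proof -
      have "\<eta> V (free_gen n A V i g) = arr X (A i) V g (x i)"
        unfolding x_def arr_free_gen[of A, OF A[OF that(1)] that, symmetric]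
        by (rule VI_nat_transD(2)[OF \<eta> A[OF that(1)] V that(2) free_gen_mem])
      moreover have "x i \<in> N (A i)" using gen that(1) by blast
      ultimately show ?thesis using VI_subD(2)[OF N A[OF that(1)] V that(2)] by simp
    qed
    \<comment> \<open>\<open>part J\<close> keeps only the coordinates of \<open>d\<close> indexed
      by \<open>J\<close>, so that \<open>d\<close> is rebuilt one basis vector at a time.\<close>
    define part where
      "part J = (\<lambda>i\<in>{..<n}. \<lambda>g\<in>VI_hom p (A i) V. if (i, g) \<in> J then d i g else \<zero>)" for J
    have part: "part J \<in> carrier (obj (free_sum n A) V)" for J
      unfolding part_def by (rule free_sum_mem) (use free_sum_memD[OF d(1)] in auto)
    have "\<eta> V (part J) \<in> N V" if "finite J" "J \<subseteq> (SIGMA i:{..<n}. VI_hom p (A i) V)" for J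
      using that
    proof (induction J)
      case empty
      \<comment> \<open>The zero vector is written as a multiple by \<open>\<zero>\<close>, because
        homogeneity then gives its image directly.\<close>
      have "part {} = \<zero> \<odot>\<^bsub>obj (free_sum n A) V\<^esub> part {}"
        unfolding part_def free_sum_simps by (intro restrict_ext) simp
      then have "\<eta> V (part {}) = \<zero> \<odot>\<^bsub>obj X V\<^esub> \<eta> V (part {})"
        using hom(3)[of \<zero> "part {}"] part by simp
      then show ?case using hom(1)[OF part] cl(2) by simp
    next
      case (insert z J)
      obtain i g where z: "z = (i, g)" "i < n" "g \<in> VI_hom p (A i) V" using insert.prems by auto
      have dig: "d i g \<in> carrier K" using free_sum_memD[OF d(1) z(2,3)] .
      let ?e = "d i g \<odot>\<^bsub>obj (free_sum n A) V\<^esub> free_gen n A V i g"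
      have emem: "?e \<in> carrier (obj (free_sum n A) V)"
        unfolding free_sum_simps(3) by (rule free_sum_mem) (use dig in \<open>auto simp: free_gen_def\<close>)
      have "part (insert z J) = part J \<oplus>\<^bsub>obj (free_sum n A) V\<^esub> ?e"
        unfolding part_def free_sum_simps
        using insert.hyps(2) free_sum_memD[OF d(1)] dig z
        by (intro restrict_ext) (auto simp: free_gen_def)
      then have "\<eta> V (part (insert z J)) = \<eta> V (part J) \<oplus>\<^bsub>obj X V\<^esub> (d i g \<odot>\<^bsub>obj X V\<^esub> \<eta> V (free_gen n A V i g))"
        using hom part emem dig free_gen_mem by simp
      then show ?case using insert e z dig cl by auto
    qed
    moreover have "finite (SIGMA i:{..<n}. VI_hom p (A i) V)"
      using A finite_VI_hom V by blast
    ultimately have "\<eta> V (part (SIGMA i:{..<n}. VI_hom p (A i) V)) \<in> N V" by blast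
    moreover have "part (SIGMA i:{..<n}. VI_hom p (A i) V) = d"
      unfolding part_def by (subst (2) free_sum_restrict[OF d(1), symmetric]) (intro restrict_ext, simp)
    ultimately show "y \<in> N V" using d by simp
  qed
  then show ?thesis by (intro that) auto
qed

text \<open>The Yoneda correspondence backwards: each generator \<open>x i\<close> determines a map
  out of the free module on \<open>A i\<close>. The image of their sum is a submodule that contains
  all generators.\<close>

lemma generates_imp_fin_gen:
  assumes X: "VI_module p K X" and G: "finite G" "VI_generates p K X G"
  shows "VI_fin_gen p K X"
proof -
  obtain n :: nat and f where nf: "G = f ` {i. i < n}"
    using G(1) finite_imp_nat_seg_image_inj_on by blast
  define A where "A i = fst (f i)" for i
  define x where "x i = snd (f i)" for i
  have Ax: "(A i, x i) \<in> G" if "i < n" for i using that by (auto simp: nf A_def x_def)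
  have A: "A i \<in> VI_ob p" and x: "x i \<in> carrier (obj X (A i))" if "i < n" for i
    using VI_generatesD(1,2)[OF G(2) Ax[OF that]] by auto
  have Gx: "\<exists>i<n. B = A i \<and> y = x i" if "(B, y) \<in> G" for B y
    using that by (auto simp: nf A_def x_def) (metis fst_conv snd_conv)
  define I where "I V = (SIGMA i:{..<n}. VI_hom p (A i) V)" for V
  have finI: "finite (I V)" if "V \<in> VI_ob p" for V
    unfolding I_def using A finite_VI_hom that by blast
  define t where "t V d = (\<lambda>(i, g). d i g \<odot>\<^bsub>obj X V\<^esub> arr X (A i) V g (x i))"
    for V and d :: "nat \<Rightarrow> (nat \<Rightarrow> nat) \<Rightarrow> 'k"
  define \<eta> where "\<eta> V d = finsum (obj X V) (t V d) (I V)" for V d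
  have gx: "arr X (A i) V g (x i) \<in> carrier (obj X V)" if "(i, g) \<in> I V" "V \<in> VI_ob p" for i g V
    using VI_module_arrD(1)[OF X A _ _ x] that by (auto simp: I_def)
  have dK: "d i g \<in> carrier K" if "d \<in> carrier (obj (free_sum n A) V)" "(i, g) \<in> I V" for d V i g
    using free_sum_memD[OF that(1)] that(2) by (auto simp: I_def)
  have tmem: "t V d z \<in> carrier (obj X V)"
    if "V \<in> VI_ob p" "d \<in> carrier (obj (free_sum n A) V)" "z \<in> I V" for V d z
  proof (cases z)
    case (Pair i g)
    with that(3) have "(i, g) \<in> I V" by simp
    then show ?thesis
      using module_closed(3)[OF VI_moduleD(1)[OF X that(1)] dK[OF that(2)] gx[OF _ that(1)]]
      by (simp add: t_def Pair)
  qed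
  have hom: "\<eta> V \<in> module_hom K (obj (free_sum n A) V) (obj X V)" if V: "V \<in> VI_ob p" for V
  proof -
    interpret M: Module.module K "obj X V" using VI_moduleD(1)[OF X V] .
    have tV: "t V d \<in> I V \<rightarrow> carrier (obj X V)" if "d \<in> carrier (obj (free_sum n A) V)" for d
      using tmem[OF V that] by blast
    show ?thesis
    proof (rule module_homI)
      show "\<eta> V d \<in> carrier (obj X V)" if "d \<in> carrier (obj (free_sum n A) V)" for d
        unfolding \<eta>_def by (rule M.M.finsum_closed[OF tV[OF that]])
    next
      fix d d' assume d: "d \<in> carrier (obj (free_sum n A) V)" "d' \<in> carrier (obj (free_sum n A) V)"
      have "\<eta> V (d \<oplus>\<^bsub>obj (free_sum n A) V\<^esub> d')
        = (\<Oplus>\<^bsub>obj X V\<^esub>z\<in>I V. t V d z \<oplus>\<^bsub>obj X V\<^esub> t V d' z)"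
        unfolding \<eta>_def
      proof (rule M.M.finsum_cong'[OF refl])
        show "(\<lambda>z. t V d z \<oplus>\<^bsub>obj X V\<^esub> t V d' z) \<in> I V \<rightarrow> carrier (obj X V)"
          using tmem[OF V d(1)] tmem[OF V d(2)] by auto
        show "t V (d \<oplus>\<^bsub>obj (free_sum n A) V\<^esub> d') z = t V d z \<oplus>\<^bsub>obj X V\<^esub> t V d' z" if "z \<in> I V" for z
        proof (cases z)
          case (Pair i g)
          with that have "i < n" "g \<in> VI_hom p (A i) V" by (auto simp: I_def)
          with Pair that show ?thesis
            by (simp add: t_def free_sum_simps M.smult_l_distr dK[OF d(1)] dK[OF d(2)] gx[OF _ V])
        qed
      qed
      also have "\<dots> = \<eta> V d \<oplus>\<^bsub>obj X V\<^esub> \<eta> V d'"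
        unfolding \<eta>_def by (rule M.M.finsum_addf[OF tV[OF d(1)] tV[OF d(2)]])
      finally show "\<eta> V (d \<oplus>\<^bsub>obj (free_sum n A) V\<^esub> d') = \<eta> V d \<oplus>\<^bsub>obj X V\<^esub> \<eta> V d'" .
    next
      fix a d assume a: "a \<in> carrier K" and d: "d \<in> carrier (obj (free_sum n A) V)"
      have "\<eta> V (a \<odot>\<^bsub>obj (free_sum n A) V\<^esub> d) = (\<Oplus>\<^bsub>obj X V\<^esub>z\<in>I V. a \<odot>\<^bsub>obj X V\<^esub> t V d z)"
        unfolding \<eta>_def
      proof (rule M.M.finsum_cong'[OF refl])
        show "(\<lambda>z. a \<odot>\<^bsub>obj X V\<^esub> t V d z) \<in> I V \<rightarrow> carrier (obj X V)"
          using tmem[OF V d] a by auto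
        show "t V (a \<odot>\<^bsub>obj (free_sum n A) V\<^esub> d) z = a \<odot>\<^bsub>obj X V\<^esub> t V d z" if "z \<in> I V" for z
        proof (cases z)
          case (Pair i g)
          with that have "i < n" "g \<in> VI_hom p (A i) V" by (auto simp: I_def)
          with Pair that show ?thesis
            by (simp add: t_def free_sum_simps M.smult_assoc1 a dK[OF d] gx[OF _ V])
        qed
      qed
      also have "\<dots> = a \<odot>\<^bsub>obj X V\<^esub> \<eta> V d"
        unfolding \<eta>_def by (rule M.finsum_smult_ldistr[OF finI[OF V] a tV[OF d], symmetric])
      finally show "\<eta> V (a \<odot>\<^bsub>obj (free_sum n A) V\<^esub> d) = a \<odot>\<^bsub>obj X V\<^esub> \<eta> V d" .
    qed
  qed
  have arr_mem: "arr (free_sum n A) V W f d \<in> carrier (obj (free_sum n A) W)"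
    if d: "d \<in> carrier (obj (free_sum n A) V)" for V W f d
    unfolding free_sum_simps(4)
  proof (rule free_sum_mem)
    show "(\<Oplus>g\<in>{g \<in> VI_hom p (A i) V. compose (carrier (A i)) f g = h}. d i g) \<in> carrier K"
      if "i < n" for i h
      using free_sum_memD[OF d that] by (intro K.finsum_closed) auto
  qed
  have nat: "\<eta> W (arr (free_sum n A) V W f d) = arr X V W f (\<eta> V d)"
    if V: "V \<in> VI_ob p" and W: "W \<in> VI_ob p" and f: "f \<in> VI_hom p V W"
      and d: "d \<in> carrier (obj (free_sum n A) V)" for V W f d
  proof -
    interpret M: Module.module K "obj X V" using VI_moduleD(1)[OF X V] .
    interpret N: Module.module K "obj X W" using VI_moduleD(1)[OF X W] .
    let ?d = "arr (free_sum n A) V W f d"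
    \<comment> \<open>A morphism \<open>f\<close> permutes no coefficients but only relabels them:
      it moves the index set along the injection \<open>?c\<close>, and indices outside its image
      get coefficient zero.\<close>
    let ?c = "\<lambda>(i, g). (i, compose (carrier (A i)) f g)"
    have inj: "inj_on ?c (I V)"
      using VI_hom_compose_cancel[OF f] by (auto simp: inj_on_def I_def)
    have cI: "?c ` I V \<subseteq> I W" using VI_hom_compose[OF _ f A] by (auto simp: I_def)
    have tW: "t W ?d \<in> I W \<rightarrow> carrier (obj X W)" using tmem[OF W arr_mem[OF d]] by blast
    have dval: "?d i h = (\<Oplus>g\<in>{g \<in> VI_hom p (A i) V. compose (carrier (A i)) f g = h}. d i g)"
      if "(i, h) \<in> I W" for i h
      using that by (auto simp: free_sum_simps I_def)
    have z0: "t W ?d z = \<zero>\<^bsub>obj X W\<^esub>" if "z \<in> I W - ?c ` I V" for z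
    proof -
      obtain i h where zz: "z = (i, h)" by (cases z)
      then have z: "z = (i, h)" "(i, h) \<in> I W" "(i, h) \<notin> ?c ` I V" using that by simp_all
      have e: "{g \<in> VI_hom p (A i) V. compose (carrier (A i)) f g = h} = {}"
        using z(2,3) by (force simp: I_def)
      have "?d i h = \<zero>" using dval[OF z(2)] unfolding e by simp
      then show ?thesis using gx[OF z(2) W] by (simp add: t_def z)
    qed
    have "\<eta> W ?d = finsum (obj X W) (t W ?d) (?c ` I V)"
      unfolding \<eta>_def
      by (rule N.M.add.finprod_mono_neutral_cong_right[OF finI[OF W] cI z0 refl tW])
    also have "\<dots> = (\<Oplus>\<^bsub>obj X W\<^esub>z\<in>I V. t W ?d (?c z))"
      by (rule N.M.finsum_reindex[OF _ inj]) (use tW cI in blast)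
    also have "\<dots> = (\<Oplus>\<^bsub>obj X W\<^esub>z\<in>I V. arr X V W f (t V d z))"
    proof (rule N.M.finsum_cong'[OF refl])
      show "(\<lambda>z. arr X V W f (t V d z)) \<in> I V \<rightarrow> carrier (obj X W)"
        using VI_module_arrD(1)[OF X V W f tmem[OF V d]] by blast
      fix z assume z: "z \<in> I V"
      then obtain i g where ig: "z = (i, g)" "i < n" "g \<in> VI_hom p (A i) V" "(i, g) \<in> I V"
        by (auto simp: I_def)
      have fg: "(i, compose (carrier (A i)) f g) \<in> I W" using cI z ig by auto
      have e: "{u \<in> VI_hom p (A i) V. compose (carrier (A i)) f u = compose (carrier (A i)) f g} = {g}"
        using VI_hom_compose_cancel[OF f _ ig(3)] ig(3) by auto
      have "?d i (compose (carrier (A i)) f g) = d i g"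
        using dval[OF fg] dK[OF d ig(4)] unfolding e by (simp add: K.finsum_insert)
      moreover have "arr X (A i) W (compose (carrier (A i)) f g) (x i)
          = arr X V W f (arr X (A i) V g (x i))"
        by (rule VI_moduleD(4)[OF X A[OF ig(2)] V W ig(3) f x[OF ig(2)]])
      ultimately show "t W ?d (?c z) = arr X V W f (t V d z)"
        using VI_module_arrD(3)[OF X V W f dK[OF d ig(4)] gx[OF ig(4) V]] by (simp add: t_def ig(1))
    qed
    also have "\<dots> = arr X V W f (\<eta> V d)"
      unfolding \<eta>_def
      by (rule module_hom_finsum[OF VI_moduleD(1)[OF X V] VI_moduleD(1)[OF X W] VI_moduleD(2)[OF X V W f]
            finI[OF V] tmem[OF V d], symmetric])
    finally show ?thesis .
  qed
  have trans: "VI_nat_trans p K (free_sum n A) X \<eta>"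
    unfolding VI_nat_trans_def using hom nat by blast
  have sub: "VI_sub p K X (\<lambda>V. \<eta> V ` carrier (obj (free_sum n A) V))"
    unfolding VI_sub_iff[OF X]
  proof (intro conjI ballI)
    fix V assume V: "V \<in> VI_ob p"
    interpret M: Module.module K "obj X V" using VI_moduleD(1)[OF X V] .
    note h = module_homD[OF hom[OF V]]
    let ?D = "carrier (obj (free_sum n A) V)"
    show "\<eta> V ` ?D \<subseteq> carrier (obj X V)" using h(1) by blast
    have add: "d \<oplus>\<^bsub>obj (free_sum n A) V\<^esub> d' \<in> ?D" if "d \<in> ?D" "d' \<in> ?D" for d d'
      unfolding free_sum_simps(2)
      by (rule free_sum_mem) (use free_sum_memD[OF that(1)] free_sum_memD[OF that(2)] in auto)
    have smul: "a \<odot>\<^bsub>obj (free_sum n A) V\<^esub> d \<in> ?D" if "a \<in> carrier K" "d \<in> ?D" for a d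
      unfolding free_sum_simps(3)
      by (rule free_sum_mem) (use that(1) free_sum_memD[OF that(2)] in auto)
    \<comment> \<open>Any element of the domain would do here; its multiple by
      \<open>\<zero>\<close> is mapped to the zero of the target.\<close>
    have e: "free_gen n A V 0 undefined \<in> ?D" by (rule free_gen_mem)
    have "\<zero>\<^bsub>obj X V\<^esub> = \<eta> V (\<zero> \<odot>\<^bsub>obj (free_sum n A) V\<^esub> free_gen n A V 0 undefined)"
      using h(3)[OF _ e] h(1)[OF e] by simp
    then show "\<zero>\<^bsub>obj X V\<^esub> \<in> \<eta> V ` ?D" using smul[OF _ e] by blast
    show "y \<oplus>\<^bsub>obj X V\<^esub> y' \<in> \<eta> V ` ?D" if "y \<in> \<eta> V ` ?D" "y' \<in> \<eta> V ` ?D" for y y'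
      using that h(2)[symmetric] add by auto
    show "a \<odot>\<^bsub>obj X V\<^esub> y \<in> \<eta> V ` ?D" if "a \<in> carrier K" "y \<in> \<eta> V ` ?D" for a y
      using that h(3)[symmetric] smul by auto
  next
    fix V W f y
    assume *: "V \<in> VI_ob p" "W \<in> VI_ob p" "f \<in> VI_hom p V W" "y \<in> \<eta> V ` carrier (obj (free_sum n A) V)"
    then show "arr X V W f y \<in> \<eta> W ` carrier (obj (free_sum n A) W)"
      using nat[OF *(1-3), symmetric] arr_mem by auto
  qed
  have gens: "x i \<in> \<eta> (A i) ` carrier (obj (free_sum n A) (A i))" if i: "i < n" for i
  proof (rule image_eqI[OF _ free_gen_mem])
    interpret M: Module.module K "obj X (A i)" using VI_moduleD(1)[OF X A[OF i]] .
    let ?id = "\<lambda>v\<in>carrier (A i). v"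
    let ?e = "free_gen n A (A i) i ?id"
    have id: "(i, ?id) \<in> I (A i)" using VI_hom_id[OF A[OF i]] i by (simp add: I_def)
    have "t (A i) ?e z = (if z = (i, ?id) then x i else \<zero>\<^bsub>obj X (A i)\<^esub>)" if z: "z \<in> I (A i)" for z
    proof (cases z)
      case (Pair j h)
      then have "j < n" "h \<in> VI_hom p (A j) (A i)" using z by (auto simp: I_def)
      then show ?thesis
        using gx[of j h "A i"] z A[OF i] VI_moduleD(3)[OF X A[OF i] x[OF i]] x[OF i]
        by (auto simp: t_def free_gen_def Pair)
    qed
    then have "\<eta> (A i) ?e = (\<Oplus>\<^bsub>obj X (A i)\<^esub>z\<in>I (A i). if z = (i, ?id) then x i else \<zero>\<^bsub>obj X (A i)\<^esub>)"
      unfolding \<eta>_def using x[OF i] by (intro M.M.finsum_cong') auto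
    also have "\<dots> = x i"
      using M.M.add.finprod_singleton_swap[OF id finI[OF A[OF i]], of "\<lambda>_. x i"] x[OF i] by simp
    finally show "x i = \<eta> (A i) ?e" ..
  qed
  have "carrier (obj X V) \<subseteq> \<eta> V ` carrier (obj (free_sum n A) V)" if V: "V \<in> VI_ob p" for V
  proof
    fix y assume y: "y \<in> carrier (obj X V)"
    show "y \<in> \<eta> V ` carrier (obj (free_sum n A) V)"
      by (rule VI_generatesD(3)[OF G(2) sub _ V y]) (use Gx gens in blast)
  qed
  then have "\<eta> V ` carrier (obj (free_sum n A) V) = carrier (obj X V)" if V: "V \<in> VI_ob p" for V
    using module_homD(1)[OF hom[OF V]] V by blast
  with A trans show ?thesis unfolding VI_fin_gen_def by blast
qed

lemma fin_gen_iff_generates: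
  assumes "VI_module p K X"
  shows "VI_fin_gen p K X \<longleftrightarrow> (\<exists>G. finite G \<and> VI_generates p K X G)"
  using fin_gen_imp_generates[OF assms] generates_imp_fin_gen[OF assms] by metis

end

section \<open>Spaces of functions with values in a module\<close>

text \<open>For finite \<open>S\<close> this is the tensor product of \<open>M\<close> with the free
  module on \<open>S\<close>, a function giving the coefficient in \<open>M\<close> of each basis
  vector.\<close>

definition fun_mod :: "'s set \<Rightarrow> ('k, 'u) module \<Rightarrow> ('k, 's \<Rightarrow> 'u) module" where
  "fun_mod S M = \<lparr>carrier = S \<rightarrow>\<^sub>E carrier M, monoid.mult = (\<lambda>x y. \<lambda>s\<in>S. \<zero>\<^bsub>M\<^esub>), one = (\<lambda>s\<in>S. \<zero>\<^bsub>M\<^esub>),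
     zero = (\<lambda>s\<in>S. \<zero>\<^bsub>M\<^esub>), add = (\<lambda>x y. \<lambda>s\<in>S. x s \<oplus>\<^bsub>M\<^esub> y s),
     smult = (\<lambda>a x. \<lambda>s\<in>S. a \<odot>\<^bsub>M\<^esub> x s)\<rparr>"

lemma fun_mod_simps [simp]:
  "carrier (fun_mod S M) = S \<rightarrow>\<^sub>E carrier M" "\<zero>\<^bsub>fun_mod S M\<^esub> = (\<lambda>s\<in>S. \<zero>\<^bsub>M\<^esub>)"
  "x \<oplus>\<^bsub>fun_mod S M\<^esub> y = (\<lambda>s\<in>S. x s \<oplus>\<^bsub>M\<^esub> y s)" "a \<odot>\<^bsub>fun_mod S M\<^esub> x = (\<lambda>s\<in>S. a \<odot>\<^bsub>M\<^esub> x s)"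
  by (simp_all add: fun_mod_def)

lemma PiE_restrictI: "(\<And>s. s \<in> S \<Longrightarrow> f s \<in> T) \<Longrightarrow> (\<lambda>s\<in>S. f s) \<in> S \<rightarrow>\<^sub>E T"
  by (rule restrict_PiE_iff[THEN iffD2]) blast

lemma restrict_eqI: "c \<in> S \<rightarrow>\<^sub>E T \<Longrightarrow> (\<And>s. s \<in> S \<Longrightarrow> f s = c s) \<Longrightarrow> (\<lambda>s\<in>S. f s) = c"
  by (metis PiE_restrict restrict_ext)

lemma fun_mod_module:
  assumes M: "Module.module R M"
  shows "Module.module R (fun_mod S M)"
proof -
  interpret Module.module R M by fact
  have mem: "f s \<in> carrier M" if "f \<in> S \<rightarrow>\<^sub>E carrier M" "s \<in> S" for f s
    using that by (rule PiE_mem)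
  show ?thesis
  proof (rule moduleI)
    show "abelian_group (fun_mod S M)"
    proof (rule abelian_groupI)
      fix x assume x: "x \<in> carrier (fun_mod S M)"
      have "(\<lambda>s\<in>S. \<ominus>\<^bsub>M\<^esub> x s) \<in> carrier (fun_mod S M)"
        unfolding fun_mod_simps using x by (intro PiE_restrictI) (simp add: mem)
      moreover have "(\<lambda>s\<in>S. \<ominus>\<^bsub>M\<^esub> x s) \<oplus>\<^bsub>fun_mod S M\<^esub> x = \<zero>\<^bsub>fun_mod S M\<^esub>"
        unfolding fun_mod_simps using x by (intro restrict_ext) (simp add: mem M.l_neg)
      ultimately show "\<exists>y\<in>carrier (fun_mod S M). y \<oplus>\<^bsub>fun_mod S M\<^esub> x = \<zero>\<^bsub>fun_mod S M\<^esub>" by blast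
    next
      fix x assume "x \<in> carrier (fun_mod S M)"
      then show "\<zero>\<^bsub>fun_mod S M\<^esub> \<oplus>\<^bsub>fun_mod S M\<^esub> x = x"
        unfolding fun_mod_simps by (intro restrict_eqI) (auto simp: mem)
    next
      fix x y assume "x \<in> carrier (fun_mod S M)" "y \<in> carrier (fun_mod S M)"
      then show "x \<oplus>\<^bsub>fun_mod S M\<^esub> y = y \<oplus>\<^bsub>fun_mod S M\<^esub> x"
        unfolding fun_mod_simps by (intro restrict_ext) (simp add: mem M.a_comm)
    next
      fix x y z
      assume "x \<in> carrier (fun_mod S M)" "y \<in> carrier (fun_mod S M)" "z \<in> carrier (fun_mod S M)"
      then show "(x \<oplus>\<^bsub>fun_mod S M\<^esub> y) \<oplus>\<^bsub>fun_mod S M\<^esub> z = x \<oplus>\<^bsub>fun_mod S M\<^esub> (y \<oplus>\<^bsub>fun_mod S M\<^esub> z)"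
        unfolding fun_mod_simps by (intro restrict_ext) (simp add: mem M.a_assoc)
    next
      fix x y assume "x \<in> carrier (fun_mod S M)" "y \<in> carrier (fun_mod S M)"
      then show "x \<oplus>\<^bsub>fun_mod S M\<^esub> y \<in> carrier (fun_mod S M)"
        unfolding fun_mod_simps by (intro PiE_restrictI) (simp add: mem)
    next
      show "\<zero>\<^bsub>fun_mod S M\<^esub> \<in> carrier (fun_mod S M)"
        unfolding fun_mod_simps by (intro PiE_restrictI) simp
    qed
  next
    fix a x assume "a \<in> carrier R" "x \<in> carrier (fun_mod S M)"
    then show "a \<odot>\<^bsub>fun_mod S M\<^esub> x \<in> carrier (fun_mod S M)"
      unfolding fun_mod_simps by (intro PiE_restrictI) (simp add: mem)
  next
    fix a b x assume "a \<in> carrier R" "b \<in> carrier R" "x \<in> carrier (fun_mod S M)"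
    then show "(a \<oplus>\<^bsub>R\<^esub> b) \<odot>\<^bsub>fun_mod S M\<^esub> x = (a \<odot>\<^bsub>fun_mod S M\<^esub> x) \<oplus>\<^bsub>fun_mod S M\<^esub> (b \<odot>\<^bsub>fun_mod S M\<^esub> x)"
      and "(a \<otimes>\<^bsub>R\<^esub> b) \<odot>\<^bsub>fun_mod S M\<^esub> x = a \<odot>\<^bsub>fun_mod S M\<^esub> (b \<odot>\<^bsub>fun_mod S M\<^esub> x)"
      unfolding fun_mod_simps by (intro restrict_ext, simp add: mem smult_l_distr smult_assoc1)+
  next
    fix a x y assume "a \<in> carrier R" "x \<in> carrier (fun_mod S M)" "y \<in> carrier (fun_mod S M)"
    then show "a \<odot>\<^bsub>fun_mod S M\<^esub> (x \<oplus>\<^bsub>fun_mod S M\<^esub> y) = (a \<odot>\<^bsub>fun_mod S M\<^esub> x) \<oplus>\<^bsub>fun_mod S M\<^esub> (a \<odot>\<^bsub>fun_mod S M\<^esub> y)"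
      unfolding fun_mod_simps by (intro restrict_ext) (simp add: mem smult_r_distr)
  next
    fix x assume "x \<in> carrier (fun_mod S M)"
    then show "\<one>\<^bsub>R\<^esub> \<odot>\<^bsub>fun_mod S M\<^esub> x = x"
      unfolding fun_mod_simps by (intro restrict_eqI) (auto simp: mem)
  qed (rule R.is_cring)
qed

definition single :: "'s set \<Rightarrow> ('k, 'u) module \<Rightarrow> 's \<Rightarrow> 'u \<Rightarrow> 's \<Rightarrow> 'u" where
  "single S M g x = (\<lambda>s\<in>S. if s = g then x else \<zero>\<^bsub>M\<^esub>)"

lemma single_hom:
  assumes "Module.module R M"
  shows "single S M g \<in> module_hom R M (fun_mod S M)"
proof -
  interpret Module.module R M by fact
  show ?thesis
  proof (rule module_homI)
    show "single S M g x \<in> carrier (fun_mod S M)" if "x \<in> carrier M" for x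
      unfolding single_def fun_mod_simps using that by (intro PiE_restrictI) simp
  qed (auto simp: single_def intro!: restrict_ext)
qed

lemma eval_hom: "s \<in> S \<Longrightarrow> (\<lambda>c. c s) \<in> module_hom R (fun_mod S M) M"
  by (rule module_homI) (auto dest: PiE_mem)

lemma fun_mod_decompose:
  assumes M: "Module.module R M" and S: "finite S" and c: "c \<in> S \<rightarrow>\<^sub>E carrier M"
  shows "(\<Oplus>\<^bsub>fun_mod S M\<^esub>g\<in>S. single S M g (c g)) = c"
proof -
  interpret M: Module.module R M by fact
  interpret F: Module.module R "fun_mod S M" by (rule fun_mod_module[OF M])
  have mem: "single S M g (c g) \<in> carrier (fun_mod S M)" if "g \<in> S" for g
    by (rule module_homD(1)[OF single_hom[OF M] PiE_mem[OF c that]])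
  let ?s = "\<Oplus>\<^bsub>fun_mod S M\<^esub>g\<in>S. single S M g (c g)"
  have "?s \<in> carrier (fun_mod S M)" using mem by (intro F.M.finsum_closed Pi_I)
  then have 1: "?s \<in> S \<rightarrow>\<^sub>E carrier M" by simp
  show ?thesis
  proof (rule PiE_ext[OF 1 c])
    fix s assume s: "s \<in> S"
    have "?s s = (\<Oplus>\<^bsub>M\<^esub>g\<in>S. single S M g (c g) s)"
      using module_hom_finsum[OF fun_mod_module[OF M] M eval_hom[OF s] S mem] .
    also have "\<dots> = (\<Oplus>\<^bsub>M\<^esub>g\<in>S. if s = g then c g else \<zero>\<^bsub>M\<^esub>)"
      using s PiE_mem[OF c] by (intro M.M.finsum_cong') (simp_all add: single_def)
    also have "\<dots> = c s"
      using PiE_mem[OF c] by (intro M.M.finsum_singleton[OF s S, of c] Pi_I)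
    finally show "?s s = c s" .
  qed
qed

lemma fun_mod_submodule_eq:
  assumes M: "Module.module R M" and S: "finite S" and N: "submodule R N (fun_mod S M)"
    and single: "\<And>g x. g \<in> S \<Longrightarrow> x \<in> carrier M \<Longrightarrow> single S M g x \<in> N"
    and c: "c \<in> S \<rightarrow>\<^sub>E carrier M"
  shows "c \<in> N"
proof -
  have "(\<Oplus>\<^bsub>fun_mod S M\<^esub>g\<in>S. single S M g (c g)) \<in> N"
    by (rule submodule_finsum_closed[OF fun_mod_module[OF M] N S]) (use single PiE_mem[OF c] in blast)
  then show ?thesis unfolding fun_mod_decompose[OF M S c] .
qed

section \<open>Truncations\<close>

context VI_setting
begin

text \<open>A morphism acts as zero as soon as some dimension between source and target is missing
  from \<open>S\<close>. Asking only for the two end dimensions would break functoriality for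
  composites through a missing one.\<close>

definition trunc :: "nat set \<Rightarrow> ('k, 'u) vi_module \<Rightarrow> ('k, 'u) vi_module" where
  "trunc S X = \<lparr>obj = (\<lambda>U. (obj X U)\<lparr>carrier := if vdim U \<in> S then carrier (obj X U) else {\<zero>\<^bsub>obj X U\<^esub>}\<rparr>),
     arr = (\<lambda>U V f x. if {vdim U..vdim V} \<subseteq> S then arr X U V f x else \<zero>\<^bsub>obj X V\<^esub>)\<rparr>"

lemma trunc_simps [simp]:
  "carrier (obj (trunc S X) U) = (if vdim U \<in> S then carrier (obj X U) else {\<zero>\<^bsub>obj X U\<^esub>})"
  "\<zero>\<^bsub>obj (trunc S X) U\<^esub> = \<zero>\<^bsub>obj X U\<^esub>"
  "x \<oplus>\<^bsub>obj (trunc S X) U\<^esub> y = x \<oplus>\<^bsub>obj X U\<^esub> y" "a \<odot>\<^bsub>obj (trunc S X) U\<^esub> x = a \<odot>\<^bsub>obj X U\<^esub> x"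
  "arr (trunc S X) U V f x = (if {vdim U..vdim V} \<subseteq> S then arr X U V f x else \<zero>\<^bsub>obj X V\<^esub>)"
  by (simp_all add: trunc_def)

lemma module_trunc:
  assumes "VI_module p K X" "U \<in> VI_ob p"
  shows "Module.module K (obj (trunc S X) U)"
proof -
  interpret M: Module.module K "obj X U" using VI_moduleD(1)[OF assms] .
  have "submodule K (if vdim U \<in> S then carrier (obj X U) else {\<zero>\<^bsub>obj X U\<^esub>}) (obj X U)"
    using M.module_axioms by (auto simp: submodule_iff[OF VI_moduleD(1)[OF assms]])
  from M.submodule_is_module[OF this] show ?thesis by (simp add: trunc_def)
qed

lemma interval_subset_split:
  "a \<le> b \<Longrightarrow> b \<le> c \<Longrightarrow> {a..c} \<subseteq> S \<longleftrightarrow> {a..b} \<subseteq> S \<and> {b..c} \<subseteq> S" for a b c :: nat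
proof -
  assume "a \<le> b" "b \<le> c"
  then have "{a..c} = {a..b} \<union> {b..c}" by auto
  then show ?thesis by simp
qed

lemma VI_module_trunc:
  assumes X: "VI_module p K X"
  shows "VI_module p K (trunc S X)"
  unfolding VI_module_def
proof (intro conjI ballI)
  show "Module.module K (obj (trunc S X) V)" if "V \<in> VI_ob p" for V
    using module_trunc[OF X that] .
next
  fix V W f assume V: "V \<in> VI_ob p" and W: "W \<in> VI_ob p" and f: "f \<in> VI_hom p V W"
  interpret N: Module.module K "obj X W" using VI_moduleD(1)[OF X W] .
  note arr = VI_module_arrD[OF X V W f]
  have le: "vdim V \<le> vdim W" using VI_hom_vdim_le[OF V W f] .
  show "arr (trunc S X) V W f \<in> module_hom K (obj (trunc S X) V) (obj (trunc S X) W)"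
  proof (cases "{vdim V..vdim W} \<subseteq> S")
    case True
    then have "vdim V \<in> S" "vdim W \<in> S" using le by auto
    with True arr show ?thesis by (intro module_homI) simp_all
  next
    case False
    then show ?thesis by (intro module_homI) simp_all
  qed
next
  fix V x assume V: "V \<in> VI_ob p" and x: "x \<in> carrier (obj (trunc S X) V)"
  then show "arr (trunc S X) V V (\<lambda>v\<in>carrier V. v) x = x"
    using VI_moduleD(3)[OF X V] by (cases "vdim V \<in> S") simp_all
next
  fix U V W f g x
  assume U: "U \<in> VI_ob p" and V: "V \<in> VI_ob p" and W: "W \<in> VI_ob p"
    and f: "f \<in> VI_hom p U V" and g: "g \<in> VI_hom p V W" and x: "x \<in> carrier (obj (trunc S X) U)"
  have x': "x \<in> carrier (obj X U)"
    using x module_closed(1)[OF VI_moduleD(1)[OF X U]] by (auto split: if_splits)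
  have le: "vdim U \<le> vdim V" "vdim V \<le> vdim W"
    using VI_hom_vdim_le[OF U V f] VI_hom_vdim_le[OF V W g] by auto
  show "arr (trunc S X) U W (compose (carrier U) g f) x
      = arr (trunc S X) V W g (arr (trunc S X) U V f x)"
    using interval_subset_split[OF le, of S] VI_moduleD(4)[OF X U V W f g x'] VI_module_arrD(4)[OF X V W g]
    by simp
qed

section \<open>Tensor products with free modules\<close>

text \<open>The tensor product of \<open>X\<close> with the free module on \<open>W\<close>, where
  \<open>c g\<close> is the coefficient of the basis vector \<open>g\<close>. Composition with an
  injection is injective on basis vectors, so a transition map moves coefficients to new places and
  never adds any up.\<close>

definition ext :: "vi_ob \<Rightarrow> ('k, 'u) vi_module \<Rightarrow> ('k, (nat \<Rightarrow> nat) \<Rightarrow> 'u) vi_module" where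
  "ext W X = \<lparr>obj = (\<lambda>U. fun_mod (VI_hom p W U) (obj X U)),
     arr = (\<lambda>U V f c. \<lambda>h\<in>VI_hom p W V.
       if h \<in> compose (carrier W) f ` VI_hom p W U
       then arr X U V f (c (inv_into (VI_hom p W U) (compose (carrier W) f) h))
       else \<zero>\<^bsub>obj X V\<^esub>)\<rparr>"

lemma ext_obj [simp]: "obj (ext W X) U = fun_mod (VI_hom p W U) (obj X U)"
  by (simp add: ext_def)

lemma ext_arr:
  assumes "W \<in> VI_ob p" "f \<in> VI_hom p U V"
  shows "g \<in> VI_hom p W U \<Longrightarrow> arr (ext W X) U V f c (compose (carrier W) f g) = arr X U V f (c g)"
    and "h \<in> VI_hom p W V \<Longrightarrow> h \<notin> compose (carrier W) f ` VI_hom p W U \<Longrightarrow>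
      arr (ext W X) U V f c h = \<zero>\<^bsub>obj X V\<^esub>"
proof -
  assume g: "g \<in> VI_hom p W U"
  have "inj_on (compose (carrier W) f) (VI_hom p W U)"
    using VI_hom_compose_cancel[OF assms(2)] by (auto simp: inj_on_def)
  then show "arr (ext W X) U V f c (compose (carrier W) f g) = arr X U V f (c g)"
    using g VI_hom_compose[OF g assms(2,1)] by (simp add: ext_def)
qed (simp add: ext_def)

lemma ext_arr_restrict: "arr (ext W X) U V f c \<in> extensional (VI_hom p W V)"
  by (simp add: ext_def)

lemma ext_arr_mem:
  assumes X: "VI_module p K X" and ob: "W \<in> VI_ob p" "U \<in> VI_ob p" "V \<in> VI_ob p"
    and f: "f \<in> VI_hom p U V" and c: "c \<in> VI_hom p W U \<rightarrow>\<^sub>E carrier (obj X U)"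
  shows "arr (ext W X) U V f c \<in> VI_hom p W V \<rightarrow>\<^sub>E carrier (obj X V)"
proof (rule PiE_I)
  fix h assume h: "h \<in> VI_hom p W V"
  show "arr (ext W X) U V f c h \<in> carrier (obj X V)"
  proof (cases "h \<in> compose (carrier W) f ` VI_hom p W U")
    case True
    then obtain g where g: "g \<in> VI_hom p W U" "h = compose (carrier W) f g" by blast
    show ?thesis
      unfolding g(2) ext_arr(1)[OF ob(1) f g(1)]
      by (rule VI_module_arrD(1)[OF X ob(2,3) f PiE_mem[OF c g(1)]])
  next
    case False
    show ?thesis
      unfolding ext_arr(2)[OF ob(1) f h False] by (rule module_closed(1)[OF VI_moduleD(1)[OF X ob(3)]])
  qed
next
  show "arr (ext W X) U V f c h = undefined" if "h \<notin> VI_hom p W V" for h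
    using ext_arr_restrict that by (rule extensional_arb)
qed

lemma ext_arr_eqI:
  assumes X: "VI_module p K X" and ob: "W \<in> VI_ob p" "U \<in> VI_ob p" "V \<in> VI_ob p"
    and f: "f \<in> VI_hom p U V" and c: "c \<in> VI_hom p W U \<rightarrow>\<^sub>E carrier (obj X U)"
    and d: "d \<in> VI_hom p W V \<rightarrow>\<^sub>E carrier (obj X V)"
    and 1: "\<And>g. g \<in> VI_hom p W U \<Longrightarrow> d (compose (carrier W) f g) = arr X U V f (c g)"
    and 2: "\<And>h. h \<in> VI_hom p W V \<Longrightarrow> h \<notin> compose (carrier W) f ` VI_hom p W U \<Longrightarrow> d h = \<zero>\<^bsub>obj X V\<^esub>"
  shows "arr (ext W X) U V f c = d"
proof (rule PiE_ext[OF ext_arr_mem[OF X ob f c] d])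
  fix h assume h: "h \<in> VI_hom p W V"
  show "arr (ext W X) U V f c h = d h"
  proof (cases "h \<in> compose (carrier W) f ` VI_hom p W U")
    case True
    then obtain g where g: "g \<in> VI_hom p W U" "h = compose (carrier W) f g" by blast
    show ?thesis unfolding g(2) ext_arr(1)[OF ob(1) f g(1)] 1[OF g(1)] ..
  next
    case False
    show ?thesis unfolding ext_arr(2)[OF ob(1) f h False] 2[OF h False] ..
  qed
qed

lemma VI_hom_compose_assoc:
  assumes "f \<in> VI_hom p U V" "g \<in> VI_hom p W U"
  shows "compose (carrier W) (compose (carrier U) h f) g = compose (carrier W) h (compose (carrier W) f g)"
  using VI_homD(4)[OF assms(2)] by (auto simp: compose_def fun_eq_iff)

lemma VI_module_ext:
  assumes X: "VI_module p K X" and W: "W \<in> VI_ob p"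
  shows "VI_module p K (ext W X)"
  unfolding VI_module_def
proof (intro conjI ballI)
  show "Module.module K (obj (ext W X) V)" if "V \<in> VI_ob p" for V
    unfolding ext_obj by (rule fun_mod_module[OF VI_moduleD(1)[OF X that]])
next
  fix U V f assume U: "U \<in> VI_ob p" and V: "V \<in> VI_ob p" and f: "f \<in> VI_hom p U V"
  interpret M: Module.module K "obj X V" using VI_moduleD(1)[OF X V] .
  note arr = VI_module_arrD[OF X U V f] and mem = ext_arr_mem[OF X W U V f]
  note cl = module_closed[OF fun_mod_module[OF VI_moduleD(1)[OF X U]], unfolded fun_mod_simps]
    module_closed[OF fun_mod_module[OF VI_moduleD(1)[OF X V]], unfolded fun_mod_simps]
  note e = ext_arr[OF W f]
  show "arr (ext W X) U V f \<in> module_hom K (obj (ext W X) U) (obj (ext W X) V)"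
    unfolding ext_obj
  proof (rule module_homI, unfold fun_mod_simps)
    fix c d assume c: "c \<in> VI_hom p W U \<rightarrow>\<^sub>E carrier (obj X U)" and d: "d \<in> VI_hom p W U \<rightarrow>\<^sub>E carrier (obj X U)"
    show "arr (ext W X) U V f (\<lambda>s\<in>VI_hom p W U. c s \<oplus>\<^bsub>obj X U\<^esub> d s)
        = (\<lambda>s\<in>VI_hom p W V. arr (ext W X) U V f c s \<oplus>\<^bsub>obj X V\<^esub> arr (ext W X) U V f d s)"
      by (rule ext_arr_eqI[OF X W U V f cl(2)[OF c d] cl(5)[OF mem[OF c] mem[OF d]]])
        (simp_all add: e VI_hom_compose[OF _ f W] arr(2) PiE_mem[OF c] PiE_mem[OF d])
  next
    fix a c assume a: "a \<in> carrier K" and c: "c \<in> VI_hom p W U \<rightarrow>\<^sub>E carrier (obj X U)"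
    show "arr (ext W X) U V f (\<lambda>s\<in>VI_hom p W U. a \<odot>\<^bsub>obj X U\<^esub> c s)
        = (\<lambda>s\<in>VI_hom p W V. a \<odot>\<^bsub>obj X V\<^esub> arr (ext W X) U V f c s)"
      by (rule ext_arr_eqI[OF X W U V f cl(3)[OF a c] cl(6)[OF a mem[OF c]]])
        (simp_all add: e VI_hom_compose[OF _ f W] arr(3) a PiE_mem[OF c])
  qed (rule mem)
next
  fix V c assume V: "V \<in> VI_ob p" and "c \<in> carrier (obj (ext W X) V)"
  then have c: "c \<in> VI_hom p W V \<rightarrow>\<^sub>E carrier (obj X V)" by simp
  have id: "compose (carrier W) (\<lambda>v\<in>carrier V. v) h = h" if "h \<in> VI_hom p W V" for h
    by (rule compose_VI_hom_id(2)[OF that])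
  show "arr (ext W X) V V (\<lambda>v\<in>carrier V. v) c = c"
  proof (rule ext_arr_eqI[OF X W V V VI_hom_id[OF V] c c])
    show "c (compose (carrier W) (\<lambda>v\<in>carrier V. v) g) = arr X V V (\<lambda>v\<in>carrier V. v) (c g)"
      if "g \<in> VI_hom p W V" for g
      using VI_moduleD(3)[OF X V PiE_mem[OF c that]] id[OF that] by simp
    show "c h = \<zero>\<^bsub>obj X V\<^esub>"
      if "h \<in> VI_hom p W V" "h \<notin> compose (carrier W) (\<lambda>v\<in>carrier V. v) ` VI_hom p W V" for h
      using that id[OF that(1)] by (metis image_eqI)
  qed
next
  fix U V T f g c
  assume ob: "U \<in> VI_ob p" "V \<in> VI_ob p" "T \<in> VI_ob p"
    and f: "f \<in> VI_hom p U V" and g: "g \<in> VI_hom p V T" and "c \<in> carrier (obj (ext W X) U)"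
  then have c: "c \<in> VI_hom p W U \<rightarrow>\<^sub>E carrier (obj X U)" by simp
  have gf: "compose (carrier U) g f \<in> VI_hom p U T" by (rule VI_hom_compose[OF f g ob(1)])
  have fc: "arr (ext W X) U V f c \<in> VI_hom p W V \<rightarrow>\<^sub>E carrier (obj X V)"
    by (rule ext_arr_mem[OF X W ob(1,2) f c])
  show "arr (ext W X) U T (compose (carrier U) g f) c = arr (ext W X) V T g (arr (ext W X) U V f c)"
  proof (rule ext_arr_eqI[OF X W ob(1,3) gf c ext_arr_mem[OF X W ob(2,3) g fc]])
    fix u assume u: "u \<in> VI_hom p W U"
    show "arr (ext W X) V T g (arr (ext W X) U V f c) (compose (carrier W) (compose (carrier U) g f) u)
        = arr X U T (compose (carrier U) g f) (c u)"
      unfolding VI_hom_compose_assoc[OF f u] ext_arr(1)[OF W g VI_hom_compose[OF u f W]]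
        ext_arr(1)[OF W f u] VI_moduleD(4)[OF X ob f g PiE_mem[OF c u]] ..
  next
    fix h assume h: "h \<in> VI_hom p W T" "h \<notin> compose (carrier W) (compose (carrier U) g f) ` VI_hom p W U"
    show "arr (ext W X) V T g (arr (ext W X) U V f c) h = \<zero>\<^bsub>obj X T\<^esub>"
    proof (cases "h \<in> compose (carrier W) g ` VI_hom p W V")
      case True
      then obtain v where v: "v \<in> VI_hom p W V" "h = compose (carrier W) g v" by blast
      \<comment> \<open>The preimage \<open>v\<close> of \<open>h\<close> under \<open>g\<close>
        does not come from \<open>U\<close>, as \<open>h\<close> would then do so too; hence the
        first transition already leaves zero at \<open>v\<close>.\<close>
      have "v \<noteq> compose (carrier W) f u" if u: "u \<in> VI_hom p W U" for u
        using h(2) VI_hom_compose_assoc[OF f u, of g] u unfolding v(2) by (metis image_eqI)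
      then have nv: "v \<notin> compose (carrier W) f ` VI_hom p W U" by blast
      show ?thesis
        unfolding v(2) ext_arr(1)[OF W g v(1)] ext_arr(2)[OF W f v(1) nv]
        by (rule VI_module_arrD(4)[OF X ob(2,3) g])
    next
      case False
      show ?thesis by (rule ext_arr(2)[OF W g h(1) False])
    qed
  qed
qed

lemma ext_arr_single:
  assumes X: "VI_module p K X" and ob: "W \<in> VI_ob p" "U \<in> VI_ob p" "V \<in> VI_ob p"
    and f: "f \<in> VI_hom p U V" and g: "g \<in> VI_hom p W U" and x: "x \<in> carrier (obj X U)"
  shows "arr (ext W X) U V f (single (VI_hom p W U) (obj X U) g x)
    = single (VI_hom p W V) (obj X V) (compose (carrier W) f g) (arr X U V f x)"
proof (rule ext_arr_eqI[OF X ob f])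
  show "single (VI_hom p W U) (obj X U) g x \<in> VI_hom p W U \<rightarrow>\<^sub>E carrier (obj X U)"
    using module_homD(1)[OF single_hom[OF VI_moduleD(1)[OF X ob(2)]] x] by simp
  show "single (VI_hom p W V) (obj X V) (compose (carrier W) f g) (arr X U V f x)
      \<in> VI_hom p W V \<rightarrow>\<^sub>E carrier (obj X V)"
    using module_homD(1)[OF single_hom[OF VI_moduleD(1)[OF X ob(3)]] VI_module_arrD(1)[OF X ob(2,3) f x]]
    by simp
next
  fix u assume u: "u \<in> VI_hom p W U"
  have "compose (carrier W) f u = compose (carrier W) f g \<longleftrightarrow> u = g"
    using VI_hom_compose_cancel[OF f u g] by blast
  then show "single (VI_hom p W V) (obj X V) (compose (carrier W) f g) (arr X U V f x) (compose (carrier W) f u)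
      = arr X U V f (single (VI_hom p W U) (obj X U) g x u)"
    using u VI_hom_compose[OF u f ob(1)] VI_module_arrD(4)[OF X ob(2,3) f] by (simp add: single_def)
next
  fix h assume "h \<in> VI_hom p W V" "h \<notin> compose (carrier W) f ` VI_hom p W U"
  then show "single (VI_hom p W V) (obj X V) (compose (carrier W) f g) (arr X U V f x) h = \<zero>\<^bsub>obj X V\<^esub>"
    using g by (auto simp: single_def)
qed

text \<open>Elements \<open>arr X A V f x\<close> placed at a single \<open>g\<close> span. The pair
  of \<open>f\<close> and \<open>g\<close> factors through a standard space of bounded dimension, so
  those placed in such spaces generate, and there are finitely many.\<close>

lemma ext_generates:
  assumes X: "VI_module p K X" and W: "W \<in> VI_ob p" and G: "finite G" "VI_generates p K X G"
  shows "\<exists>G'. finite G' \<and> VI_generates p K (ext W X) G'"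
proof -
  define G' where "G' = (\<Union>(A, x)\<in>G. \<Union>m\<le>vdim A + vdim W.
    (\<lambda>(f, g). (std m, single (VI_hom p W (std m)) (obj X (std m)) g (arr X A (std m) f x))) `
      (VI_hom p A (std m) \<times> VI_hom p W (std m)))"
  note AG = VI_generatesD(1,2)[OF G(2)]
  have "finite G'" unfolding G'_def
    using G(1) AG(1) W finite_VI_hom
    by (intro finite_UN_I finite_atMost) (auto split: prod.splits intro!: finite_UN_I finite_imageI finite_cartesian_product)
  moreover have "VI_generates p K (ext W X) G'"
  proof (rule VI_generatesI)
    fix B y assume "(B, y) \<in> G'"
    then obtain A x m f g where *: "(A, x) \<in> G" "B = std m" "f \<in> VI_hom p A (std m)" "g \<in> VI_hom p W (std m)"
      "y = single (VI_hom p W (std m)) (obj X (std m)) g (arr X A (std m) f x)"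
      unfolding G'_def by auto
    have "arr X A (std m) f x \<in> carrier (obj X (std m))"
      by (rule VI_module_arrD(1)[OF X AG(1)[OF *(1)] std_VI_ob *(3) AG(2)[OF *(1)]])
    then have "y \<in> carrier (obj (ext W X) (std m))"
      unfolding *(5) ext_obj by (rule module_homD(1)[OF single_hom[OF VI_moduleD(1)[OF X std_VI_ob]]])
    then show "B \<in> VI_ob p \<and> y \<in> carrier (obj (ext W X) B)" using *(2) by simp
  next
    fix N V c
    assume N: "VI_sub p K (ext W X) N" and gen: "\<And>B y. (B, y) \<in> G' \<Longrightarrow> y \<in> N B"
      and V: "V \<in> VI_ob p" and c: "c \<in> carrier (obj (ext W X) V)"
    note eX = VI_module_ext[OF X W]
    let ?s = "\<lambda>V. single (VI_hom p W V) (obj X V)"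
    \<comment> \<open>Elements of \<open>X\<close> all of whose images, placed at any
      \<open>g\<close>, lie in \<open>N\<close>. This is a submodule of \<open>X\<close>, so it is
      enough to check it on the generators of \<open>X\<close>.\<close>
    define M where "M U = {x \<in> carrier (obj X U). \<forall>V\<in>VI_ob p. \<forall>f\<in>VI_hom p U V. \<forall>g\<in>VI_hom p W V.
      ?s V g (arr X U V f x) \<in> N V}" for U
    have M: "VI_sub p K X M" unfolding VI_sub_iff[OF X]
    proof (intro conjI ballI)
      fix U assume U: "U \<in> VI_ob p"
      note cl = module_closed[OF VI_moduleD(1)[OF X U]]
      show "M U \<subseteq> carrier (obj X U)" unfolding M_def by blast
      have hom1: "?s V g \<zero>\<^bsub>obj X V\<^esub> = \<zero>\<^bsub>obj (ext W X) V\<^esub>" if V: "V \<in> VI_ob p" for V g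
        unfolding ext_obj
        by (rule module_hom_zero[OF VI_moduleD(1)[OF X V] fun_mod_module[OF VI_moduleD(1)[OF X V]]
              single_hom[OF VI_moduleD(1)[OF X V]]])
      have hom2: "?s V g (x \<oplus>\<^bsub>obj X V\<^esub> y) = ?s V g x \<oplus>\<^bsub>obj (ext W X) V\<^esub> ?s V g y"
        if "V \<in> VI_ob p" "x \<in> carrier (obj X V)" "y \<in> carrier (obj X V)" for V g x y
        unfolding ext_obj by (rule module_homD(2)[OF single_hom[OF VI_moduleD(1)[OF X that(1)]] that(2,3)])
      have hom3: "?s V g (a \<odot>\<^bsub>obj X V\<^esub> x) = a \<odot>\<^bsub>obj (ext W X) V\<^esub> ?s V g x"
        if "V \<in> VI_ob p" "a \<in> carrier K" "x \<in> carrier (obj X V)" for V g a x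
        unfolding ext_obj by (rule module_homD(3)[OF single_hom[OF VI_moduleD(1)[OF X that(1)]] that(2,3)])
      show "\<zero>\<^bsub>obj X U\<^esub> \<in> M U" unfolding M_def
        using cl(1) VI_module_arrD(4)[OF X U] hom1 VI_sub_closed(2)[OF eX N] by simp
      show "x \<oplus>\<^bsub>obj X U\<^esub> y \<in> M U" if "x \<in> M U" "y \<in> M U" for x y
        using that cl(2) VI_module_arrD(1,2)[OF X U] hom2 VI_sub_closed(3)[OF eX N] unfolding M_def by simp
      show "a \<odot>\<^bsub>obj X U\<^esub> x \<in> M U" if "a \<in> carrier K" "x \<in> M U" for a x
        using that cl(3) VI_module_arrD(1,3)[OF X U] hom3 VI_sub_closed(4)[OF eX N] unfolding M_def by simp
    next
      fix U V f x assume U: "U \<in> VI_ob p" and V: "V \<in> VI_ob p" and f: "f \<in> VI_hom p U V" and x: "x \<in> M U"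
      then have x': "x \<in> carrier (obj X U)" unfolding M_def by blast
      have "?s T g (arr X V T h (arr X U V f x)) \<in> N T"
        if T: "T \<in> VI_ob p" and h: "h \<in> VI_hom p V T" and g: "g \<in> VI_hom p W T" for T h g
        using x T g VI_hom_compose[OF f h U] VI_moduleD(4)[OF X U V T f h x'] unfolding M_def by fastforce
      then show "arr X U V f x \<in> M V" unfolding M_def using VI_module_arrD(1)[OF X U V f x'] by blast
    qed
    have GM: "x \<in> M A" if Ax: "(A, x) \<in> G" for A x
      unfolding M_def
    proof (intro CollectI conjI ballI)
      show "x \<in> carrier (obj X A)" by (rule AG(2)[OF Ax])
      fix V f g assume V: "V \<in> VI_ob p" and f: "f \<in> VI_hom p A V" and g: "g \<in> VI_hom p W V"
      obtain m j f' g' where *: "m \<le> vdim A + vdim W" "j \<in> VI_hom p (std m) V"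
        "f' \<in> VI_hom p A (std m)" "g' \<in> VI_hom p W (std m)"
        "f = compose (carrier A) j f'" "g = compose (carrier W) j g'"
        using VI_hom_pair_factor[OF AG(1)[OF Ax] W V f g] .
      have mem: "arr X A (std m) f' x \<in> carrier (obj X (std m))"
        by (rule VI_module_arrD(1)[OF X AG(1)[OF Ax] std_VI_ob *(3) AG(2)[OF Ax]])
      have "(std m, ?s (std m) g' (arr X A (std m) f' x)) \<in> G'"
        unfolding G'_def using Ax *(1,3,4) by force
      then have "arr (ext W X) (std m) V j (?s (std m) g' (arr X A (std m) f' x)) \<in> N V"
        by (intro VI_subD(2)[OF N std_VI_ob V *(2)] gen)
      then show "?s V g (arr X A V f x) \<in> N V"
        unfolding ext_arr_single[OF X W std_VI_ob V *(2,4) mem] *(5,6)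
          VI_moduleD(4)[OF X AG(1)[OF Ax] std_VI_ob V *(3,2) AG(2)[OF Ax]] .
    qed
    have all: "x \<in> M V" if "x \<in> carrier (obj X V)" for x
      by (rule VI_generatesD(3)[OF G(2) M GM V that])
    show "c \<in> N V"
    proof (rule fun_mod_submodule_eq[OF VI_moduleD(1)[OF X V] finite_VI_hom[OF W V]])
      show "submodule K (N V) (fun_mod (VI_hom p W V) (obj X V))"
        using VI_subD(1)[OF N V] by simp
      show "c \<in> VI_hom p W V \<rightarrow>\<^sub>E carrier (obj X V)" using c by simp
      show "?s V g x \<in> N V" if "g \<in> VI_hom p W V" "x \<in> carrier (obj X V)" for g x
        using all[OF that(2)] V VI_hom_id[OF V] that(1) VI_moduleD(3)[OF X V that(2)]
        unfolding M_def by fastforce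
    qed
  qed
  ultimately show ?thesis by blast
qed

end

section \<open>Cancellation in abelian groups\<close>

context abelian_group
begin

lemma add_minus_cancel:
  assumes "a \<in> carrier G" "b \<in> carrier G"
  shows "a \<oplus> (b \<oplus> \<ominus> a) = b" "c \<in> carrier G \<Longrightarrow> a \<oplus> (b \<oplus> (c \<oplus> \<ominus> a)) = b \<oplus> c"
proof -
  show 1: "a \<oplus> (b \<oplus> \<ominus> a) = b" using assms a_lcomm[of a b "\<ominus> a"] by (simp add: r_neg)
  show "c \<in> carrier G \<Longrightarrow> a \<oplus> (b \<oplus> (c \<oplus> \<ominus> a)) = b \<oplus> c"
    using assms a_lcomm[of a b "c \<oplus> \<ominus> a"] a_lcomm[of a c "\<ominus> a"] by (simp add: r_neg)
qed

text \<open>These are the identities behind the coset relation in \<open>quotient_exists\<close>: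
  the first three compare two elements through a third, the last is invariance under
  translation.\<close>

lemma minus_cancel:
  assumes "x \<in> carrier G" "y \<in> carrier G" "z \<in> carrier G"
  shows "(z \<ominus> y) \<ominus> (z \<ominus> x) = x \<ominus> y" "(z \<ominus> x) \<oplus> (x \<ominus> y) = z \<ominus> y"
    "(z \<ominus> y) \<ominus> (x \<ominus> y) = z \<ominus> x" "(x \<oplus> z) \<ominus> (y \<oplus> z) = x \<ominus> y"
  using assms by (simp_all add: minus_eq minus_add a_ac r_neg1 r_neg2 add_minus_cancel)

end

context VI_setting
begin

section \<open>The unit and its truncations\<close>

text \<open>\<open>K\<close> as a module over itself, on one-element lists, so that the unit lives
  on the carrier type demanded by \<open>VI_fg\<close>.\<close>

definition line :: "('k, 'k list) module" where
  "line = \<lparr>carrier = (\<lambda>k. [k]) ` carrier K, monoid.mult = (\<lambda>x y. [\<zero>]), one = [\<zero>], zero = [\<zero>],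
     add = (\<lambda>x y. [hd x \<oplus> hd y]), smult = (\<lambda>a x. [a \<otimes> hd x])\<rparr>"

lemma line_simps [simp]:
  "carrier line = (\<lambda>k. [k]) ` carrier K" "\<zero>\<^bsub>line\<^esub> = [\<zero>]"
  "x \<oplus>\<^bsub>line\<^esub> y = [hd x \<oplus> hd y]" "a \<odot>\<^bsub>line\<^esub> x = [a \<otimes> hd x]"
  by (simp_all add: line_def)

lemma line_module: "Module.module K line"
proof (rule moduleI)
  show "abelian_group line"
  proof (rule abelian_groupI)
    fix x assume "x \<in> carrier line"
    then obtain k where k: "k \<in> carrier K" "x = [k]" by auto
    then show "\<exists>y\<in>carrier line. y \<oplus>\<^bsub>line\<^esub> x = \<zero>\<^bsub>line\<^esub>"
      by (intro bexI[of _ "[\<ominus> k]"]) (auto simp: K.l_neg)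
  qed (auto simp: K.a_assoc intro: K.a_comm)
qed (auto simp: K.l_distr K.r_distr K.m_assoc intro: K.is_cring)

definition unit_vi :: "('k, 'k list) vi_module" where
  "unit_vi = \<lparr>obj = (\<lambda>V. line), arr = (\<lambda>V W f x. x)\<rparr>"

lemma unit_vi_simps [simp]: "obj unit_vi V = line" "arr unit_vi V W f x = x"
  by (simp_all add: unit_vi_def)

lemma VI_module_unit: "VI_module p K unit_vi"
  unfolding VI_module_def by (auto simp: line_module intro: module_homI)

text \<open>One generator is placed at the left end of each maximal run of consecutive numbers in
  \<open>S\<close>; within a run the transition maps are identities. The clause for \<open>0\<close>
  is there because \<open>0 - 1\<close> is again \<open>0\<close>.\<close>

lemma VI_generates_trunc_unit:
  "VI_generates p K (trunc S unit_vi) ((\<lambda>a. (std a, [\<one>])) ` {a \<in> S. a = 0 \<or> a - 1 \<notin> S})"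
proof (rule VI_generatesI)
  show "A \<in> VI_ob p \<and> x \<in> carrier (obj (trunc S unit_vi) A)"
    if "(A, x) \<in> (\<lambda>a. (std a, [\<one>])) ` {a \<in> S. a = 0 \<or> a - 1 \<notin> S}" for A x
    using that by auto
next
  fix N V x
  assume N: "VI_sub p K (trunc S unit_vi) N" and V: "V \<in> VI_ob p" and x: "x \<in> carrier (obj (trunc S unit_vi) V)"
    and gen: "\<And>A x. (A, x) \<in> (\<lambda>a. (std a, [\<one>])) ` {a \<in> S. a = 0 \<or> a - 1 \<notin> S} \<Longrightarrow> x \<in> N A"
  note cl = VI_sub_closed[OF VI_module_trunc[OF VI_module_unit] N V]
  show "x \<in> N V"
  proof (cases "vdim V \<in> S")
    case False
    then show ?thesis using x cl(2) by simp
  next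
    case True
    then obtain k where k: "k \<in> carrier K" "x = [k]" using x by auto
    \<comment> \<open>The left end of the run of \<open>S\<close> that contains
      \<open>vdim V\<close>.\<close>
    define a where "a = (LEAST a. {a..vdim V} \<subseteq> S)"
    have a: "{a..vdim V} \<subseteq> S" unfolding a_def by (rule LeastI[of _ "vdim V"]) (simp add: True)
    have le: "a \<le> vdim V" unfolding a_def by (rule Least_le) (simp add: True)
    have aS: "a \<in> S" using a le by auto
    have "a = 0 \<or> a - 1 \<notin> S"
    proof (rule ccontr)
      assume "\<not> ?thesis"
      then have "a > 0" "{a - 1..vdim V} \<subseteq> S" using a by (auto simp: subset_iff) (metis Suc_pred le_SucE le_less_Suc_eq not_le)
      then show False using not_less_Least[of "a - 1" "\<lambda>a. {a..vdim V} \<subseteq> S"] unfolding a_def by simp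
    qed
    then have "[\<one>] \<in> N (std a)" using gen aS by blast
    moreover obtain f where f: "f \<in> VI_hom p (std a) V"
      using VI_hom_nonempty[OF std_VI_ob V] le by auto
    ultimately have "[\<one>] \<in> N V" using VI_subD(2)[OF N std_VI_ob V f] a by fastforce
    then show ?thesis using cl(4)[OF k(1)] k by fastforce
  qed
qed

section \<open>Encoding functions as lists\<close>

text \<open>A self-delimiting code: the flag \<open>\<one>\<close> announces a further letter and
  \<open>\<zero>\<close> the end. Since the two scalars differ, concatenated codes can be read
  back.\<close>

definition code :: "'k list \<Rightarrow> 'k list" where
  "code xs = concat (map (\<lambda>x. [\<one>, x]) xs) @ [\<zero>]"

lemma code_append_eq: "code xs @ r = code ys @ s \<Longrightarrow> xs = ys \<and> r = s"
proof (induction xs arbitrary: ys)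
  case Nil
  then show ?case by (cases ys) (auto simp: code_def)
next
  case (Cons x xs)
  then show ?case by (cases ys) (auto simp: code_def)
qed

text \<open>Concatenates the codes of the values along one fixed enumeration of \<open>S\<close>;
  repetitions in the enumeration do no harm to injectivity.\<close>

definition enc :: "'s set \<Rightarrow> ('s \<Rightarrow> 'k list) \<Rightarrow> 'k list" where
  "enc S c = concat (map (\<lambda>g. code (c g)) (SOME l. set l = S))"

lemma inj_on_enc:
  assumes "finite S"
  shows "inj_on (enc S) (S \<rightarrow>\<^sub>E T)"
proof (rule inj_onI)
  fix c d assume c: "c \<in> S \<rightarrow>\<^sub>E T" and d: "d \<in> S \<rightarrow>\<^sub>E T" and eq: "enc S c = enc S d"
  let ?l = "SOME l. set l = S"
  have l: "set ?l = S" using finite_list[OF assms] by (rule someI_ex)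
  have "\<forall>g\<in>set xs. c g = d g"
    if "concat (map (\<lambda>g. code (c g)) xs) = concat (map (\<lambda>g. code (d g)) xs)" for xs
    using that
  proof (induction xs)
    case (Cons g xs)
    then have "c g = d g \<and> concat (map (\<lambda>g. code (c g)) xs) = concat (map (\<lambda>g. code (d g)) xs)"
      by (intro code_append_eq) simp
    with Cons.IH show ?case by simp
  qed simp
  from this[of ?l] eq have "c g = d g" if "g \<in> S" for g unfolding enc_def l using that by blast
  then show "c = d" by (rule PiE_ext[OF c d])
qed

text \<open>The values of \<open>ext W X\<close> are functions and hence of the wrong type for an
  object of \<A>; this is the isomorphic copy on lists.\<close>

definition extl :: "vi_ob \<Rightarrow> ('k, 'k list) vi_module \<Rightarrow> ('k, 'k list) vi_module" where
  "extl W X = img_vi (\<lambda>U. enc (VI_hom p W U)) (ext W X)"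

lemma inj_on_enc_ext:
  "W \<in> VI_ob p \<Longrightarrow> U \<in> VI_ob p \<Longrightarrow> inj_on (enc (VI_hom p W U)) (carrier (obj (ext W X) U))"
  using inj_on_enc[OF finite_VI_hom] by simp

lemma extl_congruence:
  assumes "W \<in> VI_ob p"
  shows "VI_congruence p K (ext W X) (\<lambda>U. enc (VI_hom p W U))"
  by (rule VI_congruence_inj) (rule inj_on_enc_ext[OF assms])

lemma VI_module_extl: "VI_module p K X \<Longrightarrow> W \<in> VI_ob p \<Longrightarrow> VI_module p K (extl W X)"
  unfolding extl_def by (rule VI_module_img_vi[OF VI_module_ext extl_congruence])

lemma extl_trans:
  "VI_module p K X \<Longrightarrow> W \<in> VI_ob p \<Longrightarrow> VI_nat_trans p K (ext W X) (extl W X) (\<lambda>U. enc (VI_hom p W U))"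
  unfolding extl_def by (rule VI_nat_trans_img_vi[OF VI_module_ext extl_congruence])

lemma extl_carrier: "carrier (obj (extl W X) U) = enc (VI_hom p W U) ` carrier (obj (ext W X) U)"
  by (simp add: extl_def)

section \<open>Objects, subobjects and quotients\<close>

abbreviation "\<A> \<equiv> VI_fg p K"

lemma Ob_iff: "X \<in> Ob \<A> \<longleftrightarrow> VI_module p K X \<and> (\<exists>G. finite G \<and> VI_generates p K X G)"
  using fin_gen_iff_generates by (auto simp: VI_fg_def)

lemma Ob_module: "X \<in> Ob \<A> \<Longrightarrow> VI_module p K X"
  by (simp add: Ob_iff)

lemma exact_simps [simp]: "short_exact \<A> = VI_short_exact p K" "tensor \<A> = VI_tensor p K"
  by (simp_all add: VI_fg_def)

lemma Ob_quotient:
  assumes "X \<in> Ob \<A>" "VI_module p K Y" "VI_nat_trans p K X Y \<eta>"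
    and "\<And>V. V \<in> VI_ob p \<Longrightarrow> \<eta> V ` carrier (obj X V) = carrier (obj Y V)"
  shows "Y \<in> Ob \<A>"
proof -
  obtain G where G: "finite G" "VI_generates p K X G" using assms(1) unfolding Ob_iff by blast
  have "VI_generates p K Y ((\<lambda>(A, x). (A, \<eta> A x)) ` G)"
    by (rule VI_generates_surj[OF Ob_module[OF assms(1)] assms(2,3,4) G(2)])
  then show ?thesis unfolding Ob_iff using assms(2) finite_imageI[OF G(1)] by blast
qed

lemma Ob_trunc_unit: "finite {a \<in> S. a = 0 \<or> a - 1 \<notin> S} \<Longrightarrow> trunc S unit_vi \<in> Ob \<A>"
  unfolding Ob_iff using VI_module_trunc[OF VI_module_unit] VI_generates_trunc_unit finite_imageI by blast

lemma Ob_extl: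
  assumes X: "X \<in> Ob \<A>" and W: "W \<in> VI_ob p"
  shows "extl W X \<in> Ob \<A>"
proof -
  have VX: "VI_module p K X" using Ob_module[OF X] .
  obtain G where G: "finite G" "VI_generates p K X G" using X unfolding Ob_iff by blast
  obtain G' where G': "finite G'" "VI_generates p K (ext W X) G'" using ext_generates[OF VX W G] by blast
  have "VI_generates p K (extl W X) ((\<lambda>(A, x). (A, enc (VI_hom p W A) x)) ` G')"
    by (rule VI_generates_surj[OF VI_module_ext[OF VX W] VI_module_extl[OF VX W] extl_trans[OF VX W] _ G'(2)])
      (simp only: extl_carrier)
  then show ?thesis unfolding Ob_iff using VI_module_extl[OF VX W] finite_imageI[OF G'(1)] by blast
qed

text \<open>All spaces of dimension \<open>n\<close> are isomorphic to \<open>std n\<close>, so the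
  finitely many images of the generators of \<open>X\<close> in \<open>std n\<close> generate the
  truncation.\<close>

lemma Ob_trunc_single:
  assumes X: "X \<in> Ob \<A>"
  shows "trunc {n} X \<in> Ob \<A>"
proof -
  have VX: "VI_module p K X" using Ob_module[OF X] .
  obtain G where G: "finite G" "VI_generates p K X G" using X unfolding Ob_iff by blast
  note AG = VI_generatesD(1,2)[OF G(2)] and VT = VI_module_trunc[OF VX, of "{n}"]
  define G' where "G' = (\<Union>(A, x)\<in>G. (\<lambda>f. (std n, arr X A (std n) f x)) ` VI_hom p A (std n))"
  have "finite G'" unfolding G'_def
    using G(1) AG(1) finite_VI_hom[OF _ std_VI_ob]
    by (intro finite_UN_I) (auto split: prod.splits)
  moreover have "VI_generates p K (trunc {n} X) G'"
  proof (rule VI_generatesI)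
    fix B y assume "(B, y) \<in> G'"
    then obtain A x f where "(A, x) \<in> G" "f \<in> VI_hom p A (std n)" "B = std n" "y = arr X A (std n) f x"
      unfolding G'_def by auto
    then show "B \<in> VI_ob p \<and> y \<in> carrier (obj (trunc {n} X) B)"
      using VI_module_arrD(1)[OF VX AG(1) std_VI_ob _ AG(2)] by simp
  next
    fix N V y
    assume N: "VI_sub p K (trunc {n} X) N" and gen: "\<And>B y. (B, y) \<in> G' \<Longrightarrow> y \<in> N B"
      and V: "V \<in> VI_ob p" and y: "y \<in> carrier (obj (trunc {n} X) V)"
    show "y \<in> N V"
    proof (cases "vdim V = n")
      case False
      then show ?thesis using y VI_sub_closed(2)[OF VT N V] by simp
    next
      case True
      \<comment> \<open>The elements of \<open>X\<close> whose images in dimension \<open>n\<close>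
        lie in \<open>N\<close>. In contrast to \<open>N\<close>, this is a submodule of
        \<open>X\<close> itself, so it can be tested on the generators of \<open>X\<close>.\<close>
      define M where "M U = {x \<in> carrier (obj X U). vdim U = n \<longrightarrow> x \<in> N U} \<inter>
        {x \<in> carrier (obj X U). \<forall>V\<in>VI_ob p. \<forall>f\<in>VI_hom p U V. vdim V = n \<longrightarrow> arr X U V f x \<in> N V}" for U
      have M: "VI_sub p K X M" unfolding VI_sub_iff[OF VX]
      proof (intro conjI ballI)
        fix U assume U: "U \<in> VI_ob p"
        note cl = module_closed[OF VI_moduleD(1)[OF VX U]]
        note arr = VI_module_arrD[OF VX U]
        have Ncl: "\<zero>\<^bsub>obj X V\<^esub> \<in> N V" "x \<in> N V \<Longrightarrow> y \<in> N V \<Longrightarrow> x \<oplus>\<^bsub>obj X V\<^esub> y \<in> N V"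
          "a \<in> carrier K \<Longrightarrow> x \<in> N V \<Longrightarrow> a \<odot>\<^bsub>obj X V\<^esub> x \<in> N V" if "V \<in> VI_ob p" for V x y a
          using VI_sub_closed(2-4)[OF VT N that] by simp_all
        show "M U \<subseteq> carrier (obj X U)" unfolding M_def by blast
        show "\<zero>\<^bsub>obj X U\<^esub> \<in> M U" using cl(1) Ncl(1) U arr(4) unfolding M_def by simp
        show "x \<oplus>\<^bsub>obj X U\<^esub> y \<in> M U" if "x \<in> M U" "y \<in> M U" for x y
          using that cl(2) Ncl(2) U arr(2) unfolding M_def by simp
        show "a \<odot>\<^bsub>obj X U\<^esub> x \<in> M U" if "a \<in> carrier K" "x \<in> M U" for a x
          using that cl(3) Ncl(3) U arr(3) unfolding M_def by simp
      next
        fix U V f x assume U: "U \<in> VI_ob p" and V: "V \<in> VI_ob p" and f: "f \<in> VI_hom p U V" and x: "x \<in> M U"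
        then have x': "x \<in> carrier (obj X U)" unfolding M_def by blast
        have "arr X V T h (arr X U V f x) \<in> N T"
          if T: "T \<in> VI_ob p" and h: "h \<in> VI_hom p V T" and n: "vdim T = n" for T h
          using x T n VI_hom_compose[OF f h U] VI_moduleD(4)[OF VX U V T f h x'] unfolding M_def by fastforce
        moreover have "vdim V = n \<longrightarrow> arr X U V f x \<in> N V" using x V f unfolding M_def by blast
        ultimately show "arr X U V f x \<in> M V" using VI_module_arrD(1)[OF VX U V f x'] unfolding M_def by blast
      qed
      \<comment> \<open>An isomorphism from \<open>std n\<close> to \<open>V\<close> factors
        \<open>f\<close> through an injection into \<open>std n\<close>, whose effect on
        \<open>x\<close> is recorded in \<open>G'\<close>.\<close>
      have GN: "arr X A V f x \<in> N V"
        if Ax: "(A, x) \<in> G" and V: "V \<in> VI_ob p" and f: "f \<in> VI_hom p A V" and n: "vdim V = n" for A x V f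
      proof -
        obtain a where a: "a \<in> VI_hom p (std n) V" "a ` carrier (std n) = carrier V"
          using std_iso[OF V] unfolding n .
        obtain b where b: "b \<in> VI_hom p V (std n)" "compose (carrier V) a b = (\<lambda>v\<in>carrier V. v)"
          using VI_hom_inverse[OF std_VI_ob V a] .
        let ?f = "compose (carrier A) b f"
        have f': "?f \<in> VI_hom p A (std n)" by (rule VI_hom_compose[OF f b(1) AG(1)[OF Ax]])
        have f: "f = compose (carrier A) a ?f"
          unfolding VI_hom_compose_assoc[OF b(1), of f A a, symmetric, OF f] b(2)
            compose_VI_hom_id(2)[OF f] ..
        have "(std n, arr X A (std n) ?f x) \<in> G'" unfolding G'_def using Ax f' by blast
        then have "arr (trunc {n} X) (std n) V a (arr X A (std n) ?f x) \<in> N V"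
          by (intro VI_subD(2)[OF N std_VI_ob V a(1)] gen)
        then have "arr X (std n) V a (arr X A (std n) ?f x) \<in> N V" using n by simp
        then show ?thesis
          by (subst f) (simp only: VI_moduleD(4)[OF VX AG(1)[OF Ax] std_VI_ob V f' a(1) AG(2)[OF Ax]])
      qed
      have GM: "x \<in> M A" if Ax: "(A, x) \<in> G" for A x
        unfolding M_def
        using AG[OF Ax] GN[OF Ax] GN[OF Ax AG(1)[OF Ax] VI_hom_id[OF AG(1)[OF Ax]]]
          VI_moduleD(3)[OF VX AG[OF Ax]] by auto
      have "y \<in> M V"
        by (rule VI_generatesD(3)[OF G(2) M GM V]) (use y True in auto)
      then show ?thesis using True unfolding M_def by blast
    qed
  qed
  ultimately show ?thesis unfolding Ob_iff using VT by blast
qed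

text \<open>Each coset of \<open>N V\<close> is replaced by a chosen member of it. The quotient thus
  keeps the carrier type of \<open>B\<close>, so that it can again be an object.\<close>

lemma quotient_exists:
  fixes B :: "('k, 'u) vi_module"
  assumes B: "VI_module p K B" and N: "VI_sub p K B N"
  shows "\<exists>(C :: ('k, 'u) vi_module) r. VI_module p K C \<and> VI_nat_trans p K B C r \<and>
    (\<forall>V\<in>VI_ob p. r V ` carrier (obj B V) = carrier (obj C V) \<and>
      {b \<in> carrier (obj B V). r V b = \<zero>\<^bsub>obj C V\<^esub>} = N V)"
proof -
  define r where "r V b = (SOME z. z \<in> carrier (obj B V) \<and> z \<ominus>\<^bsub>obj B V\<^esub> b \<in> N V)" for V b
  have r: "r V x = r V y \<longleftrightarrow> x \<ominus>\<^bsub>obj B V\<^esub> y \<in> N V"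
    if V: "V \<in> VI_ob p" and x: "x \<in> carrier (obj B V)" and y: "y \<in> carrier (obj B V)" for V x y
  proof -
    interpret M: Module.module K "obj B V" using VI_moduleD(1)[OF B V] .
    note cl = VI_sub_closed[OF B N V]
    have neg: "\<ominus>\<^bsub>obj B V\<^esub> a \<in> N V" if "a \<in> N V" for a
      using cl(4)[of "\<ominus> \<one>" a] M.smult_minus_1[of a] cl(1) that by simp
    have sub: "a \<ominus>\<^bsub>obj B V\<^esub> b \<in> N V" if "a \<in> N V" "b \<in> N V" for a b
      using cl(3) neg that unfolding M.M.minus_eq by blast
    have rx: "r V b \<in> carrier (obj B V) \<and> r V b \<ominus>\<^bsub>obj B V\<^esub> b \<in> N V" if "b \<in> carrier (obj B V)" for b
      unfolding r_def by (rule someI[of _ b]) (use that cl(2) in \<open>simp add: M.M.minus_eq M.M.r_neg\<close>)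
    show ?thesis
    proof
      assume "r V x = r V y"
      then show "x \<ominus>\<^bsub>obj B V\<^esub> y \<in> N V"
        using rx[OF x] rx[OF y] sub M.M.minus_cancel(1)[OF x y, of "r V x"] by metis
    next
      assume xy: "x \<ominus>\<^bsub>obj B V\<^esub> y \<in> N V"
      have "z \<ominus>\<^bsub>obj B V\<^esub> x \<in> N V \<longleftrightarrow> z \<ominus>\<^bsub>obj B V\<^esub> y \<in> N V" if z: "z \<in> carrier (obj B V)" for z
      proof
        assume zx: "z \<ominus>\<^bsub>obj B V\<^esub> x \<in> N V"
        have "z \<ominus>\<^bsub>obj B V\<^esub> y = (z \<ominus>\<^bsub>obj B V\<^esub> x) \<oplus>\<^bsub>obj B V\<^esub> (x \<ominus>\<^bsub>obj B V\<^esub> y)"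
          using M.M.minus_cancel(2)[OF x y z] ..
        then show "z \<ominus>\<^bsub>obj B V\<^esub> y \<in> N V" using cl(3)[OF zx xy] by simp
      next
        assume zy: "z \<ominus>\<^bsub>obj B V\<^esub> y \<in> N V"
        have "z \<ominus>\<^bsub>obj B V\<^esub> x = (z \<ominus>\<^bsub>obj B V\<^esub> y) \<ominus>\<^bsub>obj B V\<^esub> (x \<ominus>\<^bsub>obj B V\<^esub> y)"
          using M.M.minus_cancel(3)[OF x y z] ..
        then show "z \<ominus>\<^bsub>obj B V\<^esub> x \<in> N V" using sub[OF zy xy] by simp
      qed
      \<comment> \<open>The two choices are made by equivalent predicates, so \<open>SOME\<close>
        returns the same element.\<close>
      then show "r V x = r V y" unfolding r_def by (intro arg_cong[of _ _ Eps] ext) blast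
    qed
  qed
  have cong: "VI_congruence p K B r"
    unfolding VI_congruence_def mod_congruence_def
  proof (intro conjI ballI impI)
    fix V x y z assume V: "V \<in> VI_ob p" and x: "x \<in> carrier (obj B V)" and y: "y \<in> carrier (obj B V)"
      and z: "z \<in> carrier (obj B V)" and eq: "r V x = r V y"
    interpret M: Module.module K "obj B V" using VI_moduleD(1)[OF B V] .
    have "(x \<oplus>\<^bsub>obj B V\<^esub> z) \<ominus>\<^bsub>obj B V\<^esub> (y \<oplus>\<^bsub>obj B V\<^esub> z) = x \<ominus>\<^bsub>obj B V\<^esub> y"
      by (rule M.M.minus_cancel(4)[OF x y z])
    then show "r V (x \<oplus>\<^bsub>obj B V\<^esub> z) = r V (y \<oplus>\<^bsub>obj B V\<^esub> z)"
      using eq x y z by (simp add: r[OF V])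
  next
    fix V x y a assume V: "V \<in> VI_ob p" and x: "x \<in> carrier (obj B V)" and y: "y \<in> carrier (obj B V)"
      and a: "a \<in> carrier K" and eq: "r V x = r V y"
    interpret M: Module.module K "obj B V" using VI_moduleD(1)[OF B V] .
    have "(a \<odot>\<^bsub>obj B V\<^esub> x) \<ominus>\<^bsub>obj B V\<^esub> (a \<odot>\<^bsub>obj B V\<^esub> y) = a \<odot>\<^bsub>obj B V\<^esub> (x \<ominus>\<^bsub>obj B V\<^esub> y)"
      using x y a by (simp add: M.M.minus_eq M.smult_r_distr M.smult_r_minus)
    then show "r V (a \<odot>\<^bsub>obj B V\<^esub> x) = r V (a \<odot>\<^bsub>obj B V\<^esub> y)"
      using eq x y a VI_sub_closed(4)[OF B N V a] by (simp add: r[OF V])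
  next
    fix V W f x y assume V: "V \<in> VI_ob p" and W: "W \<in> VI_ob p" and f: "f \<in> VI_hom p V W"
      and x: "x \<in> carrier (obj B V)" and y: "y \<in> carrier (obj B V)" and eq: "r V x = r V y"
    have "arr B V W f (x \<ominus>\<^bsub>obj B V\<^esub> y) \<in> N W"
      using eq r[OF V x y] VI_subD(2)[OF N V W f] by blast
    then show "r W (arr B V W f x) = r W (arr B V W f y)"
      using module_hom_minus[OF VI_moduleD(1)[OF B V] VI_moduleD(1)[OF B W] VI_moduleD(2)[OF B V W f] x y]
      by (simp add: r[OF W] VI_module_arrD(1)[OF B V W f] x y)
  qed
  show ?thesis
  proof (intro exI conjI ballI)
    show "VI_module p K (img_vi r B)" by (rule VI_module_img_vi[OF B cong])
    show "VI_nat_trans p K B (img_vi r B) r" by (rule VI_nat_trans_img_vi[OF B cong])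
    show "r V ` carrier (obj B V) = carrier (obj (img_vi r B) V)" for V by simp
    fix V assume V: "V \<in> VI_ob p"
    interpret M: Module.module K "obj B V" using VI_moduleD(1)[OF B V] .
    have mz: "\<ominus>\<^bsub>obj B V\<^esub> \<zero>\<^bsub>obj B V\<^esub> = \<zero>\<^bsub>obj B V\<^esub>"
      using M.M.r_neg[OF M.M.zero_closed] by simp
    have "r V b = r V \<zero>\<^bsub>obj B V\<^esub> \<longleftrightarrow> b \<in> N V" if "b \<in> carrier (obj B V)" for b
      unfolding r[OF V that M.M.zero_closed] using that by (simp add: M.M.minus_eq mz)
    then show "{b \<in> carrier (obj B V). r V b = \<zero>\<^bsub>obj (img_vi r B) V\<^esub>} = N V"
      using VI_sub_closed(1)[OF B N V] by auto
  qed
qed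

text \<open>Finite generation passes to quotients, so an injective map between objects always
  extends to a short exact sequence of objects.\<close>

lemma short_exact_cokernel:
  assumes A: "A \<in> Ob \<A>" and B: "B \<in> Ob \<A>" and \<eta>: "VI_nat_trans p K A B \<eta>"
    and inj: "\<And>V. V \<in> VI_ob p \<Longrightarrow> inj_on (\<eta> V) (carrier (obj A V))"
  obtains C where "C \<in> Ob \<A>" "short_exact \<A> A B C"
proof -
  note VA = Ob_module[OF A] and VB = Ob_module[OF B]
  obtain C :: "('k, 'k list) vi_module" and r :: "vi_ob \<Rightarrow> 'k list \<Rightarrow> 'k list" where C0: "VI_module p K C \<and> VI_nat_trans p K B C r \<and>
    (\<forall>V\<in>VI_ob p. r V ` carrier (obj B V) = carrier (obj C V) \<and>
      {b \<in> carrier (obj B V). r V b = \<zero>\<^bsub>obj C V\<^esub>} = \<eta> V ` carrier (obj A V))"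
    using quotient_exists[OF VB VI_sub_image[OF VA VB \<eta>]] by (elim exE) (rule that)
  note C1 = conjunct1[OF C0] and C2 = conjunct1[OF conjunct2[OF C0]]
    and C3 = conjunct1[OF bspec[OF conjunct2[OF conjunct2[OF C0]]]]
    and C4 = conjunct2[OF bspec[OF conjunct2[OF conjunct2[OF C0]]]]
  have "C \<in> Ob \<A>" by (rule Ob_quotient[OF B C1 C2 C3])
  moreover have "short_exact \<A> A B C"
    unfolding exact_simps VI_short_exact_def
    by (intro exI[of _ \<eta>] exI[of _ r] conjI ballI) (rule \<eta> C2 | erule inj C4[symmetric] C3)+
  ultimately show ?thesis by (rule that)
qed

text \<open>Unlike for cokernels, finite generation of the kernel is something the caller has to
  supply.\<close>

lemma short_exact_kernel:
  assumes B: "B \<in> Ob \<A>" and C: "C \<in> Ob \<A>" and \<eta>: "VI_nat_trans p K B C \<eta>"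
    and surj: "\<And>V. V \<in> VI_ob p \<Longrightarrow> \<eta> V ` carrier (obj B V) = carrier (obj C V)"
    and A: "sub_vi B (\<lambda>V. {b \<in> carrier (obj B V). \<eta> V b = \<zero>\<^bsub>obj C V\<^esub>}) \<in> Ob \<A>" (is "?A \<in> _")
  shows "short_exact \<A> ?A B C"
  unfolding exact_simps VI_short_exact_def
proof (intro exI conjI ballI)
  show "VI_nat_trans p K ?A B (\<lambda>V x. x)"
    unfolding VI_nat_trans_def by (auto intro!: module_homI)
  show "VI_nat_trans p K B C \<eta>" by fact
qed (use surj in \<open>auto simp: inj_on_def\<close>)

section \<open>Computing tensor products\<close>

lemma bilinear_onD:
  assumes "bilinear_on K M N T b"
  shows "x \<in> carrier M \<Longrightarrow> b x \<in> module_hom K N T" "y \<in> carrier N \<Longrightarrow> (\<lambda>x. b x y) \<in> module_hom K M T"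
  using assms unfolding bilinear_on_def by auto

lemma tensor_zero_module:
  assumes M: "Module.module K M" and N: "Module.module K N" and T: "Module.module K T"
    and zero: "carrier M = {\<zero>\<^bsub>M\<^esub>} \<or> carrier N = {\<zero>\<^bsub>N\<^esub>}" and T0: "carrier T = {\<zero>\<^bsub>T\<^esub>}"
  shows "is_tensor_product K M N T (\<lambda>x y. \<zero>\<^bsub>T\<^esub>)"
  unfolding is_tensor_product_def
proof (intro conjI allI impI)
  interpret T: Module.module K T by fact
  show "bilinear_on K M N T (\<lambda>x y. \<zero>\<^bsub>T\<^esub>)"
    unfolding bilinear_on_def by (auto intro!: module_homI)
  fix Q c assume "Module.module K Q \<and> bilinear_on K M N Q c"
  then have Q: "Module.module K Q" and c: "bilinear_on K M N Q c" by auto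
  interpret Q: Module.module K Q by fact
  have c0: "c x y = \<zero>\<^bsub>Q\<^esub>" if "x \<in> carrier M" "y \<in> carrier N" for x y
    using zero module_hom_zero[OF N Q bilinear_onD(1)[OF c that(1)]]
      module_hom_zero[OF M Q bilinear_onD(2)[OF c that(2)]] that by auto
  show "\<exists>h\<in>module_hom K T Q. (\<forall>x\<in>carrier M. \<forall>y\<in>carrier N. h \<zero>\<^bsub>T\<^esub> = c x y) \<and>
      (\<forall>h'\<in>module_hom K T Q. (\<forall>x\<in>carrier M. \<forall>y\<in>carrier N. h' \<zero>\<^bsub>T\<^esub> = c x y) \<longrightarrow> (\<forall>t\<in>carrier T. h' t = h t))"
  proof (intro bexI conjI ballI impI)
    show "(\<lambda>t. \<zero>\<^bsub>Q\<^esub>) \<in> module_hom K T Q" by (rule module_homI) auto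
    show "h' t = \<zero>\<^bsub>Q\<^esub>" if "h' \<in> module_hom K T Q" "t \<in> carrier T" for h' t
      using module_hom_zero[OF T Q that(1)] that(2) T0 by simp
  qed (simp add: c0)
qed

lemma tensor_line:
  assumes M: "Module.module K M"
  shows "is_tensor_product K M line M (\<lambda>x l. hd l \<odot>\<^bsub>M\<^esub> x)"
  unfolding is_tensor_product_def
proof (intro conjI allI impI)
  interpret M: Module.module K M by fact
  show "bilinear_on K M line M (\<lambda>x l. hd l \<odot>\<^bsub>M\<^esub> x)"
    unfolding bilinear_on_def
  proof (intro conjI ballI)
    show "(\<lambda>l. hd l \<odot>\<^bsub>M\<^esub> x) \<in> module_hom K line M" if "x \<in> carrier M" for x
      using that by (intro module_homI) (auto simp: M.smult_l_distr M.smult_assoc1)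
    fix l assume "l \<in> carrier line"
    then obtain k where k: "k \<in> carrier K" "l = [k]" by auto
    show "(\<lambda>x. hd l \<odot>\<^bsub>M\<^esub> x) \<in> module_hom K M M"
    proof (rule module_homI)
      show "hd l \<odot>\<^bsub>M\<^esub> (a \<odot>\<^bsub>M\<^esub> x) = a \<odot>\<^bsub>M\<^esub> (hd l \<odot>\<^bsub>M\<^esub> x)"
        if "a \<in> carrier K" "x \<in> carrier M" for a x
        using that k by (simp add: M.smult_assoc1[symmetric] K.m_comm)
    qed (auto simp: k M.smult_r_distr)
  qed
  fix Q c assume "Module.module K Q \<and> bilinear_on K M line Q c"
  then have Q: "Module.module K Q" and c: "bilinear_on K M line Q c" by auto
  have 1: "[\<one>] \<in> carrier line" by simp
  have h: "(\<lambda>t. c t [\<one>]) \<in> module_hom K M Q" by (rule bilinear_onD(2)[OF c 1])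
  show "\<exists>h\<in>module_hom K M Q. (\<forall>x\<in>carrier M. \<forall>l\<in>carrier line. h (hd l \<odot>\<^bsub>M\<^esub> x) = c x l) \<and>
      (\<forall>h'\<in>module_hom K M Q. (\<forall>x\<in>carrier M. \<forall>l\<in>carrier line. h' (hd l \<odot>\<^bsub>M\<^esub> x) = c x l) \<longrightarrow>
        (\<forall>t\<in>carrier M. h' t = h t))"
  proof (rule bexI[OF _ h], intro conjI ballI impI)
    fix x l assume x: "x \<in> carrier M" and "l \<in> carrier line"
    then obtain k where k: "k \<in> carrier K" "l = [k]" by auto
    have "c (k \<odot>\<^bsub>M\<^esub> x) [\<one>] = k \<odot>\<^bsub>Q\<^esub> c x [\<one>]" using module_homD(3)[OF h k(1) x] .
    also have "\<dots> = c x (k \<odot>\<^bsub>line\<^esub> [\<one>])" using module_homD(3)[OF bilinear_onD(1)[OF c x] k(1) 1] by simp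
    finally show "c (hd l \<odot>\<^bsub>M\<^esub> x) [\<one>] = c x l" using k by simp
  next
    fix h' t assume "\<forall>x\<in>carrier M. \<forall>l\<in>carrier line. h' (hd l \<odot>\<^bsub>M\<^esub> x) = c x l" and t: "t \<in> carrier M"
    then have "h' (hd [\<one>] \<odot>\<^bsub>M\<^esub> t) = c t [\<one>]" using 1 by blast
    then show "h' t = c t [\<one>]" using t by simp
  qed
qed

text \<open>
  The free module on a finite set \<open>S\<close> and its tensor product with \<open>M\<close> are given up to
  isomorphisms \<open>\<alpha>\<close> and \<open>\<gamma>\<close>, since they are needed with carriers consisting of lists.
\<close>

lemma tensor_fun_mod:
  assumes M: "Module.module K M" and S: "finite S" and N: "Module.module K N"
    and \<alpha>: "\<alpha> \<in> module_hom K N (fun_mod S line)" "bij_betw \<alpha> (carrier N) (S \<rightarrow>\<^sub>E carrier line)"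
    and T: "Module.module K T"
    and \<gamma>: "\<gamma> \<in> module_hom K (fun_mod S M) T" "bij_betw \<gamma> (S \<rightarrow>\<^sub>E carrier M) (carrier T)"
  shows "is_tensor_product K M N T (\<lambda>x d. \<gamma> (\<lambda>g\<in>S. hd (\<alpha> d g) \<odot>\<^bsub>M\<^esub> x))"
    (is "is_tensor_product K M N T ?b")
  unfolding is_tensor_product_def
proof (intro conjI allI impI)
  interpret M: Module.module K M by fact
  have \<alpha>S: "\<alpha> d g \<in> carrier line" if "d \<in> carrier N" "g \<in> S" for d g
    using PiE_mem[OF _ that(2)] module_homD(1)[OF \<alpha>(1) that(1)] by simp
  have hd\<alpha>: "hd (\<alpha> d g) \<in> carrier K" "[hd (\<alpha> d g)] = \<alpha> d g" if "d \<in> carrier N" "g \<in> S" for d g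
    using \<alpha>S[OF that] by auto
  have mem: "(\<lambda>g\<in>S. hd (\<alpha> d g) \<odot>\<^bsub>M\<^esub> x) \<in> carrier (fun_mod S M)" if "x \<in> carrier M" "d \<in> carrier N" for x d
    unfolding fun_mod_simps using that by (intro PiE_restrictI) (simp add: hd\<alpha>)
  show "bilinear_on K M N T ?b"
    unfolding bilinear_on_def
  proof (intro conjI ballI)
    fix x assume x: "x \<in> carrier M"
    have "(\<lambda>d. \<lambda>g\<in>S. hd (\<alpha> d g) \<odot>\<^bsub>M\<^esub> x) \<in> module_hom K N (fun_mod S M)"
    proof (rule module_homI)
      fix d e assume de: "d \<in> carrier N" "e \<in> carrier N"
      show "(\<lambda>g\<in>S. hd (\<alpha> (d \<oplus>\<^bsub>N\<^esub> e) g) \<odot>\<^bsub>M\<^esub> x)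
          = (\<lambda>g\<in>S. hd (\<alpha> d g) \<odot>\<^bsub>M\<^esub> x) \<oplus>\<^bsub>fun_mod S M\<^esub> (\<lambda>g\<in>S. hd (\<alpha> e g) \<odot>\<^bsub>M\<^esub> x)"
        unfolding module_homD(2)[OF \<alpha>(1) de] fun_mod_simps
        using x hd\<alpha>(1) de by (intro restrict_ext) (simp add: M.smult_l_distr)
    next
      fix a d assume ad: "a \<in> carrier K" "d \<in> carrier N"
      show "(\<lambda>g\<in>S. hd (\<alpha> (a \<odot>\<^bsub>N\<^esub> d) g) \<odot>\<^bsub>M\<^esub> x) = a \<odot>\<^bsub>fun_mod S M\<^esub> (\<lambda>g\<in>S. hd (\<alpha> d g) \<odot>\<^bsub>M\<^esub> x)"
        unfolding module_homD(3)[OF \<alpha>(1) ad] fun_mod_simps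
        using x hd\<alpha>(1) ad by (intro restrict_ext) (simp add: M.smult_assoc1)
    qed (rule mem[OF x])
    then show "?b x \<in> module_hom K N T" by (rule module_hom_comp[OF _ \<gamma>(1)])
  next
    fix d assume d: "d \<in> carrier N"
    have "(\<lambda>x. \<lambda>g\<in>S. hd (\<alpha> d g) \<odot>\<^bsub>M\<^esub> x) \<in> module_hom K M (fun_mod S M)"
    proof (rule module_homI)
      fix x y assume "x \<in> carrier M" "y \<in> carrier M"
      then show "(\<lambda>g\<in>S. hd (\<alpha> d g) \<odot>\<^bsub>M\<^esub> (x \<oplus>\<^bsub>M\<^esub> y))
          = (\<lambda>g\<in>S. hd (\<alpha> d g) \<odot>\<^bsub>M\<^esub> x) \<oplus>\<^bsub>fun_mod S M\<^esub> (\<lambda>g\<in>S. hd (\<alpha> d g) \<odot>\<^bsub>M\<^esub> y)"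
        unfolding fun_mod_simps using hd\<alpha>(1)[OF d] by (intro restrict_ext) (simp add: M.smult_r_distr)
    next
      fix a x assume "a \<in> carrier K" "x \<in> carrier M"
      then show "(\<lambda>g\<in>S. hd (\<alpha> d g) \<odot>\<^bsub>M\<^esub> (a \<odot>\<^bsub>M\<^esub> x)) = a \<odot>\<^bsub>fun_mod S M\<^esub> (\<lambda>g\<in>S. hd (\<alpha> d g) \<odot>\<^bsub>M\<^esub> x)"
        unfolding fun_mod_simps using hd\<alpha>(1)[OF d]
        by (intro restrict_ext) (simp add: M.smult_assoc1[symmetric] K.m_comm)
    qed (rule mem[OF _ d])
    then show "(\<lambda>x. ?b x d) \<in> module_hom K M T" by (rule module_hom_comp[OF _ \<gamma>(1)])
  qed
  fix Q c assume "Module.module K Q \<and> bilinear_on K M N Q c"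
  then have Q: "Module.module K Q" and c: "bilinear_on K M N Q c" by auto
  interpret Q: Module.module K Q by fact
  define \<alpha>' where "\<alpha>' = inv_into (carrier N) \<alpha>"
  define \<gamma>' where "\<gamma>' = inv_into (carrier (fun_mod S M)) \<gamma>"
  have \<alpha>': "\<alpha>' \<in> module_hom K (fun_mod S line) N"
    unfolding \<alpha>'_def by (rule module_hom_inv_into[OF N \<alpha>(1)]) (simp add: \<alpha>(2) del: line_simps)
  have \<gamma>': "\<gamma>' \<in> module_hom K T (fun_mod S M)"
    unfolding \<gamma>'_def by (rule module_hom_inv_into[OF fun_mod_module[OF M] \<gamma>(1)]) (simp add: \<gamma>(2))
  have \<alpha>'\<alpha>: "\<alpha>' (\<alpha> d) = d" if "d \<in> carrier N" for d
    unfolding \<alpha>'_def by (rule bij_betw_inv_into_left[OF \<alpha>(2) that])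
  have \<alpha>\<alpha>': "\<alpha> (\<alpha>' u) = u" if "u \<in> S \<rightarrow>\<^sub>E carrier line" for u
    unfolding \<alpha>'_def by (rule bij_betw_inv_into_right[OF \<alpha>(2) that])
  have \<gamma>'\<gamma>: "\<gamma>' (\<gamma> d) = d" if "d \<in> carrier (fun_mod S M)" for d
    using bij_betw_inv_into_left[OF \<gamma>(2), of d] that unfolding \<gamma>'_def by simp
  have \<gamma>\<gamma>': "\<gamma> (\<gamma>' t) = t" if "t \<in> carrier T" for t
    using bij_betw_inv_into_right[OF \<gamma>(2) that] unfolding \<gamma>'_def by simp
  have "[\<one>] \<in> carrier line" by simp
  from module_homD(1)[OF single_hom[OF line_module] this]
  have one: "single S line g [\<one>] \<in> S \<rightarrow>\<^sub>E carrier line" for g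
    unfolding fun_mod_simps .
  \<comment> \<open>The element of \<open>N\<close> whose coordinate function under
    \<open>\<alpha>\<close> is the basis vector at \<open>g\<close>.\<close>
  define \<delta> where "\<delta> g = \<alpha>' (single S line g [\<one>])" for g
  have \<delta>: "\<delta> g \<in> carrier N" for g
    unfolding \<delta>_def using module_homD(1)[OF \<alpha>'] one by simp
  have \<gamma>'m: "\<gamma>' t g \<in> carrier M" if "t \<in> carrier T" "g \<in> S" for t g
    using PiE_mem[OF _ that(2)] module_homD(1)[OF \<gamma>' that(1)] by simp
  note c\<delta> = bilinear_onD(2)[OF c \<delta>]
  \<comment> \<open>Linearity leaves no other choice: \<open>t\<close> is the sum over
    \<open>g\<close> of its coefficient at \<open>g\<close> tensored with
    \<open>\<delta> g\<close>.\<close>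
  define h where "h t = (\<Oplus>\<^bsub>Q\<^esub>g\<in>S. c (\<gamma>' t g) (\<delta> g))" for t
  have c\<delta>m: "c (\<gamma>' t g) (\<delta> g) \<in> carrier Q" if "t \<in> carrier T" "g \<in> S" for t g
    by (rule module_homD(1)[OF c\<delta> \<gamma>'m[OF that]])
  have h: "h \<in> module_hom K T Q"
  proof (rule module_homI)
    show "h t \<in> carrier Q" if "t \<in> carrier T" for t
      unfolding h_def by (intro Q.M.finsum_closed Pi_I c\<delta>m[OF that])
  next
    fix t u assume tu: "t \<in> carrier T" "u \<in> carrier T"
    have "h (t \<oplus>\<^bsub>T\<^esub> u) = (\<Oplus>\<^bsub>Q\<^esub>g\<in>S. c (\<gamma>' t g) (\<delta> g) \<oplus>\<^bsub>Q\<^esub> c (\<gamma>' u g) (\<delta> g))"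
      unfolding h_def module_homD(2)[OF \<gamma>' tu] fun_mod_simps
    proof (intro Q.M.finsum_cong' refl Pi_I)
      fix g assume g: "g \<in> S"
      show "c (\<gamma>' t g) (\<delta> g) \<oplus>\<^bsub>Q\<^esub> c (\<gamma>' u g) (\<delta> g) \<in> carrier Q"
        using c\<delta>m tu g by simp
      show "c ((\<lambda>s\<in>S. \<gamma>' t s \<oplus>\<^bsub>M\<^esub> \<gamma>' u s) g) (\<delta> g) = c (\<gamma>' t g) (\<delta> g) \<oplus>\<^bsub>Q\<^esub> c (\<gamma>' u g) (\<delta> g)"
        using module_homD(2)[OF c\<delta> \<gamma>'m[OF tu(1) g] \<gamma>'m[OF tu(2) g]] g by simp
    qed
    also have "\<dots> = h t \<oplus>\<^bsub>Q\<^esub> h u"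
      unfolding h_def by (intro Q.M.finsum_addf Pi_I c\<delta>m tu)
    finally show "h (t \<oplus>\<^bsub>T\<^esub> u) = h t \<oplus>\<^bsub>Q\<^esub> h u" .
  next
    fix a t assume a: "a \<in> carrier K" and t: "t \<in> carrier T"
    have "h (a \<odot>\<^bsub>T\<^esub> t) = (\<Oplus>\<^bsub>Q\<^esub>g\<in>S. a \<odot>\<^bsub>Q\<^esub> c (\<gamma>' t g) (\<delta> g))"
      unfolding h_def module_homD(3)[OF \<gamma>' a t] fun_mod_simps
    proof (intro Q.M.finsum_cong' refl Pi_I)
      fix g assume g: "g \<in> S"
      show "a \<odot>\<^bsub>Q\<^esub> c (\<gamma>' t g) (\<delta> g) \<in> carrier Q"
        using c\<delta>m t a g by simp
      show "c ((\<lambda>s\<in>S. a \<odot>\<^bsub>M\<^esub> \<gamma>' t s) g) (\<delta> g) = a \<odot>\<^bsub>Q\<^esub> c (\<gamma>' t g) (\<delta> g)"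
        using module_homD(3)[OF c\<delta> a \<gamma>'m[OF t g]] g by simp
    qed
    also have "\<dots> = a \<odot>\<^bsub>Q\<^esub> h t"
      unfolding h_def by (intro Q.finsum_smult_ldistr[OF S a, symmetric] Pi_I c\<delta>m t)
    finally show "h (a \<odot>\<^bsub>T\<^esub> t) = a \<odot>\<^bsub>Q\<^esub> h t" .
  qed
  \<comment> \<open>The expansion of \<open>d\<close> in the basis \<open>\<delta>\<close>; it lets
    the sum defining \<open>h\<close> be pulled into the second argument of
    \<open>c\<close>.\<close>
  have d_sum: "(\<Oplus>\<^bsub>N\<^esub>g\<in>S. hd (\<alpha> d g) \<odot>\<^bsub>N\<^esub> \<delta> g) = d" if d: "d \<in> carrier N" for d
  proof -
    interpret N: Module.module K N by fact
    have \<alpha>d: "\<alpha> d \<in> S \<rightarrow>\<^sub>E carrier line" using module_homD(1)[OF \<alpha>(1) d] by simp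
    have sm: "single S line g (\<alpha> d g) \<in> carrier (fun_mod S line)" if "g \<in> S" for g
      by (rule module_homD(1)[OF single_hom[OF line_module] \<alpha>S[OF d that]])
    have "(\<Oplus>\<^bsub>N\<^esub>g\<in>S. hd (\<alpha> d g) \<odot>\<^bsub>N\<^esub> \<delta> g) = (\<Oplus>\<^bsub>N\<^esub>g\<in>S. \<alpha>' (single S line g (\<alpha> d g)))"
    proof (intro N.M.finsum_cong' refl Pi_I)
      fix g assume g: "g \<in> S"
      show "\<alpha>' (single S line g (\<alpha> d g)) \<in> carrier N" by (rule module_homD(1)[OF \<alpha>' sm[OF g]])
      have "hd (\<alpha> d g) \<odot>\<^bsub>N\<^esub> \<delta> g = \<alpha>' (hd (\<alpha> d g) \<odot>\<^bsub>fun_mod S line\<^esub> single S line g [\<one>])"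
        unfolding \<delta>_def using module_homD(3)[OF \<alpha>' hd\<alpha>(1)[OF d g]] one by simp
      also have "hd (\<alpha> d g) \<odot>\<^bsub>fun_mod S line\<^esub> single S line g [\<one>]
          = single S line g (hd (\<alpha> d g) \<odot>\<^bsub>line\<^esub> [\<one>])"
        by (rule module_homD(3)[OF single_hom[OF line_module] hd\<alpha>(1)[OF d g], symmetric]) simp
      also have "hd (\<alpha> d g) \<odot>\<^bsub>line\<^esub> [\<one>] = \<alpha> d g" using hd\<alpha>[OF d g] by simp
      finally show "hd (\<alpha> d g) \<odot>\<^bsub>N\<^esub> \<delta> g = \<alpha>' (single S line g (\<alpha> d g))" .
    qed
    also have "\<dots> = \<alpha>' (\<Oplus>\<^bsub>fun_mod S line\<^esub>g\<in>S. single S line g (\<alpha> d g))"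
      by (rule module_hom_finsum[OF fun_mod_module[OF line_module] N \<alpha>' S sm, symmetric])
    also have "\<dots> = d" unfolding fun_mod_decompose[OF line_module S \<alpha>d] by (rule \<alpha>'\<alpha>[OF d])
    finally show ?thesis .
  qed
  show "\<exists>h\<in>module_hom K T Q. (\<forall>x\<in>carrier M. \<forall>y\<in>carrier N. h (?b x y) = c x y) \<and>
      (\<forall>h'\<in>module_hom K T Q. (\<forall>x\<in>carrier M. \<forall>y\<in>carrier N. h' (?b x y) = c x y) \<longrightarrow>
        (\<forall>t\<in>carrier T. h' t = h t))"
  proof (rule bexI[OF _ h], intro conjI ballI impI)
    fix x d assume x: "x \<in> carrier M" and d: "d \<in> carrier N"
    have "h (?b x d) = (\<Oplus>\<^bsub>Q\<^esub>g\<in>S. c x (hd (\<alpha> d g) \<odot>\<^bsub>N\<^esub> \<delta> g))"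
      unfolding h_def \<gamma>'\<gamma>[OF mem[OF x d]]
    proof (intro Q.M.finsum_cong' refl Pi_I)
      fix g assume g: "g \<in> S"
      show "c x (hd (\<alpha> d g) \<odot>\<^bsub>N\<^esub> \<delta> g) \<in> carrier Q"
        by (intro module_homD(1)[OF bilinear_onD(1)[OF c x]] module_closed(3)[OF N] hd\<alpha>(1)[OF d g] \<delta>)
      show "c ((\<lambda>g\<in>S. hd (\<alpha> d g) \<odot>\<^bsub>M\<^esub> x) g) (\<delta> g) = c x (hd (\<alpha> d g) \<odot>\<^bsub>N\<^esub> \<delta> g)"
        using module_homD(3)[OF c\<delta> hd\<alpha>(1)[OF d g] x]
          module_homD(3)[OF bilinear_onD(1)[OF c x] hd\<alpha>(1)[OF d g] \<delta>] g by simp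
    qed
    also have "\<dots> = c x (\<Oplus>\<^bsub>N\<^esub>g\<in>S. hd (\<alpha> d g) \<odot>\<^bsub>N\<^esub> \<delta> g)"
      by (rule module_hom_finsum[OF N Q bilinear_onD(1)[OF c x] S, symmetric])
        (intro module_closed(3)[OF N] hd\<alpha>(1)[OF d] \<delta>)
    finally show "h (?b x d) = c x d" unfolding d_sum[OF d] .
  next
    fix h' t assume h': "h' \<in> module_hom K T Q" and eq: "\<forall>x\<in>carrier M. \<forall>y\<in>carrier N. h' (?b x y) = c x y"
      and t: "t \<in> carrier T"
    have tm: "\<gamma>' t \<in> S \<rightarrow>\<^sub>E carrier M" using module_homD(1)[OF \<gamma>' t] by simp
    have sm: "single S M g (\<gamma>' t g) \<in> carrier (fun_mod S M)" if "g \<in> S" for g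
      by (rule module_homD(1)[OF single_hom[OF M] \<gamma>'m[OF t that]])
    have "h' t = h' (\<gamma> (\<Oplus>\<^bsub>fun_mod S M\<^esub>g\<in>S. single S M g (\<gamma>' t g)))"
      unfolding fun_mod_decompose[OF M S tm] \<gamma>\<gamma>'[OF t] ..
    also have "\<dots> = (\<Oplus>\<^bsub>Q\<^esub>g\<in>S. h' (\<gamma> (single S M g (\<gamma>' t g))))"
      by (rule module_hom_finsum[OF fun_mod_module[OF M] Q module_hom_comp[OF \<gamma>(1) h'] S sm])
    also have "\<dots> = h t"
      unfolding h_def
    proof (intro Q.M.finsum_cong' refl Pi_I)
      fix g assume g: "g \<in> S"
      show "c (\<gamma>' t g) (\<delta> g) \<in> carrier Q" by (rule c\<delta>m[OF t g])
      have "\<alpha> (\<delta> g) = single S line g [\<one>]" unfolding \<delta>_def by (rule \<alpha>\<alpha>'[OF one])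
      then have "(\<lambda>k\<in>S. hd (\<alpha> (\<delta> g) k) \<odot>\<^bsub>M\<^esub> \<gamma>' t g) = single S M g (\<gamma>' t g)"
        using \<gamma>'m[OF t g] by (auto simp: single_def intro!: restrict_ext)
      then show "h' (\<gamma> (single S M g (\<gamma>' t g))) = c (\<gamma>' t g) (\<delta> g)"
        using eq \<gamma>'m[OF t g] \<delta> by metis
    qed
    finally show "h' t = h t" .
  qed
qed

text \<open>In dimensions of \<open>S\<close> the second factor is the line, elsewhere it is zero.
  Only the shape of \<open>Z\<close> is prescribed, so that both a truncation of \<open>X\<close>
  and an \<open>X\<close> that already vanishes outside \<open>S\<close> qualify.\<close>

lemma tensor_trunc_unit:
  assumes X: "VI_module p K X" and Z: "VI_module p K Z"
    and ZX: "\<And>U. U \<in> VI_ob p \<Longrightarrow> vdim U \<in> S \<Longrightarrow> obj Z U = obj X U"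
    and Z0: "\<And>U. U \<in> VI_ob p \<Longrightarrow> vdim U \<notin> S \<Longrightarrow> carrier (obj Z U) = {\<zero>\<^bsub>obj Z U\<^esub>}"
    and arr: "\<And>U V f x. U \<in> VI_ob p \<Longrightarrow> V \<in> VI_ob p \<Longrightarrow> f \<in> VI_hom p U V \<Longrightarrow> x \<in> carrier (obj X U) \<Longrightarrow>
      vdim U \<in> S \<Longrightarrow> vdim V \<in> S \<Longrightarrow>
      arr Z U V f x = (if {vdim U..vdim V} \<subseteq> S then arr X U V f x else \<zero>\<^bsub>obj Z V\<^esub>)"
  shows "tensor \<A> X (trunc S unit_vi) Z"
  unfolding exact_simps VI_tensor_def
proof (intro exI conjI ballI)
  let ?b = "\<lambda>U x l. if vdim U \<in> S then hd l \<odot>\<^bsub>obj X U\<^esub> x else \<zero>\<^bsub>obj Z U\<^esub>"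
  fix U assume U: "U \<in> VI_ob p"
  show "is_tensor_product K (obj X U) (obj (trunc S unit_vi) U) (obj Z U) (?b U)"
  proof (cases "vdim U \<in> S")
    case True
    have "obj (trunc S unit_vi) U = line" using True by (simp add: trunc_def line_def)
    then show ?thesis using tensor_line[OF VI_moduleD(1)[OF X U]] True ZX[OF U] by simp
  next
    case False
    then show ?thesis
      using tensor_zero_module[OF VI_moduleD(1)[OF X U] VI_moduleD(1)[OF VI_module_trunc[OF VI_module_unit] U]
          VI_moduleD(1)[OF Z U], of S] Z0[OF U] by simp
  qed
  fix V f x l
  assume V: "V \<in> VI_ob p" and f: "f \<in> VI_hom p U V" and x: "x \<in> carrier (obj X U)"
    and l: "l \<in> carrier (obj (trunc S unit_vi) U)"
  note arrX = VI_module_arrD[OF X U V f] and arrZ = VI_module_arrD[OF Z U V f]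
  interpret M: Module.module K "obj X U" using VI_moduleD(1)[OF X U] .
  interpret N: Module.module K "obj X V" using VI_moduleD(1)[OF X V] .
  have hl: "hd l \<in> carrier K" using l by (auto split: if_splits)
  show "arr Z U V f (?b U x l) = ?b V (arr X U V f x) (arr (trunc S unit_vi) U V f l)"
  proof (cases "vdim U \<in> S")
    case US: True
    have lx: "hd l \<odot>\<^bsub>obj X U\<^esub> x \<in> carrier (obj X U)" using hl x by simp
    show ?thesis
    proof (cases "vdim V \<in> S")
      case True
      then show ?thesis
        using US arr[OF U V f lx] arrX(1,3) hl x ZX[OF V] by simp
    next
      case False
      then show ?thesis using US Z0[OF V] arrZ(1)[of "hd l \<odot>\<^bsub>obj X U\<^esub> x"] ZX[OF U US] lx by simp
    qed
  next
    case False
    then have "\<not> {vdim U..vdim V} \<subseteq> S" using VI_hom_vdim_le[OF U V f] by auto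
    then show ?thesis using False arrZ(4) arrX(1)[OF x] ZX[OF V] by auto
  qed
qed

text \<open>\<open>extl W unit_vi\<close> is the free module on \<open>W\<close>, with list
  carriers. Pointwise this is \<open>tensor_fun_mod\<close> with decoding as \<open>\<alpha>\<close>
  and encoding as \<open>\<gamma>\<close>; what remains is naturality.\<close>

lemma tensor_extl:
  assumes X: "VI_module p K X" and W: "W \<in> VI_ob p"
  shows "tensor \<A> X (extl W unit_vi) (extl W X)"
proof -
  let ?H = "\<lambda>U. VI_hom p W U"
  let ?e = "\<lambda>U. enc (?H U) :: ((nat \<Rightarrow> nat) \<Rightarrow> 'k list) \<Rightarrow> 'k list"
  define \<alpha> where "\<alpha> U = inv_into (?H U \<rightarrow>\<^sub>E carrier line) (?e U)" for U
  define b where "b U x d = ?e U (\<lambda>g\<in>?H U. hd (\<alpha> U d g) \<odot>\<^bsub>obj X U\<^esub> x)" for U x d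
  note VE = VI_module_ext[OF X W] VI_module_ext[OF VI_module_unit W]
  note VL = VI_module_extl[OF X W] VI_module_extl[OF VI_module_unit W]
  note tr = extl_trans[OF X W] extl_trans[OF VI_module_unit W]
  have bij: "bij_betw (?e U) (?H U \<rightarrow>\<^sub>E carrier (obj X U)) (carrier (obj (extl W X) U))"
    "bij_betw (?e U) (?H U \<rightarrow>\<^sub>E carrier line) (carrier (obj (extl W unit_vi) U))"
    if U: "U \<in> VI_ob p" for U
    using inj_on_enc[OF finite_VI_hom[OF W U]] by (simp_all add: bij_betw_def extl_carrier)
  have \<alpha>e: "\<alpha> U (?e U c) = c" if "U \<in> VI_ob p" "c \<in> ?H U \<rightarrow>\<^sub>E carrier line" for U c
    unfolding \<alpha>_def by (rule bij_betw_inv_into_left[OF bij(2)[OF that(1)] that(2)])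
  have "is_tensor_product K (obj X U) (obj (extl W unit_vi) U) (obj (extl W X) U) (b U)"
    if U: "U \<in> VI_ob p" for U
    unfolding b_def
  proof (rule tensor_fun_mod[OF VI_moduleD(1)[OF X U] finite_VI_hom[OF W U] VI_moduleD(1)[OF VL(2) U]
        _ _ VI_moduleD(1)[OF VL(1) U] _ bij(1)[OF U]])
    have e: "?e U \<in> module_hom K (fun_mod (?H U) line) (obj (extl W unit_vi) U)"
      using VI_nat_transD(1)[OF tr(2) U] by simp
    show "\<alpha> U \<in> module_hom K (obj (extl W unit_vi) U) (fun_mod (?H U) line)"
      using module_hom_inv_into[OF fun_mod_module[OF line_module] e] bij(2)[OF U] unfolding \<alpha>_def by simp
    show "bij_betw (\<alpha> U) (carrier (obj (extl W unit_vi) U)) (?H U \<rightarrow>\<^sub>E carrier line)"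
      unfolding \<alpha>_def by (rule bij_betw_inv_into[OF bij(2)[OF U]])
    show "?e U \<in> module_hom K (fun_mod (?H U) (obj X U)) (obj (extl W X) U)"
      using VI_nat_transD(1)[OF tr(1) U] by simp
  qed
  moreover have "arr (extl W X) U V f (b U x d) = b V (arr X U V f x) (arr (extl W unit_vi) U V f d)"
    if U: "U \<in> VI_ob p" and V: "V \<in> VI_ob p" and f: "f \<in> VI_hom p U V" and x: "x \<in> carrier (obj X U)"
      and d: "d \<in> carrier (obj (extl W unit_vi) U)" for U V f x d
  proof -
    interpret M: Module.module K "obj X U" using VI_moduleD(1)[OF X U] .
    interpret N: Module.module K "obj X V" using VI_moduleD(1)[OF X V] .
    obtain c where c: "c \<in> ?H U \<rightarrow>\<^sub>E carrier line" "d = ?e U c"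
      using d unfolding extl_carrier by auto
    have hc: "hd (c g) \<in> carrier K" if "g \<in> ?H U" for g using PiE_mem[OF c(1) that] by auto
    have cx: "(\<lambda>g\<in>?H U. hd (c g) \<odot>\<^bsub>obj X U\<^esub> x) \<in> ?H U \<rightarrow>\<^sub>E carrier (obj X U)"
      by (rule PiE_restrictI) (simp add: hc x)
    have fc: "arr (ext W unit_vi) U V f c \<in> ?H V \<rightarrow>\<^sub>E carrier line"
      using ext_arr_mem[OF VI_module_unit W U V f, of c] c(1) by simp
    have fx: "arr X U V f x \<in> carrier (obj X V)" by (rule VI_module_arrD(1)[OF X U V f x])
    have hfc: "hd (arr (ext W unit_vi) U V f c h) \<in> carrier K" if "h \<in> ?H V" for h
      using PiE_mem[OF fc that] by auto
    have "arr (extl W X) U V f (b U x d) = ?e V (arr (ext W X) U V f (\<lambda>g\<in>?H U. hd (c g) \<odot>\<^bsub>obj X U\<^esub> x))"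
      unfolding b_def c(2) \<alpha>e[OF U c(1)]
      by (rule VI_nat_transD(2)[OF tr(1) U V f, symmetric]) (use cx in \<open>simp only: ext_obj fun_mod_simps\<close>)
    also have "arr (ext W X) U V f (\<lambda>g\<in>?H U. hd (c g) \<odot>\<^bsub>obj X U\<^esub> x)
        = (\<lambda>h\<in>?H V. hd (arr (ext W unit_vi) U V f c h) \<odot>\<^bsub>obj X V\<^esub> arr X U V f x)"
    proof (rule ext_arr_eqI[OF X W U V f cx])
      show "(\<lambda>h\<in>?H V. hd (arr (ext W unit_vi) U V f c h) \<odot>\<^bsub>obj X V\<^esub> arr X U V f x)
          \<in> ?H V \<rightarrow>\<^sub>E carrier (obj X V)"
        using hfc fx by (intro PiE_restrictI) simp
    next
      fix g assume g: "g \<in> ?H U"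
      show "(\<lambda>h\<in>?H V. hd (arr (ext W unit_vi) U V f c h) \<odot>\<^bsub>obj X V\<^esub> arr X U V f x) (compose (carrier W) f g)
          = arr X U V f ((\<lambda>g\<in>?H U. hd (c g) \<odot>\<^bsub>obj X U\<^esub> x) g)"
        using g VI_hom_compose[OF g f W] ext_arr(1)[OF W f g, of unit_vi c]
          VI_module_arrD(3)[OF X U V f hc[OF g] x] by simp
    next
      fix h assume h: "h \<in> ?H V" "h \<notin> compose (carrier W) f ` ?H U"
      show "(\<lambda>h\<in>?H V. hd (arr (ext W unit_vi) U V f c h) \<odot>\<^bsub>obj X V\<^esub> arr X U V f x) h = \<zero>\<^bsub>obj X V\<^esub>"
        using h(1) ext_arr(2)[OF W f h, of unit_vi c] fx by simp
    qed
    also have "?e V (\<lambda>h\<in>?H V. hd (arr (ext W unit_vi) U V f c h) \<odot>\<^bsub>obj X V\<^esub> arr X U V f x)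
        = b V (arr X U V f x) (?e V (arr (ext W unit_vi) U V f c))"
      unfolding b_def \<alpha>e[OF V fc] ..
    also have "?e V (arr (ext W unit_vi) U V f c) = arr (extl W unit_vi) U V f d"
      unfolding c(2) by (rule VI_nat_transD(2)[OF tr(2) U V f]) (use c(1) in simp)
    finally show ?thesis .
  qed
  ultimately show ?thesis unfolding exact_simps VI_tensor_def by (intro exI[of _ b] conjI ballI)
qed

section \<open>Linear functionals\<close>

text \<open>The images of the finitely many generators span \<open>obj X V\<close>, so the space has
  finite coordinates, one of which is nonzero at \<open>x\<close>.\<close>

lemma Ob_functional:
  assumes X: "X \<in> Ob \<A>" and V: "V \<in> VI_ob p" and x: "x \<in> carrier (obj X V)" "x \<noteq> \<zero>\<^bsub>obj X V\<^esub>"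
  obtains \<phi> where "\<phi> \<in> module_hom K (obj X V) line" "\<phi> x \<noteq> [\<zero>]"
proof -
  have VX: "VI_module p K X" using Ob_module[OF X] .
  obtain G where G: "finite G" "VI_generates p K X G" using X unfolding Ob_iff by blast
  note AG = VI_generatesD(1,2)[OF G(2)]
  define B where "B V = (\<Union>(A, x)\<in>G. (\<lambda>f. arr X A V f x) ` VI_hom p A V)" for V
  have finB: "finite (B V)" using G(1) AG(1) finite_VI_hom[OF _ V] unfolding B_def
    by (intro finite_UN_I) (auto split: prod.splits)
  have BX: "B V \<subseteq> carrier (obj X V)" if "V \<in> VI_ob p" for V
    unfolding B_def using VI_module_arrD(1)[OF VX AG(1) that _ AG(2)] by auto
  \<comment> \<open>The span of \<open>B V\<close>, taken as an intersection of subspaces: since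
    preimages of subspaces are subspaces, it is visibly preserved by the transition maps.\<close>
  define N where "N V = {x \<in> carrier (obj X V). \<forall>L. submodule K L (obj X V) \<longrightarrow> B V \<subseteq> L \<longrightarrow> x \<in> L}" for V
  have N: "VI_sub p K X N" unfolding VI_sub_iff[OF VX]
  proof (intro conjI ballI)
    fix U assume U: "U \<in> VI_ob p"
    note cl = module_closed[OF VI_moduleD(1)[OF VX U]]
    show "N U \<subseteq> carrier (obj X U)" unfolding N_def by blast
    show "\<zero>\<^bsub>obj X U\<^esub> \<in> N U" unfolding N_def using cl(1) by (auto simp: submodule_def)
    show "x \<oplus>\<^bsub>obj X U\<^esub> y \<in> N U" if "x \<in> N U" "y \<in> N U" for x y
      using that cl(2) unfolding N_def by (simp add: submodule_def)
    show "a \<odot>\<^bsub>obj X U\<^esub> x \<in> N U" if "a \<in> carrier K" "x \<in> N U" for a x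
      using that cl(3) unfolding N_def by (simp add: submodule_def)
  next
    fix U V f x assume U: "U \<in> VI_ob p" and V: "V \<in> VI_ob p" and f: "f \<in> VI_hom p U V" and x: "x \<in> N U"
    note arr = VI_module_arrD[OF VX U V f] and MU = VI_moduleD(1)[OF VX U]
    have "arr X U V f x \<in> L" if L: "submodule K L (obj X V)" "B V \<subseteq> L" for L
    proof -
      have "submodule K {y \<in> carrier (obj X U). arr X U V f y \<in> L} (obj X U)"
        using L(1) module_closed[OF MU] arr unfolding submodule_iff[OF MU] submodule_iff[OF VI_moduleD(1)[OF VX V]]
        by simp
      moreover have "B U \<subseteq> {y \<in> carrier (obj X U). arr X U V f y \<in> L}"
      proof
        fix b assume b: "b \<in> B U"
        then obtain A z g where *: "(A, z) \<in> G" "g \<in> VI_hom p A U" "b = arr X A U g z"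
          unfolding B_def by auto
        have "arr X U V f b = arr X A V (compose (carrier A) f g) z"
          unfolding *(3) by (rule VI_moduleD(4)[OF VX AG(1)[OF *(1)] U V *(2) f AG(2)[OF *(1)], symmetric])
        moreover have "\<dots> \<in> B V"
          unfolding B_def using *(1) VI_hom_compose[OF *(2) f AG(1)[OF *(1)]] by blast
        ultimately show "b \<in> {y \<in> carrier (obj X U). arr X U V f y \<in> L}" using BX[OF U] b L(2) by auto
      qed
      ultimately show ?thesis using x unfolding N_def by blast
    qed
    moreover have "arr X U V f x \<in> carrier (obj X V)" using x arr(1) unfolding N_def by blast
    ultimately show "arr X U V f x \<in> N V" unfolding N_def by blast
  qed
  have GN: "x \<in> N A" if "(A, x) \<in> G" for A x
  proof -
    have "arr X A A (\<lambda>v\<in>carrier A. v) x \<in> B A"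
      unfolding B_def using that VI_hom_id[OF AG(1)[OF that]] by blast
    then have "x \<in> B A" using VI_moduleD(3)[OF VX AG[OF that]] by simp
    then show ?thesis unfolding N_def using AG(2)[OF that] by blast
  qed
  have vs: "vectorspace K (obj X V)"
    using VI_moduleD(1)[OF VX V] K.field_axioms by (simp add: vectorspace_def)
  interpret V: vectorspace K "obj X V" by (rule vs)
  have "carrier (obj X V) \<subseteq> V.span (B V)"
  proof
    fix y assume y: "y \<in> carrier (obj X V)"
    have "y \<in> N V" by (rule VI_generatesD(3)[OF G(2) N GN V y])
    moreover have "submodule K (V.span (B V)) (obj X V)" by (rule V.span_is_submodule[OF BX[OF V]])
    moreover have "B V \<subseteq> V.span (B V)" by (rule V.in_own_span[OF BX[OF V]])
    ultimately show "y \<in> V.span (B V)" unfolding N_def by blast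
  qed
  moreover have "V.span (B V) \<subseteq> carrier (obj X V)" by (rule V.span_is_subset2[OF BX[OF V]])
  ultimately have "V.fin_dim" unfolding V.fin_dim_def using finB BX[OF V] by blast
  then obtain n \<phi> where \<phi>: "\<phi> \<in> module_hom K (ring.func_space K {..<n::nat}) (obj X V)"
    "bij_betw \<phi> ({..<n} \<rightarrow>\<^sub>E carrier K) (carrier (obj X V))"
    by (rule fin_dim_coordinates[OF vs])
  define \<psi> where "\<psi> = inv_into ({..<n} \<rightarrow>\<^sub>E carrier K) \<phi>"
  have \<psi>: "\<psi> \<in> module_hom K (obj X V) (ring.func_space K {..<n})"
    using module_hom_inv_into[OF K.func_space_is_module \<phi>(1)] \<phi>(2) by (simp add: K_ring \<psi>_def)
  have \<psi>m: "\<psi> y \<in> {..<n} \<rightarrow>\<^sub>E carrier K" if "y \<in> carrier (obj X V)" for y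
    using module_homD(1)[OF \<psi> that] by (simp add: K_ring)
  have "\<exists>i<n. \<psi> x i \<noteq> \<zero>"
  proof (rule ccontr)
    assume no: "\<not> ?thesis"
    have "\<psi> x = (\<lambda>i\<in>{..<n}. \<zero>)"
      by (rule restrict_eqI[OF \<psi>m[OF x(1)], symmetric]) (use no in auto)
    moreover have "\<phi> (\<psi> x) = x" unfolding \<psi>_def by (rule bij_betw_inv_into_right[OF \<phi>(2) x(1)])
    moreover have "\<phi> (\<lambda>i\<in>{..<n}. \<zero>) = \<zero>\<^bsub>obj X V\<^esub>"
      using module_hom_zero[OF K.func_space_is_module VI_moduleD(1)[OF VX V] \<phi>(1)] by (simp add: K_ring)
    ultimately show False using x(2) by simp
  qed
  then obtain i where i: "i < n" "\<psi> x i \<noteq> \<zero>" by blast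
  have "(\<lambda>y. [\<psi> y i]) \<in> module_hom K (obj X V) line"
  proof (rule module_homI)
    show "[\<psi> y i] \<in> carrier line" if "y \<in> carrier (obj X V)" for y
      using PiE_mem[OF \<psi>m[OF that]] i(1) by simp
  qed (use i(1) in \<open>simp_all add: module_homD(2,3)[OF \<psi>] K_ring\<close>)
  then show ?thesis using i(2) by (intro that) auto
qed

text \<open>If \<open>x\<close> and \<open>y\<close> are nonzero, functionals not vanishing on them
  multiply to a bilinear map that is nonzero at the pair, so the universal map cannot be zero there.
  Both test modules used, the line and \<open>Z\<close> itself, have list carriers, as the universal
  property requires.\<close>

lemma tensor_zero_iff:
  assumes X: "X \<in> Ob \<A>" and Y: "Y \<in> Ob \<A>" and Z: "Z \<in> Ob \<A>" and XYZ: "tensor \<A> X Y Z" and V: "V \<in> VI_ob p"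
  shows "carrier (obj Z V) = {\<zero>\<^bsub>obj Z V\<^esub>} \<longleftrightarrow>
    carrier (obj X V) = {\<zero>\<^bsub>obj X V\<^esub>} \<or> carrier (obj Y V) = {\<zero>\<^bsub>obj Y V\<^esub>}"
proof -
  note MX = VI_moduleD(1)[OF Ob_module[OF X] V] and MY = VI_moduleD(1)[OF Ob_module[OF Y] V]
    and MZ = VI_moduleD(1)[OF Ob_module[OF Z] V]
  obtain b where b: "is_tensor_product K (obj X V) (obj Y V) (obj Z V) b"
    using XYZ V unfolding exact_simps VI_tensor_def by blast
  then have bil: "bilinear_on K (obj X V) (obj Y V) (obj Z V) b" unfolding is_tensor_product_def by blast
  have univ: "\<exists>h\<in>module_hom K (obj Z V) Q.
      (\<forall>x\<in>carrier (obj X V). \<forall>y\<in>carrier (obj Y V). h (b x y) = c x y) \<and>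
      (\<forall>h'\<in>module_hom K (obj Z V) Q.
         (\<forall>x\<in>carrier (obj X V). \<forall>y\<in>carrier (obj Y V). h' (b x y) = c x y) \<longrightarrow>
         (\<forall>t\<in>carrier (obj Z V). h' t = h t))"
    if "Module.module K Q" "bilinear_on K (obj X V) (obj Y V) Q c" for Q :: "('k, 'k list) module" and c
    using b that unfolding is_tensor_product_def by blast
  show ?thesis
  proof
    assume Z0: "carrier (obj Z V) = {\<zero>\<^bsub>obj Z V\<^esub>}"
    show "carrier (obj X V) = {\<zero>\<^bsub>obj X V\<^esub>} \<or> carrier (obj Y V) = {\<zero>\<^bsub>obj Y V\<^esub>}"
    proof (rule ccontr)
      assume "\<not> ?thesis"
      then obtain x y where x: "x \<in> carrier (obj X V)" "x \<noteq> \<zero>\<^bsub>obj X V\<^esub>"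
        and y: "y \<in> carrier (obj Y V)" "y \<noteq> \<zero>\<^bsub>obj Y V\<^esub>"
        using module_closed(1)[OF MX] module_closed(1)[OF MY] by blast
      obtain \<phi> where \<phi>: "\<phi> \<in> module_hom K (obj X V) line" "\<phi> x \<noteq> [\<zero>]" using Ob_functional[OF X V x] .
      obtain \<psi> where \<psi>: "\<psi> \<in> module_hom K (obj Y V) line" "\<psi> y \<noteq> [\<zero>]" using Ob_functional[OF Y V y] .
      have hd: "hd (\<phi> u) \<in> carrier K" "[hd (\<phi> u)] = \<phi> u" if "u \<in> carrier (obj X V)" for u
        using module_homD(1)[OF \<phi>(1) that] by auto
      have hd': "hd (\<psi> u) \<in> carrier K" "[hd (\<psi> u)] = \<psi> u" if "u \<in> carrier (obj Y V)" for u
        using module_homD(1)[OF \<psi>(1) that] by auto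
      let ?c = "\<lambda>x y. [hd (\<phi> x) \<otimes> hd (\<psi> y)]"
      have "bilinear_on K (obj X V) (obj Y V) line ?c"
        unfolding bilinear_on_def
      proof (intro conjI ballI)
        show "?c u \<in> module_hom K (obj Y V) line" if u: "u \<in> carrier (obj X V)" for u
          using module_homD(2,3)[OF \<psi>(1)] hd(1)[OF u] hd'(1)
          by (intro module_homI) (auto simp: K.r_distr K.m_lcomm)
        show "(\<lambda>v. ?c v u) \<in> module_hom K (obj X V) line" if u: "u \<in> carrier (obj Y V)" for u
          using module_homD(2,3)[OF \<phi>(1)] hd'(1)[OF u] hd(1)
          by (intro module_homI) (auto simp: K.l_distr K.m_assoc)
      qed
      from univ[OF line_module this] obtain h where h: "h \<in> module_hom K (obj Z V) line"
        "\<forall>x\<in>carrier (obj X V). \<forall>y\<in>carrier (obj Y V). h (b x y) = ?c x y" by blast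
      have "b x y = \<zero>\<^bsub>obj Z V\<^esub>"
        using module_homD(1)[OF bilinear_onD(1)[OF bil x(1)] y(1)] Z0 by simp
      then have "?c x y = [\<zero>]" using h x(1) y(1) module_hom_zero[OF MZ line_module h(1)] by fastforce
      then have "hd (\<phi> x) = \<zero> \<or> hd (\<psi> y) = \<zero>"
        using K.integral_iff hd(1)[OF x(1)] hd'(1)[OF y(1)] by simp
      then show False using hd(2)[OF x(1)] hd'(2)[OF y(1)] \<phi>(2) \<psi>(2) by auto
    qed
  next
    assume zero: "carrier (obj X V) = {\<zero>\<^bsub>obj X V\<^esub>} \<or> carrier (obj Y V) = {\<zero>\<^bsub>obj Y V\<^esub>}"
    have b0: "b x y = \<zero>\<^bsub>obj Z V\<^esub>" if "x \<in> carrier (obj X V)" "y \<in> carrier (obj Y V)" for x y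
    proof -
      have "x = \<zero>\<^bsub>obj X V\<^esub> \<or> y = \<zero>\<^bsub>obj Y V\<^esub>" using zero that by blast
      then show ?thesis
        using module_hom_zero[OF MY MZ bilinear_onD(1)[OF bil that(1)]]
          module_hom_zero[OF MX MZ bilinear_onD(2)[OF bil that(2)]] by metis
    qed
    \<comment> \<open>\<open>Z\<close> is tested against its own bilinear map \<open>b\<close>. As
      \<open>b\<close> vanishes, the identity and the zero map both induce it, and uniqueness makes
      them equal.\<close>
    obtain h where h: "\<And>h' t. h' \<in> module_hom K (obj Z V) (obj Z V) \<Longrightarrow>
        \<forall>x\<in>carrier (obj X V). \<forall>y\<in>carrier (obj Y V). h' (b x y) = b x y \<Longrightarrow>
        t \<in> carrier (obj Z V) \<Longrightarrow> h' t = h t"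
      using univ[OF MZ bil] by blast
    interpret Z: Module.module K "obj Z V" by (rule MZ)
    have id: "(\<lambda>t. t) \<in> module_hom K (obj Z V) (obj Z V)" by (rule module_homI) auto
    have 0: "(\<lambda>t. \<zero>\<^bsub>obj Z V\<^esub>) \<in> module_hom K (obj Z V) (obj Z V)" by (rule module_homI) auto
    have "t = \<zero>\<^bsub>obj Z V\<^esub>" if "t \<in> carrier (obj Z V)" for t
      using h[OF id _ that] h[OF 0 _ that] b0 by simp
    then show "carrier (obj Z V) = {\<zero>\<^bsub>obj Z V\<^esub>}" using module_closed(1)[OF MZ] by blast
  qed
qed

end

section \<open>Extending injections\<close>

text \<open>If the scalars differed, dividing the difference of \<open>y\<close> and
  \<open>x\<close> by that of \<open>a\<close> and \<open>b\<close> would put \<open>v\<close> into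
  \<open>N\<close>.\<close>

lemma (in vectorspace) add_smult_unique:
  assumes N: "submodule K N V" and v: "v \<in> carrier V" "v \<notin> N"
    and mem: "x \<in> N" "y \<in> N" "a \<in> carrier K" "b \<in> carrier K"
    and eq: "x \<oplus>\<^bsub>V\<^esub> a \<odot>\<^bsub>V\<^esub> v = y \<oplus>\<^bsub>V\<^esub> b \<odot>\<^bsub>V\<^esub> v"
  shows "a = b" "x = y"
proof -
  have NV: "z \<in> carrier V" if "z \<in> N" for z using N that unfolding submodule_def by blast
  have Nsm: "c \<odot>\<^bsub>V\<^esub> z \<in> N" if "c \<in> carrier K" "z \<in> N" for c z
    using N that unfolding submodule_def by blast
  show ab: "a = b"
  proof (rule ccontr)
    assume ne: "a \<noteq> b"
    let ?d = "a \<ominus>\<^bsub>K\<^esub> b"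
    have d: "?d \<in> carrier K" "?d \<noteq> \<zero>\<^bsub>K\<^esub>" using mem ne by auto
    have "?d \<odot>\<^bsub>V\<^esub> v = y \<ominus>\<^bsub>V\<^esub> x"
    proof -
      have av: "a \<odot>\<^bsub>V\<^esub> v \<in> carrier V" "b \<odot>\<^bsub>V\<^esub> v \<in> carrier V" using mem v by auto
      have "a \<odot>\<^bsub>V\<^esub> v = (x \<oplus>\<^bsub>V\<^esub> a \<odot>\<^bsub>V\<^esub> v) \<ominus>\<^bsub>V\<^esub> x"
        using av NV[OF mem(1)] by (simp add: M.minus_eq M.a_ac M.r_neg1 M.r_neg2 M.add_minus_cancel)
      also have "\<dots> = (y \<ominus>\<^bsub>V\<^esub> x) \<oplus>\<^bsub>V\<^esub> b \<odot>\<^bsub>V\<^esub> v"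
        unfolding eq using av NV[OF mem(1)] NV[OF mem(2)] by (simp add: M.minus_eq M.a_ac)
      finally have 1: "a \<odot>\<^bsub>V\<^esub> v = (y \<ominus>\<^bsub>V\<^esub> x) \<oplus>\<^bsub>V\<^esub> b \<odot>\<^bsub>V\<^esub> v" .
      have "?d \<odot>\<^bsub>V\<^esub> v = a \<odot>\<^bsub>V\<^esub> v \<ominus>\<^bsub>V\<^esub> b \<odot>\<^bsub>V\<^esub> v"
        unfolding R.minus_eq using mem v by (simp add: smult_l_distr smult_l_minus M.minus_eq)
      also have "\<dots> = y \<ominus>\<^bsub>V\<^esub> x"
        unfolding 1 using av NV[OF mem(1)] NV[OF mem(2)] by (simp add: M.minus_eq M.a_assoc M.r_neg)
      finally show ?thesis .
    qed
    also have "y \<ominus>\<^bsub>V\<^esub> x = y \<oplus>\<^bsub>V\<^esub> (\<ominus>\<^bsub>K\<^esub> \<one>\<^bsub>K\<^esub>) \<odot>\<^bsub>V\<^esub> x"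
      unfolding M.minus_eq smult_minus_1[OF NV[OF mem(1)]] ..
    also have "\<dots> \<in> N" using N Nsm[of "\<ominus>\<^bsub>K\<^esub> \<one>\<^bsub>K\<^esub>" x] mem unfolding submodule_def by simp
    finally have "inv\<^bsub>K\<^esub> ?d \<odot>\<^bsub>V\<^esub> (?d \<odot>\<^bsub>V\<^esub> v) \<in> N" using Nsm d by blast
    moreover have "inv\<^bsub>K\<^esub> ?d \<odot>\<^bsub>V\<^esub> (?d \<odot>\<^bsub>V\<^esub> v) = v"
      by (rule mult_inverse[OF d(1) v(1) refl d(2), symmetric])
    ultimately show False using v(2) by simp
  qed
  show "x = y" using eq mem v NV unfolding ab by (simp add: M.add.right_cancel)
qed

text \<open>The extension sends \<open>v\<close> to \<open>u\<close>. It is well defined because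
  \<open>v\<close> lies outside \<open>N\<close>, and injective because \<open>u\<close> lies
  outside the image of \<open>h\<close>; \<open>add_smult_unique\<close> is applied once on each
  side.\<close>

lemma hom_extend_by_vector:
  assumes V: "vectorspace R V" and U: "vectorspace R U" and N: "submodule R N V"
    and h: "h \<in> module_hom R (V\<lparr>carrier := N\<rparr>) U" "inj_on h N"
    and v: "v \<in> carrier V" "v \<notin> N" and u: "u \<in> carrier U" "u \<notin> h ` N"
  obtains N' h' where "submodule R N' V" "N \<subseteq> N'" "v \<in> N'" "h' \<in> module_hom R (V\<lparr>carrier := N'\<rparr>) U"
    "inj_on h' N'" "\<forall>x\<in>N. h' x = h x"
proof -
  interpret V: vectorspace R V by fact
  interpret U: vectorspace R U by fact
  note Nd = N[unfolded submodule_iff[OF V.module_axioms]]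
  have NV: "x \<in> carrier V" if "x \<in> N" for x using Nd that by blast
  have hU: "h x \<in> carrier U" if "x \<in> N" for x using module_homD(1)[OF h(1)] that by simp
  have hadd: "h (x \<oplus>\<^bsub>V\<^esub> y) = h x \<oplus>\<^bsub>U\<^esub> h y" if "x \<in> N" "y \<in> N" for x y
    using module_homD(2)[OF h(1)] that by simp
  have hsm: "h (a \<odot>\<^bsub>V\<^esub> x) = a \<odot>\<^bsub>U\<^esub> h x" if "a \<in> carrier R" "x \<in> N" for a x
    using module_homD(3)[OF h(1)] that by simp
  have hN: "submodule R (h ` N) U"
    using submodule_image[OF V.submodule_is_module[OF N] U.module_axioms h(1)] by simp
  define N' where "N' = {x \<oplus>\<^bsub>V\<^esub> a \<odot>\<^bsub>V\<^esub> v | x a. x \<in> N \<and> a \<in> carrier R}"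
  define h' where "h' w = (SOME y. \<exists>x\<in>N. \<exists>a\<in>carrier R. w = x \<oplus>\<^bsub>V\<^esub> a \<odot>\<^bsub>V\<^esub> v \<and> y = h x \<oplus>\<^bsub>U\<^esub> a \<odot>\<^bsub>U\<^esub> u)" for w
  have h'eq: "h' (x \<oplus>\<^bsub>V\<^esub> a \<odot>\<^bsub>V\<^esub> v) = h x \<oplus>\<^bsub>U\<^esub> a \<odot>\<^bsub>U\<^esub> u" if xa: "x \<in> N" "a \<in> carrier R" for x a
    unfolding h'_def
  proof (rule some_equality)
    show "\<exists>x'\<in>N. \<exists>a'\<in>carrier R. x \<oplus>\<^bsub>V\<^esub> a \<odot>\<^bsub>V\<^esub> v = x' \<oplus>\<^bsub>V\<^esub> a' \<odot>\<^bsub>V\<^esub> v \<and> h x \<oplus>\<^bsub>U\<^esub> a \<odot>\<^bsub>U\<^esub> u = h x' \<oplus>\<^bsub>U\<^esub> a' \<odot>\<^bsub>U\<^esub> u"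
      using xa by blast
    fix y assume "\<exists>x'\<in>N. \<exists>a'\<in>carrier R. x \<oplus>\<^bsub>V\<^esub> a \<odot>\<^bsub>V\<^esub> v = x' \<oplus>\<^bsub>V\<^esub> a' \<odot>\<^bsub>V\<^esub> v \<and> y = h x' \<oplus>\<^bsub>U\<^esub> a' \<odot>\<^bsub>U\<^esub> u"
    then obtain x' a' where *: "x' \<in> N" "a' \<in> carrier R" "x \<oplus>\<^bsub>V\<^esub> a \<odot>\<^bsub>V\<^esub> v = x' \<oplus>\<^bsub>V\<^esub> a' \<odot>\<^bsub>V\<^esub> v"
      "y = h x' \<oplus>\<^bsub>U\<^esub> a' \<odot>\<^bsub>U\<^esub> u" by blast
    from V.add_smult_unique[OF N v xa(1) *(1) xa(2) *(2,3)] show "y = h x \<oplus>\<^bsub>U\<^esub> a \<odot>\<^bsub>U\<^esub> u"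
      using *(4) by simp
  qed
  have sum: "(x \<oplus>\<^bsub>V\<^esub> a \<odot>\<^bsub>V\<^esub> v) \<oplus>\<^bsub>V\<^esub> (y \<oplus>\<^bsub>V\<^esub> b \<odot>\<^bsub>V\<^esub> v) = (x \<oplus>\<^bsub>V\<^esub> y) \<oplus>\<^bsub>V\<^esub> (a \<oplus>\<^bsub>R\<^esub> b) \<odot>\<^bsub>V\<^esub> v"
    if "x \<in> N" "y \<in> N" "a \<in> carrier R" "b \<in> carrier R" for x y a b
    using that v(1) NV by (simp add: V.smult_l_distr V.M.a_ac)
  have smul: "c \<odot>\<^bsub>V\<^esub> (x \<oplus>\<^bsub>V\<^esub> a \<odot>\<^bsub>V\<^esub> v) = (c \<odot>\<^bsub>V\<^esub> x) \<oplus>\<^bsub>V\<^esub> (c \<otimes>\<^bsub>R\<^esub> a) \<odot>\<^bsub>V\<^esub> v"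
    if "x \<in> N" "a \<in> carrier R" "c \<in> carrier R" for x a c
    using that v(1) NV by (simp add: V.smult_r_distr V.smult_assoc1)
  have N'I: "x \<oplus>\<^bsub>V\<^esub> a \<odot>\<^bsub>V\<^esub> v \<in> N'" if "x \<in> N" "a \<in> carrier R" for x a
    unfolding N'_def using that by blast
  have x0: "x = x \<oplus>\<^bsub>V\<^esub> \<zero>\<^bsub>R\<^esub> \<odot>\<^bsub>V\<^esub> v" if "x \<in> N" for x using that v(1) NV by simp
  show ?thesis
  proof (rule that)
    show sub: "submodule R N' V"
      unfolding submodule_iff[OF V.module_axioms]
    proof (intro conjI ballI)
      show "N' \<subseteq> carrier V" unfolding N'_def using NV v(1) by auto
      show "\<zero>\<^bsub>V\<^esub> \<in> N'" using N'I[of "\<zero>\<^bsub>V\<^esub>" "\<zero>\<^bsub>R\<^esub>"] x0[of "\<zero>\<^bsub>V\<^esub>"] Nd by simp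
      show "w \<oplus>\<^bsub>V\<^esub> w' \<in> N'" if ww: "w \<in> N'" "w' \<in> N'" for w w'
      proof -
        obtain x a y b where *: "x \<in> N" "a \<in> carrier R" "w = x \<oplus>\<^bsub>V\<^esub> a \<odot>\<^bsub>V\<^esub> v"
          "y \<in> N" "b \<in> carrier R" "w' = y \<oplus>\<^bsub>V\<^esub> b \<odot>\<^bsub>V\<^esub> v" using ww unfolding N'_def by blast
        have "x \<oplus>\<^bsub>V\<^esub> y \<in> N" using Nd *(1,4) by blast
        then show ?thesis unfolding *(3,6) sum[OF *(1,4,2,5)] using *(2,5) by (intro N'I) auto
      qed
      show "c \<odot>\<^bsub>V\<^esub> w \<in> N'" if c: "c \<in> carrier R" and w: "w \<in> N'" for c w
      proof -
        obtain x a where *: "x \<in> N" "a \<in> carrier R" "w = x \<oplus>\<^bsub>V\<^esub> a \<odot>\<^bsub>V\<^esub> v" using w unfolding N'_def by blast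
        have "c \<odot>\<^bsub>V\<^esub> x \<in> N" using Nd *(1) c by blast
        then show ?thesis unfolding *(3) smul[OF *(1,2) c] using *(2) c by (intro N'I) auto
      qed
    qed
    show "N \<subseteq> N'" using x0 N'I[OF _ V.R.zero_closed] by (metis subsetI)
    show "v \<in> N'" using N'I[of "\<zero>\<^bsub>V\<^esub>" "\<one>\<^bsub>R\<^esub>"] Nd v(1) by simp
    show "h' \<in> module_hom R (V\<lparr>carrier := N'\<rparr>) U"
    proof (rule module_homI)
      fix w assume "w \<in> carrier (V\<lparr>carrier := N'\<rparr>)"
      then obtain x a where *: "x \<in> N" "a \<in> carrier R" "w = x \<oplus>\<^bsub>V\<^esub> a \<odot>\<^bsub>V\<^esub> v" unfolding N'_def by auto
      show "h' w \<in> carrier U" unfolding *(3) h'eq[OF *(1,2)] using hU[OF *(1)] *(2) u(1) by simp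
    next
      fix w w' assume "w \<in> carrier (V\<lparr>carrier := N'\<rparr>)" "w' \<in> carrier (V\<lparr>carrier := N'\<rparr>)"
      then obtain x a y b where *: "x \<in> N" "a \<in> carrier R" "w = x \<oplus>\<^bsub>V\<^esub> a \<odot>\<^bsub>V\<^esub> v"
        "y \<in> N" "b \<in> carrier R" "w' = y \<oplus>\<^bsub>V\<^esub> b \<odot>\<^bsub>V\<^esub> v" unfolding N'_def by auto
      have xy: "x \<oplus>\<^bsub>V\<^esub> y \<in> N" and ab: "a \<oplus>\<^bsub>R\<^esub> b \<in> carrier R" using Nd *(1,4) *(2,5) by auto
      have "h' (w \<oplus>\<^bsub>V\<^esub> w') = h' w \<oplus>\<^bsub>U\<^esub> h' w'"
        unfolding *(3,6) sum[OF *(1,4,2,5)] h'eq[OF xy ab] h'eq[OF *(1,2)] h'eq[OF *(4,5)] hadd[OF *(1,4)]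
        using hU[OF *(1)] hU[OF *(4)] *(2,5) u(1) by (simp add: U.smult_l_distr U.M.a_ac)
      then show "h' (w \<oplus>\<^bsub>V\<lparr>carrier := N'\<rparr>\<^esub> w') = h' w \<oplus>\<^bsub>U\<^esub> h' w'" by simp
    next
      fix c w assume c: "c \<in> carrier R" and "w \<in> carrier (V\<lparr>carrier := N'\<rparr>)"
      then obtain x a where *: "x \<in> N" "a \<in> carrier R" "w = x \<oplus>\<^bsub>V\<^esub> a \<odot>\<^bsub>V\<^esub> v" unfolding N'_def by auto
      have cx: "c \<odot>\<^bsub>V\<^esub> x \<in> N" and ca: "c \<otimes>\<^bsub>R\<^esub> a \<in> carrier R" using Nd *(1,2) c by auto
      have "h' (c \<odot>\<^bsub>V\<^esub> w) = c \<odot>\<^bsub>U\<^esub> h' w"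
        unfolding *(3) smul[OF *(1,2) c] h'eq[OF cx ca] h'eq[OF *(1,2)] hsm[OF c *(1)]
        using hU[OF *(1)] *(2) c u(1) by (simp add: U.smult_r_distr U.smult_assoc1)
      then show "h' (c \<odot>\<^bsub>V\<lparr>carrier := N'\<rparr>\<^esub> w) = c \<odot>\<^bsub>U\<^esub> h' w" by simp
    qed
    show "inj_on h' N'"
    proof (rule inj_onI)
      fix w w' assume "w \<in> N'" "w' \<in> N'" and eq: "h' w = h' w'"
      then obtain x a y b where *: "x \<in> N" "a \<in> carrier R" "w = x \<oplus>\<^bsub>V\<^esub> a \<odot>\<^bsub>V\<^esub> v"
        "y \<in> N" "b \<in> carrier R" "w' = y \<oplus>\<^bsub>V\<^esub> b \<odot>\<^bsub>V\<^esub> v" unfolding N'_def by blast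
      have e: "h x \<oplus>\<^bsub>U\<^esub> a \<odot>\<^bsub>U\<^esub> u = h y \<oplus>\<^bsub>U\<^esub> b \<odot>\<^bsub>U\<^esub> u"
        using eq unfolding *(3,6) h'eq[OF *(1,2)] h'eq[OF *(4,5)] .
      have "a = b" "h x = h y"
        using U.add_smult_unique[OF hN u imageI[OF *(1)] imageI[OF *(4)] *(2,5) e] by auto
      then show "w = w'" using inj_onD[OF h(2) _ *(1,4)] *(3,6) by simp
    qed
    have "h' x = h x" if "x \<in> N" for x
      using h'eq[OF that V.R.zero_closed] x0[OF that] hU[OF that] u(1) by simp
    then show "\<forall>x\<in>N. h' x = h x" ..
  qed
qed

context VI_category
begin

text \<open>Take a largest subspace of \<open>V\<close> containing the image of \<open>f\<close> on
  which an injective extension of \<open>g\<close> exists; if it were proper,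
  \<open>hom_extend_by_vector\<close> would enlarge it. The lemma makes any two injections out of
  \<open>A\<close> comparable: the one into the larger space factors through the other.\<close>

lemma VI_hom_extend:
  assumes ob: "A \<in> VI_ob p" "V \<in> VI_ob p" "U \<in> VI_ob p"
    and f: "f \<in> VI_hom p A V" and g: "g \<in> VI_hom p A U" and le: "vdim V \<le> vdim U"
  obtains h where "h \<in> VI_hom p V U" "g = compose (carrier A) h f"
proof -
  have vs: "vectorspace F V" "vectorspace F U" using ob by (auto simp: VI_ob_def)
  interpret A: Module.module F A using VI_ob_module[OF ob(1)] .
  interpret V: vectorspace F V by (rule vs)
  define P where "P N \<longleftrightarrow> submodule F N V \<and> f ` carrier A \<subseteq> N \<and>
    (\<exists>h\<in>module_hom F (V\<lparr>carrier := N\<rparr>) U. inj_on h N \<and> (\<forall>a\<in>carrier A. h (f a) = g a))" for N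
  note hf = module_homD[OF VI_homD(1)[OF f]] and hg = module_homD[OF VI_homD(1)[OF g]]
  have inj: "inj_on f (carrier A)" using VI_homD(2)[OF f] .
  let ?i = "inv_into (carrier A) f"
  have i: "?i (f a) = a" if "a \<in> carrier A" for a using inv_into_f_f[OF inj that] .
  have "P (f ` carrier A)" unfolding P_def
  proof (intro conjI bexI[of _ "\<lambda>y. g (?i y)"] ballI)
    show "submodule F (f ` carrier A) V"
      by (rule submodule_image[OF VI_ob_module[OF ob(1)] VI_ob_module[OF ob(2)] VI_homD(1)[OF f]])
    show "inj_on (\<lambda>y. g (?i y)) (f ` carrier A)"
      using VI_homD(2)[OF g] by (auto simp: inj_on_def i)
    show "(\<lambda>y. g (?i y)) \<in> module_hom F (V\<lparr>carrier := f ` carrier A\<rparr>) U"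
      by (rule module_homI) (auto simp: i hg hf(2,3)[symmetric])
  qed (simp_all add: i)
  moreover have "\<forall>N. P N \<longrightarrow> card N < Suc (card (carrier V))"
    unfolding P_def submodule_def using VI_ob_finite[OF ob(2)] by (auto simp: less_Suc_eq_le intro: card_mono)
  ultimately obtain N where N: "P N" "\<And>N'. P N' \<Longrightarrow> card N' \<le> card N"
    using ex_has_greatest_nat[of P "f ` carrier A" card] by blast
  then obtain h where sub: "submodule F N V" and fN: "f ` carrier A \<subseteq> N"
    and h: "h \<in> module_hom F (V\<lparr>carrier := N\<rparr>) U" "inj_on h N" "\<And>a. a \<in> carrier A \<Longrightarrow> h (f a) = g a"
    unfolding P_def by blast
  have NV: "N \<subseteq> carrier V" using sub unfolding submodule_def by blast
  have "N = carrier V"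
  proof (rule ccontr)
    assume "N \<noteq> carrier V"
    then obtain v where v: "v \<in> carrier V" "v \<notin> N" using NV by blast
    \<comment> \<open>The image of a proper subspace of \<open>V\<close> has fewer points than
      \<open>U\<close>, so a value \<open>u\<close> for the new vector \<open>v\<close> is
      available.\<close>
    have "card (h ` N) < card (carrier V)"
      using card_image[OF h(2)] psubset_card_mono[OF VI_ob_finite[OF ob(2)], of N] NV v by auto
    also have "\<dots> \<le> card (carrier U)" using le card_vdim ob p_gt_1 by simp
    finally have "\<not> carrier U \<subseteq> h ` N"
      using card_mono[of "h ` N" "carrier U"] finite_subset[OF NV VI_ob_finite[OF ob(2)]] by auto
    then obtain u where u: "u \<in> carrier U" "u \<notin> h ` N" by blast
    obtain N' h' where *: "submodule F N' V" "N \<subseteq> N'" "v \<in> N'" "h' \<in> module_hom F (V\<lparr>carrier := N'\<rparr>) U"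
      "inj_on h' N'" "\<forall>x\<in>N. h' x = h x"
      using hom_extend_by_vector[OF vs sub h(1,2) v u] .
    have "h' (f a) = g a" if "a \<in> carrier A" for a
      using *(6) h(3)[OF that] fN that by auto
    then have "P N'" unfolding P_def using * fN by blast
    moreover have "card N < card N'"
    proof (rule psubset_card_mono)
      show "finite N'" using *(1) VI_ob_finite[OF ob(2)] finite_subset unfolding submodule_def by blast
    qed (use * v in blast)
    ultimately show False using N(2) by fastforce
  qed
  then have "h \<in> module_hom F V U" "inj_on h (carrier V)" using h by auto
  then have "restrict h (carrier V) \<in> VI_hom p V U" by (rule VI_hom_restrict[OF ob(2)])
  moreover have "g = compose (carrier A) (restrict h (carrier V)) f"
  proof (rule extensionalityI[OF VI_homD(3)[OF g] compose_extensional])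
    fix a assume a: "a \<in> carrier A"
    then show "g a = compose (carrier A) (restrict h (carrier V)) f a"
      using h(3)[OF a] hf(1)[OF a] by (simp add: compose_def)
  qed
  ultimately show ?thesis by (rule that)
qed

end

context VI_setting
begin

section \<open>Supports\<close>

definition nz :: "('k, 'u) vi_module \<Rightarrow> nat \<Rightarrow> bool" where
  "nz X n \<longleftrightarrow> carrier (obj X (std n)) \<noteq> {\<zero>\<^bsub>obj X (std n)\<^esub>}"

lemma arr_iso_nonzero:
  assumes X: "VI_module p K X" and V: "V \<in> VI_ob p" and W: "W \<in> VI_ob p" and f: "f \<in> VI_hom p V W"
    and eq: "vdim V = vdim W" and x: "x \<in> carrier (obj X V)" "arr X V W f x = \<zero>\<^bsub>obj X W\<^esub>"
  shows "x = \<zero>\<^bsub>obj X V\<^esub>"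
proof -
  obtain g where g: "g \<in> VI_hom p W V" "compose (carrier V) g f = (\<lambda>v\<in>carrier V. v)"
    using VI_hom_inverse[OF V W f VI_hom_surj[OF V W f eq]] .
  have "x = arr X W V g (arr X V W f x)"
    using VI_moduleD(4)[OF X V W V f g(1) x(1)] VI_moduleD(3)[OF X V x(1)] g(2) by simp
  then show ?thesis using x(2) VI_module_arrD(4)[OF X W V g(1)] by simp
qed

lemma nz_vdim:
  assumes X: "VI_module p K X" and V: "V \<in> VI_ob p"
  shows "nz X (vdim V) \<longleftrightarrow> carrier (obj X V) \<noteq> {\<zero>\<^bsub>obj X V\<^esub>}"
proof -
  have nonzero: "carrier (obj X B) \<noteq> {\<zero>\<^bsub>obj X B\<^esub>}"
    if A: "A \<in> VI_ob p" and B: "B \<in> VI_ob p" and eq: "vdim A = vdim B" and ne: "carrier (obj X A) \<noteq> {\<zero>\<^bsub>obj X A\<^esub>}" for A B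
  proof -
    obtain x where x: "x \<in> carrier (obj X A)" "x \<noteq> \<zero>\<^bsub>obj X A\<^esub>"
      using ne module_closed(1)[OF VI_moduleD(1)[OF X A]] by blast
    obtain f where f: "f \<in> VI_hom p A B" using VI_hom_nonempty[OF A B] eq by auto
    show ?thesis
      using arr_iso_nonzero[OF X A B f eq x(1)] x(2) VI_module_arrD(1)[OF X A B f x(1)] by blast
  qed
  show ?thesis unfolding nz_def using nonzero[OF std_VI_ob V] nonzero[OF V std_VI_ob] by auto
qed

lemma nz_trunc_unit: "nz (trunc S unit_vi) n \<longleftrightarrow> n \<in> S"
proof -
  have "carrier line \<noteq> {[\<zero>]}"
  proof
    assume "carrier line = {[\<zero>]}"
    moreover have "[\<one>] \<in> carrier line" by simp
    ultimately show False by simp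
  qed
  then show ?thesis by (simp add: nz_def del: line_simps(1))
qed

lemma nz_exact:
  assumes Ob: "A \<in> Ob \<A>" "B \<in> Ob \<A>" "C \<in> Ob \<A>" and ex: "short_exact \<A> A B C"
  shows "nz B n \<longleftrightarrow> nz A n \<or> nz C n"
proof -
  let ?V = "std n"
  obtain \<alpha> \<beta> where *: "VI_nat_trans p K A B \<alpha> \<and> VI_nat_trans p K B C \<beta> \<and>
        (\<forall>V\<in>VI_ob p.
           inj_on (\<alpha> V) (carrier (obj A V)) \<and>
           \<alpha> V ` carrier (obj A V) = {b \<in> carrier (obj B V). \<beta> V b = \<zero>\<^bsub>obj C V\<^esub>} \<and>
           \<beta> V ` carrier (obj B V) = carrier (obj C V))"
    using ex unfolding exact_simps VI_short_exact_def by (elim exE) (rule that)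
  note nt = conjunct1[OF *] conjunct1[OF conjunct2[OF *]]
    and pw = bspec[OF conjunct2[OF conjunct2[OF *]] std_VI_ob[of n]]
  note inj = conjunct1[OF pw] and im = conjunct1[OF conjunct2[OF pw]] and surj = conjunct2[OF conjunct2[OF pw]]
  note MA = VI_moduleD(1)[OF Ob_module[OF Ob(1)] std_VI_ob[of n]]
    and MB = VI_moduleD(1)[OF Ob_module[OF Ob(2)] std_VI_ob[of n]]
    and MC = VI_moduleD(1)[OF Ob_module[OF Ob(3)] std_VI_ob[of n]]
  note \<alpha> = VI_nat_transD(1)[OF nt(1) std_VI_ob[of n]] and \<beta> = VI_nat_transD(1)[OF nt(2) std_VI_ob[of n]]
  have \<alpha>0: "\<alpha> ?V \<zero>\<^bsub>obj A ?V\<^esub> = \<zero>\<^bsub>obj B ?V\<^esub>" by (rule module_hom_zero[OF MA MB \<alpha>])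
  have \<beta>0: "\<beta> ?V \<zero>\<^bsub>obj B ?V\<^esub> = \<zero>\<^bsub>obj C ?V\<^esub>" by (rule module_hom_zero[OF MB MC \<beta>])
  note z = module_closed(1)[OF MA] module_closed(1)[OF MB]
  have "carrier (obj B ?V) = {\<zero>\<^bsub>obj B ?V\<^esub>} \<longleftrightarrow>
    carrier (obj A ?V) = {\<zero>\<^bsub>obj A ?V\<^esub>} \<and> carrier (obj C ?V) = {\<zero>\<^bsub>obj C ?V\<^esub>}"
  proof
    assume B0: "carrier (obj B ?V) = {\<zero>\<^bsub>obj B ?V\<^esub>}"
    have "a = \<zero>\<^bsub>obj A ?V\<^esub>" if "a \<in> carrier (obj A ?V)" for a
      using inj_onD[OF inj _ that z(1)] module_homD(1)[OF \<alpha> that] B0 \<alpha>0 by simp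
    moreover have "carrier (obj C ?V) = {\<zero>\<^bsub>obj C ?V\<^esub>}" using surj \<beta>0 unfolding B0 by simp
    ultimately show "carrier (obj A ?V) = {\<zero>\<^bsub>obj A ?V\<^esub>} \<and> carrier (obj C ?V) = {\<zero>\<^bsub>obj C ?V\<^esub>}"
      using z(1) by blast
  next
    assume AC: "carrier (obj A ?V) = {\<zero>\<^bsub>obj A ?V\<^esub>} \<and> carrier (obj C ?V) = {\<zero>\<^bsub>obj C ?V\<^esub>}"
    have "b = \<zero>\<^bsub>obj B ?V\<^esub>" if b: "b \<in> carrier (obj B ?V)" for b
    proof -
      have "\<beta> ?V b = \<zero>\<^bsub>obj C ?V\<^esub>" using module_homD(1)[OF \<beta> b] AC by blast
      then have "b \<in> \<alpha> ?V ` carrier (obj A ?V)" unfolding im using b by blast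
      then show ?thesis using AC \<alpha>0 by auto
    qed
    then show "carrier (obj B ?V) = {\<zero>\<^bsub>obj B ?V\<^esub>}" using z(2) by blast
  qed
  then show ?thesis unfolding nz_def by blast
qed

lemma nz_tensor:
  assumes "X \<in> Ob \<A>" "Y \<in> Ob \<A>" "Z \<in> Ob \<A>" "tensor \<A> X Y Z"
  shows "nz Z n \<longleftrightarrow> nz X n \<and> nz Y n"
  unfolding nz_def using tensor_zero_iff[OF assms std_VI_ob] by blast

text \<open>
  If a morphism out of \<open>A\<close> kills \<open>x\<close>, then so do all morphisms from \<open>A\<close>
  to spaces of larger dimension. A finitely generated module all of whose generators are killed
  therefore vanishes in large dimensions.
\<close>

lemma torsion_free_element:
  assumes X: "X \<in> Ob \<A>" and inf: "\<And>N. \<exists>n\<ge>N. nz X n"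
  obtains A x where "A \<in> VI_ob p" "x \<in> carrier (obj X A)"
    "\<And>V f. V \<in> VI_ob p \<Longrightarrow> f \<in> VI_hom p A V \<Longrightarrow> arr X A V f x \<noteq> \<zero>\<^bsub>obj X V\<^esub>"
proof (rule ccontr)
  assume no: "\<not> thesis"
  note result = that
  have VX: "VI_module p K X" using Ob_module[OF X] .
  obtain G where G: "finite G" "VI_generates p K X G" using X unfolding Ob_iff by blast
  note AG = VI_generatesD(1,2)[OF G(2)]
  have "\<exists>V f. V \<in> VI_ob p \<and> f \<in> VI_hom p A V \<and> arr X A V f x = \<zero>\<^bsub>obj X V\<^esub>" if "(A, x) \<in> G" for A x
    using result[OF AG[OF that]] no by blast
  then have "\<forall>z\<in>G. \<exists>V f. V \<in> VI_ob p \<and> f \<in> VI_hom p (fst z) V \<and> arr X (fst z) V f (snd z) = \<zero>\<^bsub>obj X V\<^esub>"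
    by force
  then obtain V f where Vf: "\<And>z. z \<in> G \<Longrightarrow> V z \<in> VI_ob p \<and> f z \<in> VI_hom p (fst z) (V z) \<and>
      arr X (fst z) (V z) (f z) (snd z) = \<zero>\<^bsub>obj X (V z)\<^esub>"
    by metis
  \<comment> \<open>\<open>N\<close> bounds the dimensions of the finitely many targets in which the
    generators are killed.\<close>
  obtain N where N: "\<And>z. z \<in> G \<Longrightarrow> vdim (V z) \<le> N"
    using finite_imageI[OF G(1), of "\<lambda>z. vdim (V z)"] finite_nat_set_iff_bounded_le by (metis imageI)
  \<comment> \<open>Elements killed by every injection into a space of dimension at least
    \<open>N\<close>; \<open>VI_hom_extend\<close> will place all generators here.\<close>
  define M where "M V = {x \<in> carrier (obj X V). \<forall>U\<in>VI_ob p. \<forall>g\<in>VI_hom p V U. N \<le> vdim U \<longrightarrow>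
      arr X V U g x = \<zero>\<^bsub>obj X U\<^esub>}" for V
  have M: "VI_sub p K X M" unfolding VI_sub_iff[OF VX]
  proof (intro conjI ballI)
    fix V assume V: "V \<in> VI_ob p"
    note cl = module_closed[OF VI_moduleD(1)[OF VX V]] and arr = VI_module_arrD[OF VX V]
    have z: "\<zero>\<^bsub>obj X U\<^esub> \<oplus>\<^bsub>obj X U\<^esub> \<zero>\<^bsub>obj X U\<^esub> = \<zero>\<^bsub>obj X U\<^esub>" "a \<in> carrier K \<Longrightarrow> a \<odot>\<^bsub>obj X U\<^esub> \<zero>\<^bsub>obj X U\<^esub> = \<zero>\<^bsub>obj X U\<^esub>"
      if "U \<in> VI_ob p" for U a
    proof -
      interpret M: Module.module K "obj X U" using VI_moduleD(1)[OF VX that] .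
      show "\<zero>\<^bsub>obj X U\<^esub> \<oplus>\<^bsub>obj X U\<^esub> \<zero>\<^bsub>obj X U\<^esub> = \<zero>\<^bsub>obj X U\<^esub>" "a \<in> carrier K \<Longrightarrow> a \<odot>\<^bsub>obj X U\<^esub> \<zero>\<^bsub>obj X U\<^esub> = \<zero>\<^bsub>obj X U\<^esub>"
        by auto
    qed
    show "M V \<subseteq> carrier (obj X V)" unfolding M_def by blast
    show "\<zero>\<^bsub>obj X V\<^esub> \<in> M V" unfolding M_def using cl(1) arr(4) by simp
    show "x \<oplus>\<^bsub>obj X V\<^esub> y \<in> M V" if "x \<in> M V" "y \<in> M V" for x y
      using that cl(2) arr(2) z(1) unfolding M_def by simp
    show "a \<odot>\<^bsub>obj X V\<^esub> x \<in> M V" if "a \<in> carrier K" "x \<in> M V" for a x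
      using that cl(3) arr(3) z(2) unfolding M_def by simp
  next
    fix V W g x assume V: "V \<in> VI_ob p" and W: "W \<in> VI_ob p" and g: "g \<in> VI_hom p V W" and x: "x \<in> M V"
    then have x': "x \<in> carrier (obj X V)" unfolding M_def by blast
    have "arr X W T h (arr X V W g x) = \<zero>\<^bsub>obj X T\<^esub>"
      if T: "T \<in> VI_ob p" and h: "h \<in> VI_hom p W T" and n: "N \<le> vdim T" for T h
    proof -
      have "arr X V T (compose (carrier V) h g) x = \<zero>\<^bsub>obj X T\<^esub>"
        using x T n VI_hom_compose[OF g h V] unfolding M_def by blast
      then show ?thesis unfolding VI_moduleD(4)[OF VX V W T g h x'] .
    qed
    then show "arr X V W g x \<in> M W" unfolding M_def using VI_module_arrD(1)[OF VX V W g x'] by blast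
  qed
  have GM: "x \<in> M A" if Ax: "(A, x) \<in> G" for A x
    unfolding M_def
  proof (intro CollectI conjI ballI impI)
    show x: "x \<in> carrier (obj X A)" by (rule AG(2)[OF Ax])
    fix U g assume U: "U \<in> VI_ob p" and g: "g \<in> VI_hom p A U" and n: "N \<le> vdim U"
    let ?V = "V (A, x)"
    have V: "?V \<in> VI_ob p" and f: "f (A, x) \<in> VI_hom p A ?V" and 0: "arr X A ?V (f (A, x)) x = \<zero>\<^bsub>obj X ?V\<^esub>"
      using Vf[OF Ax] by auto
    obtain h where h: "h \<in> VI_hom p ?V U" "g = compose (carrier A) h (f (A, x))"
      using VI_hom_extend[OF AG(1)[OF Ax] V U f g] N[OF Ax] n by auto
    show "arr X A U g x = \<zero>\<^bsub>obj X U\<^esub>"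
      unfolding h(2) VI_moduleD(4)[OF VX AG(1)[OF Ax] V U f h(1) x] 0
      by (rule VI_module_arrD(4)[OF VX V U h(1)])
  qed
  obtain n where n: "n \<ge> N" "nz X n" using inf by blast
  have "x = \<zero>\<^bsub>obj X (std n)\<^esub>" if x: "x \<in> carrier (obj X (std n))" for x
  proof -
    \<comment> \<open>In dimension \<open>n \<ge> N\<close> the identity is itself one of the
      injections that kill \<open>x\<close>.\<close>
    have "x \<in> M (std n)" by (rule VI_generatesD(3)[OF G(2) M GM std_VI_ob x])
    then have "arr X (std n) (std n) (\<lambda>v\<in>carrier (std n). v) x = \<zero>\<^bsub>obj X (std n)\<^esub>"
      unfolding M_def using n(1) VI_hom_id[OF std_VI_ob] by auto
    then show ?thesis using VI_moduleD(3)[OF VX std_VI_ob x] by simp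
  qed
  then show False using n(2) module_closed(1)[OF VI_moduleD(1)[OF VX std_VI_ob[of n]]] unfolding nz_def by blast
qed

text \<open>The definition of a Serre ideal has the member of the ideal as the left factor, whereas
  \<open>tensor_trunc_unit\<close> produces the truncated unit as the right one.\<close>

lemma tensor_sym:
  assumes "tensor \<A> X Y Z"
  shows "tensor \<A> Y X Z"
proof -
  obtain b where *: "(\<forall>V\<in>VI_ob p. is_tensor_product K (obj X V) (obj Y V) (obj Z V) (b V)) \<and>
        (\<forall>V\<in>VI_ob p. \<forall>W\<in>VI_ob p. \<forall>f\<in>VI_hom p V W.
           \<forall>x\<in>carrier (obj X V). \<forall>y\<in>carrier (obj Y V).
             arr Z V W f (b V x y) = b W (arr X V W f x) (arr Y V W f y))"
    using assms unfolding exact_simps VI_tensor_def by (elim exE) (rule that)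
  note b = bspec[OF conjunct1[OF *]]
    and arr = bspec[OF bspec[OF bspec[OF bspec[OF bspec[OF conjunct2[OF *]]]]]]
  have bil: "bilinear_on K N M Q (\<lambda>y x. c x y) \<longleftrightarrow> bilinear_on K M N Q c"
    for M N Q :: "('k, 'k list) module" and c
    unfolding bilinear_on_def by blast
  have "is_tensor_product K (obj Y V) (obj X V) (obj Z V) (\<lambda>y x. b V x y)" if V: "V \<in> VI_ob p" for V
    unfolding is_tensor_product_def
  proof (intro conjI allI impI)
    note bV = b[OF V, unfolded is_tensor_product_def]
    show "bilinear_on K (obj Y V) (obj X V) (obj Z V) (\<lambda>y x. b V x y)"
      by (rule iffD2[OF bil conjunct1[OF bV]])
    fix Q :: "('k, 'k list) module" and c
    assume Qc: "Module.module K Q \<and> bilinear_on K (obj Y V) (obj X V) Q c"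
    then have "Module.module K Q \<and> bilinear_on K (obj X V) (obj Y V) Q (\<lambda>x y. c y x)"
      using iffD1[OF bil[of "obj Y V" "obj X V" Q "\<lambda>x y. c y x"]] by simp
    from mp[OF spec[OF spec[OF conjunct2[OF bV]]] this]
    obtain h where h: "h \<in> module_hom K (obj Z V) Q"
      "\<forall>x\<in>carrier (obj X V). \<forall>y\<in>carrier (obj Y V). h (b V x y) = c y x"
      "\<forall>h'\<in>module_hom K (obj Z V) Q.
         (\<forall>x\<in>carrier (obj X V). \<forall>y\<in>carrier (obj Y V). h' (b V x y) = c y x) \<longrightarrow>
         (\<forall>t\<in>carrier (obj Z V). h' t = h t)" by (elim bexE conjE) (rule that)
    show "\<exists>h\<in>module_hom K (obj Z V) Q.
      (\<forall>x\<in>carrier (obj Y V). \<forall>y\<in>carrier (obj X V). h (b V y x) = c x y) \<and>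
      (\<forall>h'\<in>module_hom K (obj Z V) Q.
         (\<forall>x\<in>carrier (obj Y V). \<forall>y\<in>carrier (obj X V). h' (b V y x) = c x y) \<longrightarrow>
         (\<forall>t\<in>carrier (obj Z V). h' t = h t))"
    proof (rule bexI[OF _ h(1)], intro conjI ballI impI)
      show "h (b V y x) = c x y" if "x \<in> carrier (obj Y V)" "y \<in> carrier (obj X V)" for x y
        using h(2) that by simp
      show "h' t = h t" if h': "h' \<in> module_hom K (obj Z V) Q"
          "\<forall>x\<in>carrier (obj Y V). \<forall>y\<in>carrier (obj X V). h' (b V y x) = c x y"
        and t: "t \<in> carrier (obj Z V)" for h' t
        by (rule bspec[OF mp[OF bspec[OF h(3) h'(1)]] t]) (use h'(2) in simp)
    qed
  qed
  then show ?thesis unfolding exact_simps VI_tensor_def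
    by (intro exI[of _ "\<lambda>V y x. b V x y"] conjI ballI) (simp_all add: arr)
qed

section \<open>Membership in Serre ideals\<close>

lemma nat_trans_comp:
  assumes "VI_nat_trans p K X Y \<eta>" "VI_nat_trans p K Y Z \<theta>"
  shows "VI_nat_trans p K X Z (\<lambda>V x. \<theta> V (\<eta> V x))"
  unfolding VI_nat_trans_def
proof (intro conjI ballI)
  show "(\<lambda>x. \<theta> V (\<eta> V x)) \<in> module_hom K (obj X V) (obj Z V)" if "V \<in> VI_ob p" for V
    by (rule module_hom_comp[OF VI_nat_transD(1)[OF assms(1) that] VI_nat_transD(1)[OF assms(2) that]])
  fix V W f x assume *: "V \<in> VI_ob p" "W \<in> VI_ob p" "f \<in> VI_hom p V W" "x \<in> carrier (obj X V)"
  show "\<theta> W (\<eta> W (arr X V W f x)) = arr Z V W f (\<theta> V (\<eta> V x))"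
    unfolding VI_nat_transD(2)[OF assms(1) *]
    by (rule VI_nat_transD(2)[OF assms(2) *(1-3) module_homD(1)[OF VI_nat_transD(1)[OF assms(1) *(1)] *(4)]])
qed

lemma nat_trans_inverse:
  assumes X: "VI_module p K X" and Y: "VI_module p K Y" and \<eta>: "VI_nat_trans p K X Y \<eta>"
    and bij: "\<And>V. V \<in> VI_ob p \<Longrightarrow> bij_betw (\<eta> V) (carrier (obj X V)) (carrier (obj Y V))"
  shows "VI_nat_trans p K Y X (\<lambda>V. inv_into (carrier (obj X V)) (\<eta> V))"
  unfolding VI_nat_trans_def
proof (intro conjI ballI)
  show "inv_into (carrier (obj X V)) (\<eta> V) \<in> module_hom K (obj Y V) (obj X V)" if "V \<in> VI_ob p" for V
    by (rule module_hom_inv_into[OF VI_moduleD(1)[OF X that] VI_nat_transD(1)[OF \<eta> that] bij[OF that]])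
  fix V W f y assume V: "V \<in> VI_ob p" and W: "W \<in> VI_ob p" and f: "f \<in> VI_hom p V W"
    and y: "y \<in> carrier (obj Y V)"
  let ?i = "\<lambda>V. inv_into (carrier (obj X V)) (\<eta> V)"
  have x: "?i V y \<in> carrier (obj X V)" "\<eta> V (?i V y) = y"
    using bij_betw_inv_into_right[OF bij[OF V] y] bij_betw_apply[OF bij_betw_inv_into[OF bij[OF V]] y] by auto
  have "\<eta> W (arr X V W f (?i V y)) = arr Y V W f y"
    unfolding VI_nat_transD(2)[OF \<eta> V W f x(1)] x(2) ..
  then show "?i W (arr Y V W f y) = arr X V W f (?i V y)"
    using bij_betw_inv_into_left[OF bij[OF W] VI_module_arrD(1)[OF X V W f x(1)]] by simp
qed

lemma extl_bij:
  assumes "W \<in> VI_ob p" "U \<in> VI_ob p"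
  shows "bij_betw (enc (VI_hom p W U)) (carrier (obj (ext W X) U)) (carrier (obj (extl W X) U))"
  using inj_on_enc_ext[OF assms] by (simp only: bij_betw_def extl_carrier)

abbreviation dec :: "vi_ob \<Rightarrow> ('k, 'k list) vi_module \<Rightarrow> vi_ob \<Rightarrow> 'k list \<Rightarrow> (nat \<Rightarrow> nat) \<Rightarrow> 'k list" where
  "dec W X U \<equiv> inv_into (carrier (obj (ext W X) U)) (enc (VI_hom p W U))"

lemma dec_trans:
  assumes X: "VI_module p K X" and W: "W \<in> VI_ob p"
  shows "VI_nat_trans p K (extl W X) (ext W X) (dec W X)"
  by (rule nat_trans_inverse[OF VI_module_ext[OF X W] VI_module_extl[OF X W] extl_trans[OF X W] extl_bij[OF W]])

lemma dec_bij:
  assumes "W \<in> VI_ob p" "U \<in> VI_ob p"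
  shows "bij_betw (dec W X U) (carrier (obj (extl W X) U)) (carrier (obj (ext W X) U))"
  by (rule bij_betw_inv_into[OF extl_bij[OF assms]])

lemma serreD:
  assumes "serre_subcategory \<A> P"
  shows "X \<in> P \<Longrightarrow> X \<in> Ob \<A>" "P \<noteq> {}"
    and "A \<in> Ob \<A> \<Longrightarrow> B \<in> Ob \<A> \<Longrightarrow> C \<in> Ob \<A> \<Longrightarrow> short_exact \<A> A B C \<Longrightarrow> B \<in> P \<longleftrightarrow> A \<in> P \<and> C \<in> P"
  using assms unfolding serre_subcategory_def by blast+

lemma serre_sub:
  assumes P: "serre_subcategory \<A> P" and B: "B \<in> P" and A: "A \<in> Ob \<A>" and \<eta>: "VI_nat_trans p K A B \<eta>"
    and inj: "\<And>V. V \<in> VI_ob p \<Longrightarrow> inj_on (\<eta> V) (carrier (obj A V))"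
  shows "A \<in> P"
proof -
  have OB: "B \<in> Ob \<A>" by (rule serreD(1)[OF P B])
  obtain C where "C \<in> Ob \<A>" "short_exact \<A> A B C" using short_exact_cokernel[OF A OB \<eta> inj] .
  then show ?thesis using serreD(3)[OF P A OB] B by blast
qed

lemma serre_quotient:
  assumes P: "serre_subcategory \<A> P" and B: "B \<in> P" and C: "C \<in> Ob \<A>" and \<eta>: "VI_nat_trans p K B C \<eta>"
    and surj: "\<And>V. V \<in> VI_ob p \<Longrightarrow> \<eta> V ` carrier (obj B V) = carrier (obj C V)"
    and A: "sub_vi B (\<lambda>V. {b \<in> carrier (obj B V). \<eta> V b = \<zero>\<^bsub>obj C V\<^esub>}) \<in> Ob \<A>"
  shows "C \<in> P"
  using serreD(3)[OF P A serreD(1)[OF P B] C short_exact_kernel[OF serreD(1)[OF P B] C \<eta> surj A]] B by blast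

text \<open>There are many zero objects, with different carriers and arbitrary values off
  \<open>VI_ob\<close>; each of them embeds into any member of \<open>P\<close>.\<close>

lemma serre_zero:
  assumes P: "serre_subcategory \<A> P" and Z: "Z \<in> Ob \<A>"
    and zero: "\<And>V. V \<in> VI_ob p \<Longrightarrow> carrier (obj Z V) = {\<zero>\<^bsub>obj Z V\<^esub>}"
  shows "Z \<in> P"
proof -
  obtain B where B: "B \<in> P" using serreD(2)[OF P] by blast
  have VB: "VI_module p K B" by (rule Ob_module[OF serreD(1)[OF P B]])
  have "VI_nat_trans p K Z B (\<lambda>V x. \<zero>\<^bsub>obj B V\<^esub>)"
    unfolding VI_nat_trans_def
  proof (intro conjI ballI)
    fix V assume "V \<in> VI_ob p"
    then interpret M: Module.module K "obj B V" using VI_moduleD(1)[OF VB] by blast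
    show "(\<lambda>x. \<zero>\<^bsub>obj B V\<^esub>) \<in> module_hom K (obj Z V) (obj B V)" by (rule module_homI) auto
  next
    show "\<zero>\<^bsub>obj B W\<^esub> = arr B V W f \<zero>\<^bsub>obj B V\<^esub>"
      if "V \<in> VI_ob p" "W \<in> VI_ob p" "f \<in> VI_hom p V W" for V W f
      by (rule VI_module_arrD(4)[OF VB that, symmetric])
  qed
  then show ?thesis by (rule serre_sub[OF P B Z]) (simp add: zero)
qed

section \<open>Truncations of the unit and the coefficient sum\<close>

lemma trunc_UNIV_unit: "trunc UNIV unit_vi = unit_vi"
  by (simp add: trunc_def unit_vi_def line_def)

lemma unit_Ob: "unit_vi \<in> Ob \<A>"
proof -
  have "{a \<in> (UNIV :: nat set). a = 0 \<or> a - 1 \<notin> UNIV} = {0}" by auto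
  then show ?thesis using Ob_trunc_unit[of UNIV] trunc_UNIV_unit by simp
qed

text \<open>Every element of \<open>S\<close> above \<open>n\<close> has its predecessor in
  \<open>S\<close>, so a run can start only at \<open>n\<close>.\<close>

lemma Ob_trunc_unit_interval:
  assumes Sn: "S \<subseteq> {n..}" and conv: "\<And>a b. b \<in> S \<Longrightarrow> n \<le> a \<Longrightarrow> a \<le> b \<Longrightarrow> a \<in> S"
  shows "trunc S unit_vi \<in> Ob \<A>"
proof (rule Ob_trunc_unit, rule finite_subset)
  show "{a \<in> S. a = 0 \<or> a - 1 \<notin> S} \<subseteq> {..n}"
  proof
    fix a assume a: "a \<in> {a \<in> S. a = 0 \<or> a - 1 \<notin> S}"
    show "a \<in> {..n}"
    proof (rule ccontr)
      assume "a \<notin> {..n}"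
      then have "n \<le> a - 1" "a \<noteq> 0" by auto
      then show False using conv[of a "a - 1"] a by simp
    qed
  qed
qed (rule finite_atMost)

text \<open>Morphisms never lower the dimension, so the part in dimensions at least \<open>n\<close>
  is a subfunctor, and the part below \<open>n\<close> is its quotient.\<close>

lemma trunc_unit_exact:
  "short_exact \<A> (trunc (S \<inter> {n..}) unit_vi) (trunc S unit_vi) (trunc (S \<inter> {..<n}) unit_vi)"
  (is "short_exact \<A> ?A ?B ?C")
  unfolding exact_simps VI_short_exact_def
proof (intro exI conjI ballI)
  let ?\<beta> = "\<lambda>V x. if vdim V < n then x else [\<zero>]"
  have z: "[\<zero>] \<in> carrier line" by simp
  have *: "hd x \<in> carrier K" if "x \<in> carrier line" for x using that by auto
  show "VI_nat_trans p K ?A ?B (\<lambda>V x. x)"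
    unfolding VI_nat_trans_def
  proof (intro conjI ballI)
    show "(\<lambda>x. x) \<in> module_hom K (obj ?A V) (obj ?B V)" for V
      by (rule module_homI) (auto split: if_splits)
    show "arr ?A V W f x = arr ?B V W f x"
      if "V \<in> VI_ob p" "W \<in> VI_ob p" "f \<in> VI_hom p V W" "x \<in> carrier (obj ?A V)" for V W f x
    proof -
      have "{vdim V..vdim W} \<subseteq> {n..} \<longleftrightarrow> n \<le> vdim V"
        using VI_hom_vdim_le[OF that(1-3)] by auto
      then show ?thesis using that(4) by (auto split: if_splits)
    qed
  qed
  show "VI_nat_trans p K ?B ?C ?\<beta>"
    unfolding VI_nat_trans_def
  proof (intro conjI ballI)
    show "?\<beta> V \<in> module_hom K (obj ?B V) (obj ?C V)" for V
      by (rule module_homI) (auto split: if_splits)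
    show "?\<beta> W (arr ?B V W f x) = arr ?C V W f (?\<beta> V x)"
      if "V \<in> VI_ob p" "W \<in> VI_ob p" "f \<in> VI_hom p V W" "x \<in> carrier (obj ?B V)" for V W f x
    proof -
      have "{vdim V..vdim W} \<subseteq> {..<n} \<longleftrightarrow> vdim W < n"
        using VI_hom_vdim_le[OF that(1-3)] by auto
      then show ?thesis using that(4) VI_hom_vdim_le[OF that(1-3)] by (auto split: if_splits)
    qed
  qed
qed (auto split: if_splits)

text \<open>This is \<open>X\<close> tensored with the augmentation of the free module on
  \<open>W\<close>, which sends every basis vector to \<open>\<one>\<close>. It is natural because
  transition maps only move coefficients to other basis vectors.\<close>

lemma ext_sum_trans:
  assumes X: "VI_module p K X" and W: "W \<in> VI_ob p"
  shows "VI_nat_trans p K (ext W X) X (\<lambda>U c. \<Oplus>\<^bsub>obj X U\<^esub>g\<in>VI_hom p W U. c g)"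
  unfolding VI_nat_trans_def
proof (intro conjI ballI)
  fix U assume U: "U \<in> VI_ob p"
  interpret M: Module.module K "obj X U" using VI_moduleD(1)[OF X U] .
  have mem: "c \<in> VI_hom p W U \<rightarrow> carrier (obj X U)" if "c \<in> VI_hom p W U \<rightarrow>\<^sub>E carrier (obj X U)" for c
    using that by (rule PiE_iff[THEN iffD1, THEN conjunct1, folded Pi_iff])
  show "(\<lambda>c. \<Oplus>\<^bsub>obj X U\<^esub>g\<in>VI_hom p W U. c g) \<in> module_hom K (obj (ext W X) U) (obj X U)"
    unfolding ext_obj
  proof (rule module_homI, unfold fun_mod_simps)
    fix c d assume c: "c \<in> VI_hom p W U \<rightarrow>\<^sub>E carrier (obj X U)" and d: "d \<in> VI_hom p W U \<rightarrow>\<^sub>E carrier (obj X U)"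
    have "(\<Oplus>\<^bsub>obj X U\<^esub>g\<in>VI_hom p W U. (\<lambda>s\<in>VI_hom p W U. c s \<oplus>\<^bsub>obj X U\<^esub> d s) g)
        = (\<Oplus>\<^bsub>obj X U\<^esub>g\<in>VI_hom p W U. c g \<oplus>\<^bsub>obj X U\<^esub> d g)"
      using PiE_mem[OF c] PiE_mem[OF d] by (intro M.M.finsum_cong' refl Pi_I) simp_all
    then show "(\<Oplus>\<^bsub>obj X U\<^esub>g\<in>VI_hom p W U. (\<lambda>s\<in>VI_hom p W U. c s \<oplus>\<^bsub>obj X U\<^esub> d s) g)
        = (\<Oplus>\<^bsub>obj X U\<^esub>g\<in>VI_hom p W U. c g) \<oplus>\<^bsub>obj X U\<^esub> (\<Oplus>\<^bsub>obj X U\<^esub>g\<in>VI_hom p W U. d g)"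
      using M.M.finsum_addf[OF mem[OF c] mem[OF d]] by simp
  next
    fix a c assume a: "a \<in> carrier K" and c: "c \<in> VI_hom p W U \<rightarrow>\<^sub>E carrier (obj X U)"
    have "(\<Oplus>\<^bsub>obj X U\<^esub>g\<in>VI_hom p W U. (\<lambda>s\<in>VI_hom p W U. a \<odot>\<^bsub>obj X U\<^esub> c s) g)
        = (\<Oplus>\<^bsub>obj X U\<^esub>g\<in>VI_hom p W U. a \<odot>\<^bsub>obj X U\<^esub> c g)"
      using PiE_mem[OF c] a by (intro M.M.finsum_cong' refl Pi_I) simp_all
    then show "(\<Oplus>\<^bsub>obj X U\<^esub>g\<in>VI_hom p W U. (\<lambda>s\<in>VI_hom p W U. a \<odot>\<^bsub>obj X U\<^esub> c s) g)
        = a \<odot>\<^bsub>obj X U\<^esub> (\<Oplus>\<^bsub>obj X U\<^esub>g\<in>VI_hom p W U. c g)"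
      using M.finsum_smult_ldistr[OF finite_VI_hom[OF W U] a mem[OF c]] by simp
  qed (rule M.M.finsum_closed[OF mem])
next
  fix U V f c assume U: "U \<in> VI_ob p" and V: "V \<in> VI_ob p" and f: "f \<in> VI_hom p U V"
    and "c \<in> carrier (obj (ext W X) U)"
  then have c: "c \<in> VI_hom p W U \<rightarrow>\<^sub>E carrier (obj X U)" by simp
  interpret N: Module.module K "obj X V" using VI_moduleD(1)[OF X V] .
  let ?c = "compose (carrier W) f" and ?fc = "arr (ext W X) U V f c"
  have inj: "inj_on ?c (VI_hom p W U)" using VI_hom_compose_cancel[OF f] by (auto simp: inj_on_def)
  have sub: "?c ` VI_hom p W U \<subseteq> VI_hom p W V" using VI_hom_compose[OF _ f W] by blast
  have fc: "?fc h \<in> carrier (obj X V)" if "h \<in> VI_hom p W V" for h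
    by (rule PiE_mem[OF ext_arr_mem[OF X W U V f c] that])
  have "(\<Oplus>\<^bsub>obj X V\<^esub>h\<in>VI_hom p W V. ?fc h) = (\<Oplus>\<^bsub>obj X V\<^esub>h\<in>?c ` VI_hom p W U. ?fc h)"
    by (rule N.M.add.finprod_mono_neutral_cong_right[OF finite_VI_hom[OF W V] sub _ refl])
      (use ext_arr(2)[OF W f] fc in auto)
  also have "\<dots> = (\<Oplus>\<^bsub>obj X V\<^esub>g\<in>VI_hom p W U. ?fc (?c g))"
    by (rule N.M.finsum_reindex[OF _ inj]) (use fc sub in blast)
  also have "\<dots> = (\<Oplus>\<^bsub>obj X V\<^esub>g\<in>VI_hom p W U. arr X U V f (c g))"
    using VI_module_arrD(1)[OF X U V f PiE_mem[OF c]]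
    by (intro N.M.finsum_cong' refl Pi_I ext_arr(1)[OF W f]) auto
  also have "\<dots> = arr X U V f (\<Oplus>\<^bsub>obj X U\<^esub>g\<in>VI_hom p W U. c g)"
    by (rule module_hom_finsum[OF VI_moduleD(1)[OF X U] VI_moduleD(1)[OF X V] VI_moduleD(2)[OF X U V f]
          finite_VI_hom[OF W U] PiE_mem[OF c], symmetric])
  finally show "(\<Oplus>\<^bsub>obj X V\<^esub>h\<in>VI_hom p W V. ?fc h) = arr X U V f (\<Oplus>\<^bsub>obj X U\<^esub>g\<in>VI_hom p W U. c g)" .
qed

lemma sum_single:
  assumes M: "Module.module K M" and S: "finite S" "g \<in> S" and x: "x \<in> carrier M"
  shows "(\<Oplus>\<^bsub>M\<^esub>h\<in>S. single S M g x h) = x"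
proof -
  interpret M: Module.module K M by fact
  have "(\<Oplus>\<^bsub>M\<^esub>h\<in>S. single S M g x h) = (\<Oplus>\<^bsub>M\<^esub>h\<in>S. if g = h then x else \<zero>\<^bsub>M\<^esub>)"
    using x by (intro M.M.finsum_cong' refl Pi_I) (auto simp: single_def)
  also have "\<dots> = x" using M.M.finsum_singleton[OF S(2,1), of "\<lambda>_. x"] x by simp
  finally show ?thesis .
qed

text \<open>A coefficient function with sum zero is a combination of differences between basis
  vectors \<open>g\<close> and one fixed \<open>h\<close>. Each pair factors through a standard
  space of dimension between \<open>vdim W\<close> and twice that. By \<open>conv\<close> this
  dimension lies in \<open>S\<close> when that of the target does, so the truncation does not
  destroy the difference on its way from there.\<close>

lemma ext_trunc_kernel_generates:
  assumes W: "W \<in> VI_ob p" and SW: "S \<subseteq> {vdim W..}" and conv: "\<And>a b. b \<in> S \<Longrightarrow> vdim W \<le> a \<Longrightarrow> a \<le> b \<Longrightarrow> a \<in> S"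
  defines "T \<equiv> trunc S unit_vi"
  shows "\<exists>G. finite G \<and> VI_generates p K (sub_vi (ext W T) (\<lambda>U. {c \<in> carrier (obj (ext W T) U).
    (\<Oplus>\<^bsub>obj T U\<^esub>g\<in>VI_hom p W U. c g) = \<zero>\<^bsub>obj T U\<^esub>})) G"
    (is "\<exists>G. finite G \<and> VI_generates p K (sub_vi _ ?ker) G")
proof -
  have VT: "VI_module p K T" unfolding T_def by (rule VI_module_trunc[OF VI_module_unit])
  note VE = VI_module_ext[OF VT W] and MT = VI_moduleD(1)[OF VT]
  let ?s = "\<lambda>U. single (VI_hom p W U) (obj T U)"
  let ?E = "\<lambda>U. fun_mod (VI_hom p W U) (obj T U)"
  note ST = ext_sum_trans[OF VT W]
  have ker: "VI_sub p K (ext W T) ?ker" by (rule VI_sub_kernel[OF VE VT ST])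
  \<comment> \<open>The coefficient \<open>y\<close> placed at \<open>g\<close> minus the same
    coefficient placed at \<open>h\<close>.\<close>
  define d where "d U g h y = ?s U g y \<oplus>\<^bsub>?E U\<^esub> ?s U h ((\<ominus> \<one>) \<odot>\<^bsub>obj T U\<^esub> y)" for U g h y
  have m1: "\<ominus> \<one> \<in> carrier K" by simp
  have dm: "d U g h y \<in> carrier (?E U)" if "U \<in> VI_ob p" "y \<in> carrier (obj T U)" for U g h y
    unfolding d_def
    by (intro module_closed(2)[OF fun_mod_module[OF MT[OF that(1)]]] module_homD(1)[OF single_hom[OF MT[OF that(1)]]]
        module_closed(3)[OF MT[OF that(1)]] m1 that(2))
  have d_hom: "d U g h \<in> module_hom K (obj T U) (?E U)" if U: "U \<in> VI_ob p" for U g h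
  proof -
    interpret M: Module.module K "obj T U" using MT[OF U] .
    interpret N: Module.module K "?E U" using fun_mod_module[OF MT[OF U]] .
    note sh = module_homD[OF single_hom[OF MT[OF U], where S = "VI_hom p W U"]]
    show ?thesis
    proof (rule module_homI)
      fix x y assume xy: "x \<in> carrier (obj T U)" "y \<in> carrier (obj T U)"
      have mx: "\<ominus> \<one> \<odot>\<^bsub>obj T U\<^esub> x \<in> carrier (obj T U)" "\<ominus> \<one> \<odot>\<^bsub>obj T U\<^esub> y \<in> carrier (obj T U)"
        by (intro M.smult_closed m1 xy)+
      show "d U g h (x \<oplus>\<^bsub>obj T U\<^esub> y) = d U g h x \<oplus>\<^bsub>?E U\<^esub> d U g h y"
        unfolding d_def M.smult_r_distr[OF m1 xy] sh(2)[OF xy] sh(2)[OF mx]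
        using sh(1)[OF xy(1)] sh(1)[OF xy(2)] sh(1)[OF mx(1)] sh(1)[OF mx(2)]
        by (simp only: N.M.a_ac N.M.add.m_closed)
    next
      fix a x assume a: "a \<in> carrier K" and x: "x \<in> carrier (obj T U)"
      have mx: "\<ominus> \<one> \<odot>\<^bsub>obj T U\<^esub> x \<in> carrier (obj T U)" by (intro M.smult_closed m1 x)
      have "\<ominus> \<one> \<odot>\<^bsub>obj T U\<^esub> (a \<odot>\<^bsub>obj T U\<^esub> x) = a \<odot>\<^bsub>obj T U\<^esub> (\<ominus> \<one> \<odot>\<^bsub>obj T U\<^esub> x)"
        unfolding M.smult_assoc1[OF m1 a x, symmetric] M.smult_assoc1[OF a m1 x, symmetric] K.m_comm[OF m1 a] ..
      then show "d U g h (a \<odot>\<^bsub>obj T U\<^esub> x) = a \<odot>\<^bsub>?E U\<^esub> d U g h x"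
        unfolding d_def using sh(3)[OF a x] sh(3)[OF a mx] N.smult_r_distr[OF a sh(1)[OF x] sh(1)[OF mx]]
        by metis
    qed (rule dm[OF U])
  qed
  have d_ker: "d U g h y \<in> ?ker U" if U: "U \<in> VI_ob p" and gh: "g \<in> VI_hom p W U" "h \<in> VI_hom p W U"
    and y: "y \<in> carrier (obj T U)" for U g h y
  proof -
    interpret M: Module.module K "obj T U" using MT[OF U] .
    have my: "\<ominus> \<one> \<odot>\<^bsub>obj T U\<^esub> y \<in> carrier (obj T U)" by (intro M.smult_closed m1 y)
    note s1 = module_homD(1)[OF single_hom[OF MT[OF U], where S = "VI_hom p W U"]]
    note fin = finite_VI_hom[OF W U]
    have "(\<Oplus>\<^bsub>obj T U\<^esub>k\<in>VI_hom p W U. d U g h y k)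
        = (\<Oplus>\<^bsub>obj T U\<^esub>k\<in>VI_hom p W U. ?s U g y k) \<oplus>\<^bsub>obj T U\<^esub>
          (\<Oplus>\<^bsub>obj T U\<^esub>k\<in>VI_hom p W U. ?s U h (\<ominus> \<one> \<odot>\<^bsub>obj T U\<^esub> y) k)"
      using module_homD(2)[OF VI_nat_transD(1)[OF ST U]] s1[OF y] s1[OF my] unfolding d_def ext_obj by blast
    also have "\<dots> = y \<oplus>\<^bsub>obj T U\<^esub> \<ominus> \<one> \<odot>\<^bsub>obj T U\<^esub> y"
      unfolding sum_single[OF MT[OF U] fin gh(1) y] sum_single[OF MT[OF U] fin gh(2) my] ..
    also have "\<dots> = \<zero>\<^bsub>obj T U\<^esub>"
      unfolding M.smult_minus_1[OF y] by (rule M.M.r_neg[OF y])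
    finally show ?thesis using dm[OF U y] by simp
  qed
  have one: "[\<one>] \<in> carrier (obj T U)" if "vdim U \<in> S" for U
    unfolding T_def using that by simp
  \<comment> \<open>The bound is the one from \<open>VI_hom_pair_factor\<close> for two injections
    out of \<open>W\<close>; in dimensions outside \<open>S\<close> there are only zero
    coefficients.\<close>
  define G where "G = (\<Union>m\<in>{..vdim W + vdim W} \<inter> S. (\<lambda>(g, h). (std m, d (std m) g h [\<one>])) `
    (VI_hom p W (std m) \<times> VI_hom p W (std m)))"
  have "finite G" unfolding G_def using finite_VI_hom[OF W std_VI_ob] by blast
  moreover have "VI_generates p K (sub_vi (ext W T) ?ker) G"
  proof (rule VI_generatesI)
    fix A y assume "(A, y) \<in> G"
    then obtain m g h where *: "m \<in> S" "A = std m" "y = d (std m) g h [\<one>]"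
      "g \<in> VI_hom p W (std m)" "h \<in> VI_hom p W (std m)" unfolding G_def by auto
    show "A \<in> VI_ob p \<and> y \<in> carrier (obj (sub_vi (ext W T) ?ker) A)"
      unfolding *(2,3) sub_vi_simps using d_ker[OF std_VI_ob *(4,5) one] *(1) by simp
  next
    fix N U c
    assume N: "VI_sub p K (sub_vi (ext W T) ?ker) N" and gen: "\<And>A y. (A, y) \<in> G \<Longrightarrow> y \<in> N A"
      and U: "U \<in> VI_ob p" and "c \<in> carrier (obj (sub_vi (ext W T) ?ker) U)"
    then have c: "c \<in> VI_hom p W U \<rightarrow>\<^sub>E carrier (obj T U)"
      and c0: "(\<Oplus>\<^bsub>obj T U\<^esub>g\<in>VI_hom p W U. c g) = \<zero>\<^bsub>obj T U\<^esub>" by simp_all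
    note Vker = VI_module_sub_vi[OF VE ker]
    interpret M: Module.module K "obj T U" using MT[OF U] .
    interpret E: Module.module K "?E U" using fun_mod_module[OF MT[OF U]] .
    have sub: "submodule K (N U) (?E U)"
      using VI_sub_closed[OF Vker N U] VI_sub_closed(1)[OF VE ker U] ext_obj
      unfolding submodule_iff[OF fun_mod_module[OF MT[OF U]]] sub_vi_simps by auto
    have Nz: "\<zero>\<^bsub>?E U\<^esub> \<in> N U" using sub unfolding submodule_def by blast
    show "c \<in> N U"
    proof (cases "vdim U \<in> S \<and> VI_hom p W U \<noteq> {}")
      case False
      have "c = \<zero>\<^bsub>?E U\<^esub>" unfolding fun_mod_simps
      proof (rule restrict_eqI[OF c, symmetric])
        fix g assume g: "g \<in> VI_hom p W U"
        then have "vdim U \<notin> S" using False by blast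
        then show "\<zero>\<^bsub>obj T U\<^esub> = c g" using PiE_mem[OF c g] unfolding T_def by simp
      qed
      then show ?thesis using Nz by simp
    next
      case True
      then obtain h where US: "vdim U \<in> S" and h: "h \<in> VI_hom p W U" by blast
      have dN: "d U g h [\<one>] \<in> N U" if g: "g \<in> VI_hom p W U" for g
      proof -
        obtain m j g' h' where *: "m \<le> vdim W + vdim W" "j \<in> VI_hom p (std m) U"
          "g' \<in> VI_hom p W (std m)" "h' \<in> VI_hom p W (std m)"
          "g = compose (carrier W) j g'" "h = compose (carrier W) j h'"
          using VI_hom_pair_factor[OF W W U g h] .
        have le: "vdim W \<le> m" "m \<le> vdim U"
          using VI_hom_vdim_le[OF W std_VI_ob *(3)] VI_hom_vdim_le[OF std_VI_ob U *(2)] by auto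
        have mS: "m \<in> S" using conv[OF US le] .
        have o: "[\<one>] \<in> carrier (obj T (std m))" using one mS by simp
        have o': "\<ominus> \<one> \<odot>\<^bsub>obj T (std m)\<^esub> [\<one>] \<in> carrier (obj T (std m))"
          by (rule module_closed(3)[OF MT[OF std_VI_ob] m1 o])
        \<comment> \<open>No dimension between \<open>m\<close> and \<open>vdim U\<close> is
          missing, so the transition maps of \<open>T\<close> are identities and \<open>j\<close>
          carries one difference to the other.\<close>
        have "{m..vdim U} \<subseteq> S" using conv[OF US] le(1) by auto
        then have aid: "arr T (std m) U j y = y" for y unfolding T_def by simp
        have ops: "\<ominus> \<one> \<odot>\<^bsub>obj T (std m)\<^esub> [\<one>] = \<ominus> \<one> \<odot>\<^bsub>obj T U\<^esub> [\<one>]" unfolding T_def by simp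
        have s: "arr (ext W T) (std m) U j (?s (std m) k y) = ?s U (compose (carrier W) j k) y"
          if "k \<in> VI_hom p W (std m)" "y \<in> carrier (obj T (std m))" for k y
          using ext_arr_single[OF VT W std_VI_ob U *(2) that] unfolding aid .
        note sh = module_homD(1)[OF single_hom[OF MT[OF std_VI_ob]]]
        have "arr (ext W T) (std m) U j (d (std m) g' h' [\<one>])
            = arr (ext W T) (std m) U j (?s (std m) g' [\<one>]) \<oplus>\<^bsub>obj (ext W T) U\<^esub>
              arr (ext W T) (std m) U j (?s (std m) h' (\<ominus> \<one> \<odot>\<^bsub>obj T (std m)\<^esub> [\<one>]))"
          unfolding d_def ext_obj
          by (rule VI_module_arrD(2)[OF VE std_VI_ob U *(2), unfolded ext_obj, OF sh[OF o] sh[OF o']])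
        also have "\<dots> = d U g h [\<one>]"
          unfolding ops s[OF *(3) o] s[OF *(4) o'[unfolded ops]] *(5,6)[symmetric] ext_obj d_def ..
        finally have "d U g h [\<one>] = arr (sub_vi (ext W T) ?ker) (std m) U j (d (std m) g' h' [\<one>])" by simp
        moreover have "(std m, d (std m) g' h' [\<one>]) \<in> G" unfolding G_def using *(1,3,4) mS by auto
        ultimately show ?thesis using VI_subD(2)[OF N std_VI_ob U *(2) gen] by simp
      qed
      have cm: "c g \<in> carrier (obj T U)" if "g \<in> VI_hom p W U" for g by (rule PiE_mem[OF c that])
      have dcN: "d U g h (c g) \<in> N U" if g: "g \<in> VI_hom p W U" for g
      proof -
        obtain k where k: "k \<in> carrier K" "c g = [k]" using cm[OF g] US unfolding T_def by auto
        have "c g = k \<odot>\<^bsub>obj T U\<^esub> [\<one>]" using k unfolding T_def by simp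
        then have "d U g h (c g) = k \<odot>\<^bsub>?E U\<^esub> d U g h [\<one>]"
          using module_homD(3)[OF d_hom[OF U] k(1) one[OF US]] by simp
        then show ?thesis using dN[OF g] k(1) sub unfolding submodule_def by simp
      qed
      have "(\<lambda>y. \<ominus> \<one> \<odot>\<^bsub>obj T U\<^esub> y) \<in> module_hom K (obj T U) (obj T U)"
      proof (rule module_homI)
        show "\<ominus> \<one> \<odot>\<^bsub>obj T U\<^esub> (a \<odot>\<^bsub>obj T U\<^esub> x) = a \<odot>\<^bsub>obj T U\<^esub> (\<ominus> \<one> \<odot>\<^bsub>obj T U\<^esub> x)"
          if "a \<in> carrier K" "x \<in> carrier (obj T U)" for a x
          unfolding M.smult_assoc1[OF m1 that, symmetric] M.smult_assoc1[OF that(1) m1 that(2), symmetric]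
            K.m_comm[OF m1 that(1)] ..
      qed (rule M.smult_closed[OF m1] M.smult_r_distr[OF m1], assumption+)+
      from module_hom_comp[OF this single_hom[OF MT[OF U]]]
      have nh: "(\<lambda>y. ?s U h (\<ominus> \<one> \<odot>\<^bsub>obj T U\<^esub> y)) \<in> module_hom K (obj T U) (?E U)" .
      \<comment> \<open>In the sum of the terms \<open>d U g h (c g)\<close> the coefficients
        collected at \<open>h\<close> with negative sign add up to the coefficient sum of
        \<open>c\<close>, which is zero; what is left is \<open>c\<close>.\<close>
      note fin = finite_VI_hom[OF W U]
      have "(\<Oplus>\<^bsub>?E U\<^esub>g\<in>VI_hom p W U. d U g h (c g))
          = (\<Oplus>\<^bsub>?E U\<^esub>g\<in>VI_hom p W U. ?s U g (c g)) \<oplus>\<^bsub>?E U\<^esub>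
            (\<Oplus>\<^bsub>?E U\<^esub>g\<in>VI_hom p W U. ?s U h (\<ominus> \<one> \<odot>\<^bsub>obj T U\<^esub> c g))"
        unfolding d_def
        by (intro E.M.finsum_addf Pi_I module_homD(1)[OF single_hom[OF MT[OF U]]] module_homD(1)[OF nh] cm)
      also have "(\<Oplus>\<^bsub>?E U\<^esub>g\<in>VI_hom p W U. ?s U h (\<ominus> \<one> \<odot>\<^bsub>obj T U\<^esub> c g))
          = ?s U h (\<ominus> \<one> \<odot>\<^bsub>obj T U\<^esub> (\<Oplus>\<^bsub>obj T U\<^esub>g\<in>VI_hom p W U. c g))"
        by (rule module_hom_finsum[OF MT[OF U] fun_mod_module[OF MT[OF U]] nh fin cm, symmetric])
      also have "\<dots> = \<zero>\<^bsub>?E U\<^esub>"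
        unfolding c0 by (rule module_hom_zero[OF MT[OF U] fun_mod_module[OF MT[OF U]] nh])
      also have "(\<Oplus>\<^bsub>?E U\<^esub>g\<in>VI_hom p W U. ?s U g (c g)) = c"
        by (rule fun_mod_decompose[OF MT[OF U] fin c])
      also have "c \<oplus>\<^bsub>?E U\<^esub> \<zero>\<^bsub>?E U\<^esub> = c"
        by (rule E.M.r_zero) (simp only: fun_mod_simps c)
      finally have "c = (\<Oplus>\<^bsub>?E U\<^esub>g\<in>VI_hom p W U. d U g h (c g))" ..
      also have "\<dots> \<in> N U"
        by (rule submodule_finsum_closed[OF fun_mod_module[OF MT[OF U]] sub fin dcN])
      finally show ?thesis .
    qed
  qed
  ultimately show ?thesis by blast
qed

text \<open>Every space with dimension in \<open>S\<close> receives an injection from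
  \<open>W\<close>, so the coefficient sum is onto. Its kernel is an object by
  \<open>ext_trunc_kernel_generates\<close>, which is exactly what \<open>serre_quotient\<close>
  asks for; the rest moves the kernel to list carriers.\<close>

lemma serre_ext_trunc_unit:
  assumes P: "serre_subcategory \<A> P" and W: "W \<in> VI_ob p" and SW: "S \<subseteq> {vdim W..}"
    and conv: "\<And>a b. b \<in> S \<Longrightarrow> vdim W \<le> a \<Longrightarrow> a \<le> b \<Longrightarrow> a \<in> S"
    and Y: "extl W (trunc S unit_vi) \<in> P"
  shows "trunc S unit_vi \<in> P"
proof -
  define T where "T = trunc S unit_vi"
  have TO: "T \<in> Ob \<A>" unfolding T_def by (rule Ob_trunc_unit_interval[OF SW conv])
  have VT: "VI_module p K T" by (rule Ob_module[OF TO])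
  note VE = VI_module_ext[OF VT W] and VL = VI_module_extl[OF VT W]
  define \<sigma> where "\<sigma> U c = (\<Oplus>\<^bsub>obj T U\<^esub>g\<in>VI_hom p W U. c g)" for U c
  have \<sigma>: "VI_nat_trans p K (ext W T) T \<sigma>" unfolding \<sigma>_def by (rule ext_sum_trans[OF VT W])
  have \<sigma>surj: "\<sigma> U ` carrier (obj (ext W T) U) = carrier (obj T U)" if U: "U \<in> VI_ob p" for U
  proof
    show "\<sigma> U ` carrier (obj (ext W T) U) \<subseteq> carrier (obj T U)"
      using module_homD(1)[OF VI_nat_transD(1)[OF \<sigma> U]] by blast
    show "carrier (obj T U) \<subseteq> \<sigma> U ` carrier (obj (ext W T) U)"
    proof
      fix y assume y: "y \<in> carrier (obj T U)"
      show "y \<in> \<sigma> U ` carrier (obj (ext W T) U)"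
      proof (cases "vdim U \<in> S")
        case True
        then obtain g where g: "g \<in> VI_hom p W U" using VI_hom_nonempty[OF W U] SW by auto
        show ?thesis
        proof (rule image_eqI)
          show "y = \<sigma> U (single (VI_hom p W U) (obj T U) g y)"
            unfolding \<sigma>_def sum_single[OF VI_moduleD(1)[OF VT U] finite_VI_hom[OF W U] g y] ..
          show "single (VI_hom p W U) (obj T U) g y \<in> carrier (obj (ext W T) U)"
            unfolding ext_obj by (rule module_homD(1)[OF single_hom[OF VI_moduleD(1)[OF VT U]] y])
        qed
      next
        case False
        then have y0: "y = \<zero>\<^bsub>obj T U\<^esub>" using y unfolding T_def by simp
        show ?thesis
          unfolding y0 module_hom_zero[OF VI_moduleD(1)[OF VE U] VI_moduleD(1)[OF VT U]
              VI_nat_transD(1)[OF \<sigma> U], symmetric]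
          by (rule imageI[OF module_closed(1)[OF VI_moduleD(1)[OF VE U]]])
      qed
    qed
  qed
  let ?\<tau> = "\<lambda>U x. \<sigma> U (dec W T U x)"
  have \<tau>: "VI_nat_trans p K (extl W T) T ?\<tau>" by (rule nat_trans_comp[OF dec_trans[OF VT W] \<sigma>])
  let ?k = "\<lambda>U. {c \<in> carrier (obj (ext W T) U). \<sigma> U c = \<zero>\<^bsub>obj T U\<^esub>}"
  let ?kl = "\<lambda>U. {x \<in> carrier (obj (extl W T) U). ?\<tau> U x = \<zero>\<^bsub>obj T U\<^esub>}"
  have k: "VI_module p K (sub_vi (ext W T) ?k)" by (rule VI_module_sub_vi[OF VE VI_sub_kernel[OF VE VT \<sigma>]])
  have kl: "VI_module p K (sub_vi (extl W T) ?kl)" by (rule VI_module_sub_vi[OF VL VI_sub_kernel[OF VL VT \<tau>]])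
  note et = extl_trans[OF VT W]
  have de: "dec W T U (enc (VI_hom p W U) c) = c" if "U \<in> VI_ob p" "c \<in> carrier (obj (ext W T) U)" for U c
    by (rule bij_betw_inv_into_left[OF extl_bij[OF W that(1)] that(2)])
  have img: "enc (VI_hom p W U) ` ?k U = ?kl U" if U: "U \<in> VI_ob p" for U
    unfolding extl_carrier using de[OF U] by auto
  have "VI_nat_trans p K (sub_vi (ext W T) ?k) (sub_vi (extl W T) ?kl) (\<lambda>U. enc (VI_hom p W U))"
    unfolding VI_nat_trans_def
  proof (intro conjI ballI)
    fix U assume U: "U \<in> VI_ob p"
    note h = module_homD[OF VI_nat_transD(1)[OF et U]]
    show "enc (VI_hom p W U) \<in> module_hom K (obj (sub_vi (ext W T) ?k) U) (obj (sub_vi (extl W T) ?kl) U)"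
    proof (rule module_homI, unfold sub_vi_simps)
      show "enc (VI_hom p W U) c \<in> ?kl U" if "c \<in> ?k U" for c using img[OF U] that by blast
    qed (use h(2,3) in blast)+
  next
    fix U V f c assume *: "U \<in> VI_ob p" "V \<in> VI_ob p" "f \<in> VI_hom p U V"
      and "c \<in> carrier (obj (sub_vi (ext W T) ?k) U)"
    then have "c \<in> carrier (obj (ext W T) U)" unfolding sub_vi_simps by blast
    then show "enc (VI_hom p W V) (arr (sub_vi (ext W T) ?k) U V f c)
        = arr (sub_vi (extl W T) ?kl) U V f (enc (VI_hom p W U) c)"
      unfolding sub_vi_simps by (rule VI_nat_transD(2)[OF et *])
  qed
  note enck = this
  have "\<exists>G. finite G \<and> VI_generates p K (sub_vi (ext W T) ?k) G"
    unfolding \<sigma>_def T_def by (rule ext_trunc_kernel_generates[OF W SW conv])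
  then obtain G where G: "finite G" "VI_generates p K (sub_vi (ext W T) ?k) G"
    by (elim exE conjE) (rule that)
  have "VI_generates p K (sub_vi (extl W T) ?kl) ((\<lambda>(A, x). (A, enc (VI_hom p W A) x)) ` G)"
    by (rule VI_generates_surj[OF k kl enck _ G(2)]) (simp only: sub_vi_simps img)
  then have klO: "sub_vi (extl W T) ?kl \<in> Ob \<A>" unfolding Ob_iff using kl finite_imageI[OF G(1)] by blast
  have surj: "?\<tau> U ` carrier (obj (extl W T) U) = carrier (obj T U)" if U: "U \<in> VI_ob p" for U
  proof -
    have "?\<tau> U ` carrier (obj (extl W T) U) = \<sigma> U ` dec W T U ` carrier (obj (extl W T) U)"
      unfolding image_image ..
    then show ?thesis unfolding bij_betw_imp_surj_on[OF dec_bij[OF W U, of T]] \<sigma>surj[OF U] .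
  qed
  have "T \<in> P" by (rule serre_quotient[OF P Y[folded T_def] TO \<tau> surj klO])
  then show ?thesis unfolding T_def .
qed

text \<open>
  The tensor product of \<open>X\<close> with the free module on \<open>W\<close> contains the submodule generated by
  \<open>x \<otimes> id\<close>. It is spanned by the linearly independent elements \<open>h x \<otimes> h\<close> with \<open>h x \<noteq> 0\<close>, hence
  is a truncation of that free module.
\<close>

lemma serre_ideal_trunc_unit:
  assumes P: "serre_ideal \<A> P" and X: "X \<in> P" and W: "W \<in> VI_ob p" and x: "x \<in> carrier (obj X W)"
    and SW: "S \<subseteq> {vdim W..}"
    and conv: "\<And>a b. b \<in> S \<Longrightarrow> vdim W \<le> a \<Longrightarrow> a \<le> b \<Longrightarrow> a \<in> S"
    and nonzero: "\<And>U h. U \<in> VI_ob p \<Longrightarrow> h \<in> VI_hom p W U \<Longrightarrow> arr X W U h x \<noteq> \<zero>\<^bsub>obj X U\<^esub> \<longleftrightarrow> vdim U \<in> S"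
  shows "trunc S unit_vi \<in> P"
proof -
  have Ps: "serre_subcategory \<A> P" using P unfolding serre_ideal_def by blast
  have OX: "X \<in> Ob \<A>" by (rule serreD(1)[OF Ps X])
  have VX: "VI_module p K X" by (rule Ob_module[OF OX])
  have ZP: "extl W X \<in> P"
    using P X Ob_extl[OF unit_Ob W] Ob_extl[OF OX W] tensor_extl[OF VX W] unfolding serre_ideal_def by blast
  define T where "T = trunc S unit_vi"
  have TO: "T \<in> Ob \<A>" unfolding T_def by (rule Ob_trunc_unit_interval[OF SW conv])
  have VT: "VI_module p K T" by (rule Ob_module[OF TO])
  have Tl: "hd y \<in> carrier K" "y = [hd y]" "vdim U \<notin> S \<Longrightarrow> y = [\<zero>]" if "y \<in> carrier (obj T U)" for y U
    using that unfolding T_def by (auto split: if_splits)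
  let ?H = "VI_hom p W"
  \<comment> \<open>The basis vector \<open>g\<close> goes to \<open>arr X W U g x\<close> placed at
    \<open>g\<close>; \<open>hd\<close> turns a coefficient of \<open>T\<close>, a one-element list,
    into a scalar.\<close>
  define \<epsilon> where "\<epsilon> U c = (\<lambda>g\<in>?H U. hd (c g) \<odot>\<^bsub>obj X U\<^esub> arr X W U g x)" for U c
  have gx: "arr X W U g x \<in> carrier (obj X U)" if "U \<in> VI_ob p" "g \<in> ?H U" for U g
    by (rule VI_module_arrD(1)[OF VX W that x])
  have \<epsilon>m: "\<epsilon> U c \<in> ?H U \<rightarrow>\<^sub>E carrier (obj X U)"
    if U: "U \<in> VI_ob p" and c: "c \<in> ?H U \<rightarrow>\<^sub>E carrier (obj T U)" for U c
    unfolding \<epsilon>_def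
    by (intro PiE_restrictI module_closed(3)[OF VI_moduleD(1)[OF VX U]] Tl(1)[OF PiE_mem[OF c]] gx[OF U])
  have \<epsilon>h: "\<epsilon> U \<in> module_hom K (fun_mod (?H U) (obj T U)) (fun_mod (?H U) (obj X U))" if U: "U \<in> VI_ob p" for U
  proof -
    interpret M: Module.module K "obj X U" using VI_moduleD(1)[OF VX U] .
    have Tops: "hd (y \<oplus>\<^bsub>obj T U\<^esub> z) = hd y \<oplus> hd z" "hd (a \<odot>\<^bsub>obj T U\<^esub> y) = a \<otimes> hd y" for y z a
      unfolding T_def by simp_all
    show ?thesis
    proof (rule module_homI)
      fix c assume "c \<in> carrier (fun_mod (?H U) (obj T U))"
      then show "\<epsilon> U c \<in> carrier (fun_mod (?H U) (obj X U))" unfolding fun_mod_simps by (rule \<epsilon>m[OF U])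
    next
      fix c d assume cd: "c \<in> carrier (fun_mod (?H U) (obj T U))" "d \<in> carrier (fun_mod (?H U) (obj T U))"
      then have c: "c \<in> ?H U \<rightarrow>\<^sub>E carrier (obj T U)" and d: "d \<in> ?H U \<rightarrow>\<^sub>E carrier (obj T U)" by simp_all
      show "\<epsilon> U (c \<oplus>\<^bsub>fun_mod (?H U) (obj T U)\<^esub> d) = \<epsilon> U c \<oplus>\<^bsub>fun_mod (?H U) (obj X U)\<^esub> \<epsilon> U d"
        unfolding \<epsilon>_def fun_mod_simps
        by (intro restrict_ext)
          (simp add: Tops M.smult_l_distr[OF Tl(1)[OF PiE_mem[OF c]] Tl(1)[OF PiE_mem[OF d]] gx[OF U]])
    next
      fix a c assume a: "a \<in> carrier K" and cd: "c \<in> carrier (fun_mod (?H U) (obj T U))"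
      then have c: "c \<in> ?H U \<rightarrow>\<^sub>E carrier (obj T U)" by simp
      show "\<epsilon> U (a \<odot>\<^bsub>fun_mod (?H U) (obj T U)\<^esub> c) = a \<odot>\<^bsub>fun_mod (?H U) (obj X U)\<^esub> \<epsilon> U c"
        unfolding \<epsilon>_def fun_mod_simps
        by (intro restrict_ext) (simp add: Tops M.smult_assoc1[OF a Tl(1)[OF PiE_mem[OF c]] gx[OF U]])
    qed
  qed
  have \<epsilon>: "VI_nat_trans p K (ext W T) (ext W X) \<epsilon>"
    unfolding VI_nat_trans_def
  proof (intro conjI ballI)
    show "\<epsilon> U \<in> module_hom K (obj (ext W T) U) (obj (ext W X) U)" if "U \<in> VI_ob p" for U
      unfolding ext_obj by (rule \<epsilon>h[OF that])
    fix U V f c assume U: "U \<in> VI_ob p" and V: "V \<in> VI_ob p" and f: "f \<in> VI_hom p U V"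
      and "c \<in> carrier (obj (ext W T) U)"
    then have c: "c \<in> ?H U \<rightarrow>\<^sub>E carrier (obj T U)" by simp
    interpret M: Module.module K "obj X U" using VI_moduleD(1)[OF VX U] .
    interpret N: Module.module K "obj X V" using VI_moduleD(1)[OF VX V] .
    show "\<epsilon> V (arr (ext W T) U V f c) = arr (ext W X) U V f (\<epsilon> U c)"
    proof (rule ext_arr_eqI[OF VX W U V f \<epsilon>m[OF U c] \<epsilon>m[OF V ext_arr_mem[OF VT W U V f c]], symmetric])
      fix g assume g: "g \<in> ?H U"
      let ?fg = "compose (carrier W) f g"
      have fg: "?fg \<in> ?H V" by (rule VI_hom_compose[OF g f W])
      have cg: "c g \<in> carrier (obj T U)" by (rule PiE_mem[OF c g])
      have comp: "arr X U V f (arr X W U g x) = arr X W V ?fg x"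
        by (rule VI_moduleD(4)[OF VX W U V g f x, symmetric])
      have "\<epsilon> V (arr (ext W T) U V f c) ?fg = hd (arr T U V f (c g)) \<odot>\<^bsub>obj X V\<^esub> arr X W V ?fg x"
        unfolding \<epsilon>_def using fg ext_arr(1)[OF W f g, of T c] by simp
      moreover have "arr X U V f (\<epsilon> U c g) = hd (c g) \<odot>\<^bsub>obj X V\<^esub> arr X W V ?fg x"
        unfolding \<epsilon>_def using g VI_module_arrD(3)[OF VX U V f Tl(1)[OF cg] gx[OF U g]] comp by simp
      \<comment> \<open>If the interval is not contained in \<open>S\<close>, the left side is zero.
        So is the right side: either \<open>V\<close> lies outside \<open>S\<close> and the image of
        \<open>x\<close> there is zero, or \<open>U\<close> lies outside \<open>S\<close> and the
        coefficient \<open>c g\<close> was already zero.\<close>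
      moreover have "hd (arr T U V f (c g)) \<odot>\<^bsub>obj X V\<^esub> arr X W V ?fg x = hd (c g) \<odot>\<^bsub>obj X V\<^esub> arr X W V ?fg x"
      proof (cases "{vdim U..vdim V} \<subseteq> S")
        case True
        then show ?thesis unfolding T_def by simp
      next
        case False
        then have a0: "hd (arr T U V f (c g)) = \<zero>" unfolding T_def by simp
        show ?thesis
        proof (cases "vdim V \<in> S")
          case True
          have "vdim U \<notin> S"
          proof
            assume "vdim U \<in> S"
            then have "{vdim U..vdim V} \<subseteq> S" using conv[OF True] SW by fastforce
            then show False using False by simp
          qed
          then have "hd (c g) = \<zero>" using Tl(3)[OF cg] by simp
          then show ?thesis using a0 by simp
        next
          case False
          then have "arr X W V ?fg x = \<zero>\<^bsub>obj X V\<^esub>" using nonzero[OF V fg] by blast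
          then show ?thesis using a0 Tl(1)[OF cg] by simp
        qed
      qed
      ultimately show "\<epsilon> V (arr (ext W T) U V f c) ?fg = arr X U V f (\<epsilon> U c g)" by simp
    next
      fix h assume h: "h \<in> ?H V" "h \<notin> compose (carrier W) f ` ?H U"
      have "arr (ext W T) U V f c h = [\<zero>]" using ext_arr(2)[OF W f h, of T c] unfolding T_def by simp
      then show "\<epsilon> V (arr (ext W T) U V f c) h = \<zero>\<^bsub>obj X V\<^esub>"
        unfolding \<epsilon>_def using h(1) gx[OF V h(1)] by simp
    qed
  qed
  have inj: "inj_on (\<epsilon> U) (carrier (obj (ext W T) U))" if U: "U \<in> VI_ob p" for U
  proof (rule module_hom_inj_onI[OF VI_moduleD(1)[OF VI_module_ext[OF VT W] U]
        VI_moduleD(1)[OF VI_module_ext[OF VX W] U] VI_nat_transD(1)[OF \<epsilon> U]])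
    interpret M: vectorspace K "obj X U"
      using VI_moduleD(1)[OF VX U] K.field_axioms by (simp add: vectorspace_def)
    fix c assume "c \<in> carrier (obj (ext W T) U)" and z: "\<epsilon> U c = \<zero>\<^bsub>obj (ext W X) U\<^esub>"
    then have c: "c \<in> ?H U \<rightarrow>\<^sub>E carrier (obj T U)" by simp
    have "[\<zero>] = c g" if g: "g \<in> ?H U" for g
    proof (cases "vdim U \<in> S")
      case True
      have "hd (c g) \<odot>\<^bsub>obj X U\<^esub> arr X W U g x = \<zero>\<^bsub>obj X U\<^esub>"
        using fun_cong[OF z, of g] g unfolding \<epsilon>_def by simp
      moreover have "arr X W U g x \<noteq> \<zero>\<^bsub>obj X U\<^esub>" using nonzero[OF U g] True by blast
      ultimately have "hd (c g) = \<zero>"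
        using M.mult_inverse[OF Tl(1)[OF PiE_mem[OF c g]] gx[OF U g], of "\<zero>\<^bsub>obj X U\<^esub>"]
          K.inverse_exists[OF Tl(1)[OF PiE_mem[OF c g]]] by (metis M.rmult_0)
      then show ?thesis using Tl(2)[OF PiE_mem[OF c g]] by simp
    next
      case False
      show ?thesis using Tl(3)[OF PiE_mem[OF c g] False] by simp
    qed
    then have "(\<lambda>g\<in>?H U. [\<zero>]) = c" by (rule restrict_eqI[OF c])
    then show "c = \<zero>\<^bsub>obj (ext W T) U\<^esub>" unfolding ext_obj fun_mod_simps T_def by simp
  qed
  \<comment> \<open>The embedding conjugated by the list encodings, which makes it a map between
    objects of \<A>.\<close>
  let ?\<theta> = "\<lambda>U y. enc (?H U) (\<epsilon> U (dec W T U y))"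
  have "VI_nat_trans p K (extl W T) (extl W X) ?\<theta>"
    by (rule nat_trans_comp[OF nat_trans_comp[OF dec_trans[OF VT W] \<epsilon>] extl_trans[OF VX W]])
  moreover have "inj_on (?\<theta> U) (carrier (obj (extl W T) U))" if U: "U \<in> VI_ob p" for U
  proof -
    have "inj_on (enc (?H U) \<circ> (\<epsilon> U \<circ> dec W T U)) (carrier (obj (extl W T) U))"
    proof (intro comp_inj_on)
      show "inj_on (dec W T U) (carrier (obj (extl W T) U))" by (rule bij_betw_imp_inj_on[OF dec_bij[OF W U]])
      show "inj_on (\<epsilon> U) (dec W T U ` carrier (obj (extl W T) U))"
        unfolding bij_betw_imp_surj_on[OF dec_bij[OF W U]] by (rule inj[OF U])
      show "inj_on (enc (?H U)) ((\<epsilon> U \<circ> dec W T U) ` carrier (obj (extl W T) U))"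
        unfolding image_comp[symmetric] bij_betw_imp_surj_on[OF dec_bij[OF W U]]
        using module_homD(1)[OF VI_nat_transD(1)[OF \<epsilon> U]]
        by (intro inj_on_subset[OF inj_on_enc_ext[OF W U, of X]]) blast
    qed
    then show ?thesis by (simp only: comp_def)
  qed
  ultimately have "extl W T \<in> P" by (rule serre_sub[OF Ps ZP Ob_extl[OF TO W]])
  then have Y: "extl W (trunc S unit_vi) \<in> P" unfolding T_def .
  show ?thesis by (rule serre_ext_trunc_unit[OF Ps W SW conv Y])
qed

section \<open>The prime Serre ideals\<close>

definition vanishing_at :: "nat \<Rightarrow> ('k, 'k list) vi_module set" where
  "vanishing_at n = {X \<in> Ob \<A>. \<not> nz X n}"

definition finite_support :: "('k, 'k list) vi_module set" where
  "finite_support = {X \<in> Ob \<A>. \<exists>N. \<forall>n\<ge>N. \<not> nz X n}"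

lemma Ob_truncI: "S \<subseteq> {..n} \<Longrightarrow> trunc S unit_vi \<in> Ob \<A>"
  by (rule Ob_trunc_unit) (rule finite_subset[of _ "{..n}"], auto)

text \<open>An element that no injection kills has nonzero images in all dimensions from that of its
  space on. Supports of objects are therefore finite or cofinite.\<close>

lemma nz_eventually:
  assumes X: "X \<in> Ob \<A>" and inf: "X \<notin> finite_support"
  obtains N where "\<And>n. n \<ge> N \<Longrightarrow> nz X n"
proof -
  have VX: "VI_module p K X" by (rule Ob_module[OF X])
  have "\<exists>n\<ge>N. nz X n" for N using X inf unfolding finite_support_def by blast
  then obtain A x where A: "A \<in> VI_ob p" and x: "x \<in> carrier (obj X A)"
    and nonzero: "\<And>V f. V \<in> VI_ob p \<Longrightarrow> f \<in> VI_hom p A V \<Longrightarrow> arr X A V f x \<noteq> \<zero>\<^bsub>obj X V\<^esub>"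
    using torsion_free_element[OF X] by metis
  show ?thesis
  proof (rule that)
    fix n assume n: "n \<ge> vdim A"
    obtain f where f: "f \<in> VI_hom p A (std n)" using VI_hom_nonempty[OF A std_VI_ob[of n]] n by auto
    show "nz X n" unfolding nz_def
      using nonzero[OF std_VI_ob f] VI_module_arrD(1)[OF VX A std_VI_ob f x] by blast
  qed
qed

lemma vanishing_at_Spc: "vanishing_at n \<in> Spc \<A>"
  unfolding Spc_def prime_serre_ideal_def serre_ideal_def serre_subcategory_def mem_Collect_eq
proof (intro conjI ballI impI)
  show "vanishing_at n \<subseteq> Ob \<A>" unfolding vanishing_at_def by blast
  have "trunc {} unit_vi \<in> vanishing_at n"
    unfolding vanishing_at_def using Ob_truncI[of "{}"] nz_trunc_unit by blast
  then show "vanishing_at n \<noteq> {}" by blast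
  show "B \<in> vanishing_at n \<longleftrightarrow> A \<in> vanishing_at n \<and> C \<in> vanishing_at n"
    if "A \<in> Ob \<A>" "B \<in> Ob \<A>" "C \<in> Ob \<A>" "short_exact \<A> A B C" for A B C
    using nz_exact[OF that] that(1-3) unfolding vanishing_at_def by blast
  show "Z \<in> vanishing_at n" if "X \<in> vanishing_at n" "Y \<in> Ob \<A>" "Z \<in> Ob \<A>" "tensor \<A> X Y Z" for X Y Z
    using nz_tensor[OF _ that(2-4)] that(1,3) unfolding vanishing_at_def by blast
  have "nz (trunc UNIV unit_vi) n" using nz_trunc_unit by blast
  then have "unit_vi \<notin> vanishing_at n" unfolding trunc_UNIV_unit vanishing_at_def by blast
  then show "vanishing_at n \<noteq> Ob \<A>" using unit_Ob by blast
  show "X \<in> vanishing_at n \<or> Y \<in> vanishing_at n"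
    if "X \<in> Ob \<A>" "Y \<in> Ob \<A>" "Z \<in> Ob \<A>" "tensor \<A> X Y Z" "Z \<in> vanishing_at n" for X Y Z
    using nz_tensor[OF that(1-4)] that(1,2,5) unfolding vanishing_at_def by blast
qed

text \<open>Primality is the point: by \<open>nz_eventually\<close> the objects outside have
  cofinite supports, and two cofinite supports meet in arbitrarily large dimensions.\<close>

lemma finite_support_Spc: "finite_support \<in> Spc \<A>"
  unfolding Spc_def prime_serre_ideal_def serre_ideal_def serre_subcategory_def mem_Collect_eq
proof (intro conjI ballI impI)
  show "finite_support \<subseteq> Ob \<A>" unfolding finite_support_def by blast
  have "trunc {} unit_vi \<in> finite_support"
    unfolding finite_support_def using Ob_truncI[of "{}"] nz_trunc_unit by blast
  then show "finite_support \<noteq> {}" by blast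
  show "B \<in> finite_support \<longleftrightarrow> A \<in> finite_support \<and> C \<in> finite_support"
    if Ob: "A \<in> Ob \<A>" "B \<in> Ob \<A>" "C \<in> Ob \<A>" "short_exact \<A> A B C" for A B C
  proof
    show "B \<in> finite_support \<Longrightarrow> A \<in> finite_support \<and> C \<in> finite_support"
      using nz_exact[OF Ob] Ob unfolding finite_support_def by blast
    assume "A \<in> finite_support \<and> C \<in> finite_support"
    then obtain M N where "\<forall>n\<ge>M. \<not> nz A n" "\<forall>n\<ge>N. \<not> nz C n" unfolding finite_support_def by blast
    then have "\<forall>n\<ge>max M N. \<not> nz B n" using nz_exact[OF Ob] by simp
    then show "B \<in> finite_support" using Ob(2) unfolding finite_support_def by blast
  qed
  show "Z \<in> finite_support" if "X \<in> finite_support" "Y \<in> Ob \<A>" "Z \<in> Ob \<A>" "tensor \<A> X Y Z" for X Y Z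
    using nz_tensor[OF _ that(2-4)] that(1,3) unfolding finite_support_def by blast
  have "nz (trunc UNIV unit_vi) n" for n using nz_trunc_unit by blast
  then have "unit_vi \<notin> finite_support" unfolding trunc_UNIV_unit finite_support_def by blast
  then show "finite_support \<noteq> Ob \<A>" using unit_Ob by blast
  show "X \<in> finite_support \<or> Y \<in> finite_support"
    if Ob: "X \<in> Ob \<A>" "Y \<in> Ob \<A>" "Z \<in> Ob \<A>" "tensor \<A> X Y Z" and Z: "Z \<in> finite_support" for X Y Z
  proof (rule ccontr)
    assume no: "\<not> ?thesis"
    obtain M where M: "\<And>n. n \<ge> M \<Longrightarrow> nz X n" using nz_eventually[OF Ob(1)] no by blast
    obtain N where N: "\<And>n. n \<ge> N \<Longrightarrow> nz Y n" using nz_eventually[OF Ob(2)] no by blast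
    obtain L where L: "\<forall>n\<ge>L. \<not> nz Z n" using Z unfolding finite_support_def by blast
    let ?n = "max L (max M N)"
    have "nz Z ?n" using nz_tensor[OF Ob] M[of ?n] N[of ?n] by simp
    then show False using L by simp
  qed
qed

lemma tensor_trunc_single:
  assumes X: "VI_module p K X"
  shows "tensor \<A> X (trunc {n} unit_vi) (trunc {n} X)"
  by (rule tensor_trunc_unit[OF X VI_module_trunc[OF X]]) (auto simp: trunc_def)

lemma tensor_supported:
  assumes X: "VI_module p K X" and S: "\<And>n. n \<notin> S \<Longrightarrow> \<not> nz X n" and conv: "\<And>a b. a \<in> S \<Longrightarrow> b \<in> S \<Longrightarrow> {a..b} \<subseteq> S"
  shows "tensor \<A> (trunc S unit_vi) X X"
proof (rule tensor_sym, rule tensor_trunc_unit[OF X X])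
  show "carrier (obj X U) = {\<zero>\<^bsub>obj X U\<^esub>}" if "U \<in> VI_ob p" "vdim U \<notin> S" for U
    using S[OF that(2)] nz_vdim[OF X that(1)] by blast
qed (use conv in auto)

lemma Spc_cases:
  assumes P: "P \<in> Spc \<A>"
  shows "P = finite_support \<or> (\<exists>n. P = vanishing_at n)"
proof -
  have prime: "serre_ideal \<A> P" "P \<noteq> Ob \<A>"
    "\<And>X Y Z. X \<in> Ob \<A> \<Longrightarrow> Y \<in> Ob \<A> \<Longrightarrow> Z \<in> Ob \<A> \<Longrightarrow> tensor \<A> X Y Z \<Longrightarrow> Z \<in> P \<Longrightarrow> X \<in> P \<or> Y \<in> P"
    using P unfolding Spc_def prime_serre_ideal_def by blast+
  have ser: "serre_subcategory \<A> P"
    and ideal: "\<And>X Y Z. X \<in> P \<Longrightarrow> Y \<in> Ob \<A> \<Longrightarrow> Z \<in> Ob \<A> \<Longrightarrow> tensor \<A> X Y Z \<Longrightarrow> Z \<in> P"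
    using prime(1) unfolding serre_ideal_def by blast+
  note PO = serreD(1)[OF ser]
  have one_O: "trunc {n} unit_vi \<in> Ob \<A>" for n by (rule Ob_truncI[of _ n]) simp
  have one_P: "trunc {n} unit_vi \<in> P" if X: "X \<in> P" and nz: "nz X n" for X n
  proof -
    note VX = Ob_module[OF PO[OF X]]
    \<comment> \<open>After this truncation a nonzero \<open>x\<close> in dimension \<open>n\<close>
      survives there and nowhere else, so \<open>serre_ideal_trunc_unit\<close> applies with the set
      \<open>{n}\<close>.\<close>
    have T: "trunc {n} X \<in> P"
      by (rule ideal[OF X one_O Ob_trunc_single[OF PO[OF X]] tensor_trunc_single[OF VX]])
    obtain x where x: "x \<in> carrier (obj X (std n))" "x \<noteq> \<zero>\<^bsub>obj X (std n)\<^esub>"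
      using nz module_closed(1)[OF VI_moduleD(1)[OF VX std_VI_ob[of n]]] unfolding nz_def by blast
    show ?thesis
    proof (rule serre_ideal_trunc_unit[OF prime(1) T std_VI_ob[of n], of x])
      fix U h assume U: "U \<in> VI_ob p" and h: "h \<in> VI_hom p (std n) U"
      have le: "n \<le> vdim U" using VI_hom_vdim_le[OF std_VI_ob U h] by simp
      show "arr (trunc {n} X) (std n) U h x \<noteq> \<zero>\<^bsub>obj (trunc {n} X) U\<^esub> \<longleftrightarrow> vdim U \<in> {n}"
      proof (cases "vdim U = n")
        case True
        then show ?thesis using arr_iso_nonzero[OF VX std_VI_ob U h _ x(1)] x(2) by auto
      next
        case False
        then have "\<not> {n..vdim U} \<subseteq> {n}" using le by auto
        then show ?thesis using False by simp
      qed
    qed (use x in auto)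
  qed
  show ?thesis
  proof (cases "\<exists>n. trunc {n} unit_vi \<notin> P")
    case True
    then obtain n where n: "trunc {n} unit_vi \<notin> P" by blast
    have "P = vanishing_at n"
    proof
      show "P \<subseteq> vanishing_at n" unfolding vanishing_at_def using one_P n PO by blast
      show "vanishing_at n \<subseteq> P"
      proof
        fix X assume "X \<in> vanishing_at n"
        then have X: "X \<in> Ob \<A>" "\<not> nz X n" unfolding vanishing_at_def by auto
        note VX = Ob_module[OF X(1)]
        \<comment> \<open>The product of \<open>X\<close> with \<open>trunc {n} unit_vi\<close> is
          zero because \<open>X\<close> vanishes in dimension \<open>n\<close>. Since the second
          factor is not in \<open>P\<close>, primality leaves \<open>X\<close>.\<close>
        have "trunc {n} X \<in> P"
        proof (rule serre_zero[OF ser Ob_trunc_single[OF X(1)]])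
          fix V assume V: "V \<in> VI_ob p"
          show "carrier (obj (trunc {n} X) V) = {\<zero>\<^bsub>obj (trunc {n} X) V\<^esub>}"
            using X(2) nz_vdim[OF VX V] by (cases "vdim V = n") auto
        qed
        then show "X \<in> P"
          using prime(3)[OF X(1) one_O Ob_trunc_single[OF X(1)] tensor_trunc_single[OF VX]] n by blast
      qed
    qed
    then show ?thesis by blast
  next
    case False
    then have ones: "trunc {n} unit_vi \<in> P" for n by blast
    \<comment> \<open>Initial parts of the unit are built up one dimension at a time, each new
      dimension being a subobject from \<open>ones\<close>.\<close>
    have init: "trunc {..<b} unit_vi \<in> P" for b
    proof (induction b)
      case 0
      show ?case by (rule serre_zero[OF ser Ob_truncI[of _ 0]]) auto
    next
      case (Suc b)
      have e: "{..<Suc b} \<inter> {b..} = {b}" "{..<Suc b} \<inter> {..<b} = {..<b}" by auto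
      have "trunc {..<b} unit_vi \<in> Ob \<A>" "trunc {..<Suc b} unit_vi \<in> Ob \<A>"
        by (rule Ob_truncI[of _ b], auto)+
      then show ?case
        using serreD(3)[OF ser one_O _ _ trunc_unit_exact[of "{..<Suc b}" b, unfolded e]] ones Suc.IH by blast
    qed
    have "P = finite_support"
    proof
      show "finite_support \<subseteq> P"
      proof
        fix X assume "X \<in> finite_support"
        then obtain N where X: "X \<in> Ob \<A>" "\<forall>n\<ge>N. \<not> nz X n" unfolding finite_support_def by blast
        \<comment> \<open>On a module vanishing from \<open>N\<close> on, the initial part of the
          unit acts as the whole unit would.\<close>
        have "tensor \<A> (trunc {..<N} unit_vi) X X"
          by (rule tensor_supported[OF Ob_module[OF X(1)]]) (use X(2) in auto)
        then show "X \<in> P" by (rule ideal[OF init X(1) X(1)])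
      qed
      show "P \<subseteq> finite_support"
      proof (rule ccontr)
        assume "\<not> P \<subseteq> finite_support"
        then obtain X where X: "X \<in> P" "X \<notin> finite_support" by blast
        note OX = PO[OF X(1)]
        have "\<exists>n\<ge>N. nz X n" for N using OX X(2) unfolding finite_support_def by blast
        then obtain A x where A: "A \<in> VI_ob p" and x: "x \<in> carrier (obj X A)"
          and nonzero: "\<And>V f. V \<in> VI_ob p \<Longrightarrow> f \<in> VI_hom p A V \<Longrightarrow> arr X A V f x \<noteq> \<zero>\<^bsub>obj X V\<^esub>"
          using torsion_free_element[OF OX] by metis
        let ?n = "vdim A"
        \<comment> \<open>As no injection kills \<open>x\<close>, the dimensions in which it
          survives are all those from \<open>?n\<close> on.\<close>
        have tail: "trunc {?n..} unit_vi \<in> P"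
        proof (rule serre_ideal_trunc_unit[OF prime(1) X(1) A x])
          show "arr X A U h x \<noteq> \<zero>\<^bsub>obj X U\<^esub> \<longleftrightarrow> vdim U \<in> {?n..}"
            if "U \<in> VI_ob p" "h \<in> VI_hom p A U" for U h
            using nonzero[OF that] VI_hom_vdim_le[OF A that] by simp
        qed auto
        have e: "UNIV \<inter> {?n..} = {?n..}" "UNIV \<inter> {..<?n} = {..<?n}" by auto
        \<comment> \<open>The unit is an extension of its initial part by its tail. An ideal
          containing the unit absorbs every object and is not proper.\<close>
        have "unit_vi \<in> P"
          using serreD(3)[OF ser PO[OF tail] unit_Ob PO[OF init]
              trunc_unit_exact[of UNIV ?n, unfolded e trunc_UNIV_unit]] tail init by blast
        moreover have "tensor \<A> unit_vi Y Y" if "Y \<in> Ob \<A>" for Y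
          using tensor_supported[OF Ob_module[OF that], of UNIV] unfolding trunc_UNIV_unit by simp
        ultimately have "Ob \<A> \<subseteq> P" using ideal by blast
        then show False using prime(2) PO by blast
      qed
    qed
    then show ?thesis by blast
  qed
qed

section \<open>The topology of the spectrum\<close>

definition point :: "nat option \<Rightarrow> ('k, 'k list) vi_module set" where
  "point x = (case x of None \<Rightarrow> finite_support | Some n \<Rightarrow> vanishing_at n)"

lemma trunc_unit_mem_point:
  assumes "trunc S unit_vi \<in> Ob \<A>"
  shows "trunc S unit_vi \<in> point (Some n) \<longleftrightarrow> n \<notin> S" "trunc S unit_vi \<in> point None \<longleftrightarrow> finite S"
proof -
  show "trunc S unit_vi \<in> point (Some n) \<longleftrightarrow> n \<notin> S"
    using assms nz_trunc_unit unfolding point_def vanishing_at_def by auto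
  have "(\<exists>N. \<forall>n\<ge>N. n \<notin> S) \<longleftrightarrow> finite S"
    unfolding finite_nat_set_iff_bounded by (meson not_le)
  then show "trunc S unit_vi \<in> point None \<longleftrightarrow> finite S"
    using assms nz_trunc_unit unfolding point_def finite_support_def by auto
qed

text \<open>\<open>trunc {n} unit_vi\<close> belongs to every point except \<open>Some n\<close>, so
  membership of these objects tells all points apart.\<close>

lemma inj_point: "inj point"
proof (rule injI)
  fix x y assume eq: "point x = point y"
  have one: "trunc {n} unit_vi \<in> Ob \<A>" for n by (rule Ob_truncI[of _ n]) simp
  have "x = Some n \<longleftrightarrow> trunc {n} unit_vi \<notin> point x" for x n
    using trunc_unit_mem_point[OF one] by (cases x) auto
  then have "x = Some n \<longleftrightarrow> y = Some n" for n using eq by metis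
  then show "x = y" by (metis option.exhaust)
qed

lemma range_point: "range point = Spc \<A>"
proof
  show "range point \<subseteq> Spc \<A>"
    using vanishing_at_Spc finite_support_Spc by (auto simp: point_def split: option.splits)
  show "Spc \<A> \<subseteq> range point"
  proof
    fix P assume "P \<in> Spc \<A>"
    then have "P = point None \<or> (\<exists>n. P = point (Some n))" using Spc_cases unfolding point_def by simp
    then show "P \<in> range point" by blast
  qed
qed

text \<open>A closed set is the intersection of the supports of the objects in \<open>S\<close>,
  where \<open>None\<close> counts as in the support exactly when the support is infinite. If
  \<open>None\<close> is missing, some object in \<open>S\<close> has finite support, and
  \<open>C\<close> lies inside it.\<close>

lemma Spc_closed_iff:
  "(\<exists>S\<subseteq>Ob \<A>. point ` C = Spc_closed \<A> S) \<longleftrightarrow> None \<in> C \<or> finite C"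
proof
  assume "\<exists>S\<subseteq>Ob \<A>. point ` C = Spc_closed \<A> S"
  then obtain S where S: "S \<subseteq> Ob \<A>" "point ` C = Spc_closed \<A> S" by blast
  have mem: "x \<in> C \<longleftrightarrow> (\<forall>X\<in>S. X \<notin> point x)" for x
  proof -
    have "x \<in> C \<longleftrightarrow> point x \<in> point ` C" using inj_point by (simp add: inj_image_mem_iff)
    then show ?thesis unfolding S(2) Spc_closed_def using range_point by blast
  qed
  show "None \<in> C \<or> finite C"
  proof (cases "None \<in> C")
    case False
    then obtain X where X: "X \<in> S" "X \<in> point None" using mem by blast
    then obtain N where N: "\<forall>n\<ge>N. \<not> nz X n" unfolding point_def finite_support_def by auto
    have "n < N" if n: "Some n \<in> C" for n
    proof (rule ccontr)
      assume "\<not> n < N"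
      then have "\<not> nz X n" using N by simp
      then have "X \<in> point (Some n)" unfolding point_def vanishing_at_def using X(1) S(1) by auto
      then show False using mem n X(1) by blast
    qed
    then have "C \<subseteq> Some ` {..<N}" using False by (metis imageI lessThan_iff option.exhaust subsetI)
    then show ?thesis using finite_surj by blast
  qed simp
next
  assume C: "None \<in> C \<or> finite C"
  have closed: "Spc_closed \<A> S = point ` {x. \<forall>X\<in>S. X \<notin> point x}" for S
    unfolding Spc_closed_def range_point[symmetric] by auto
  show "\<exists>S\<subseteq>Ob \<A>. point ` C = Spc_closed \<A> S"
  proof (cases "None \<in> C")
    case True
    \<comment> \<open>Each missing \<open>Some n\<close> is excluded by an object supported in all
      other dimensions. These supports are infinite, so \<open>None\<close> is not excluded.\<close>
    let ?S = "{trunc (- {n}) unit_vi | n. Some n \<notin> C}"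
    \<comment> \<open>The runs of \<open>- {n}\<close> can start only at \<open>0\<close> and at
      \<open>Suc n\<close>.\<close>
    have O: "trunc (- {n}) unit_vi \<in> Ob \<A>" for n
      by (rule Ob_trunc_unit) (rule finite_subset[of _ "{..Suc n}"], auto)
    have inf: "\<not> finite (- {n :: nat})" for n by simp
    have "x \<in> C \<longleftrightarrow> (\<forall>X\<in>?S. X \<notin> point x)" for x
      using True trunc_unit_mem_point[OF O] inf by (cases x) auto
    then have "C = {x. \<forall>X\<in>?S. X \<notin> point x}" by blast
    then have "point ` C = Spc_closed \<A> ?S" unfolding closed by (rule arg_cong)
    moreover have "?S \<subseteq> Ob \<A>" using O by blast
    ultimately show ?thesis by blast
  next
    case False
    \<comment> \<open>A finite set without \<open>None\<close> is cut out by one object, the unit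
      truncated to exactly these dimensions.\<close>
    define T where "T = {n. Some n \<in> C}"
    have "finite T" using C False finite_vimageI[of C Some] unfolding T_def vimage_def by simp
    then have O: "trunc T unit_vi \<in> Ob \<A>" by (intro Ob_trunc_unit) (rule finite_subset[of _ T], auto)
    have "x \<in> C \<longleftrightarrow> trunc T unit_vi \<notin> point x" for x
      using False trunc_unit_mem_point[OF O] \<open>finite T\<close> unfolding T_def by (cases x) auto
    then have "C = {x. \<forall>X\<in>{trunc T unit_vi}. X \<notin> point x}" by blast
    then have "point ` C = Spc_closed \<A> {trunc T unit_vi}" unfolding closed by (rule arg_cong)
    then show ?thesis using O by blast
  qed
qed

section \<open>Comparison with the one-point compactification\<close>

abbreviation "\<N> \<equiv> Alexandroff_compactification (discrete_topology (UNIV :: nat set))"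

lemma openin_compactification: "openin \<N> V \<longleftrightarrow> None \<notin> V \<or> finite (- V)"
proof
  assume "openin \<N> V"
  then consider U where "V = Some ` U" | C where "finite C" "V = insert None (Some ` (UNIV - C))"
    unfolding openin_Alexandroff_compactification compactin_discrete_topology topspace_discrete_topology by blast
  then show "None \<notin> V \<or> finite (- V)"
  proof cases
    case 1
    then show ?thesis by blast
  next
    case 2
    have "- V \<subseteq> Some ` C"
    proof
      fix x assume "x \<in> - V"
      then show "x \<in> Some ` C" unfolding 2(2) by (cases x) auto
    qed
    then show ?thesis using 2(1) finite_surj by blast
  qed
next
  assume V: "None \<notin> V \<or> finite (- V)"
  show "openin \<N> V"
  proof (cases "None \<in> V")
    case False
    have "V = Some ` {n. Some n \<in> V}"
    proof (rule Set.set_eqI)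
      show "x \<in> V \<longleftrightarrow> x \<in> Some ` {n. Some n \<in> V}" for x using False by (cases x) auto
    qed
    then show ?thesis
      unfolding openin_Alexandroff_compactification openin_discrete_topology by blast
  next
    case True
    let ?C = "{n. Some n \<notin> V}"
    have "finite ?C" using V True finite_vimageI[of "- V" Some] unfolding vimage_def by simp
    moreover have "V = insert None (Some ` (UNIV - ?C))"
    proof (rule Set.set_eqI)
      show "x \<in> V \<longleftrightarrow> x \<in> insert None (Some ` (UNIV - ?C))" for x
        using True by (cases x) auto
    qed
    ultimately show ?thesis
      unfolding openin_Alexandroff_compactification compactin_discrete_topology topspace_discrete_topology
        closedin_discrete_topology by blast
  qed
qed

lemma zariski_open_iff:
  "U \<subseteq> Spc \<A> \<and> (\<exists>S\<subseteq>Ob \<A>. Spc \<A> - U = Spc_closed \<A> S) \<longleftrightarrow> (\<exists>V. openin \<N> V \<and> U = point ` V)"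
proof -
  have "Spc \<A> - point ` V = point ` (- V)" for V
    unfolding range_point[symmetric] using inj_point by (metis Compl_eq_Diff_UNIV image_set_diff)
  then have *: "(\<exists>S\<subseteq>Ob \<A>. Spc \<A> - point ` V = Spc_closed \<A> S) \<longleftrightarrow> openin \<N> V" for V
    unfolding openin_compactification using Spc_closed_iff[of "- V"] by simp
  show ?thesis
  proof
    assume U: "U \<subseteq> Spc \<A> \<and> (\<exists>S\<subseteq>Ob \<A>. Spc \<A> - U = Spc_closed \<A> S)"
    then obtain V where V: "U = point ` V" unfolding range_point[symmetric] subset_image_iff by auto
    have "openin \<N> V" using conjunct2[OF U] unfolding V * .
    then show "\<exists>V. openin \<N> V \<and> U = point ` V" using V by (intro exI conjI)
  next
    assume "\<exists>V. openin \<N> V \<and> U = point ` V"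
    then obtain V where V: "openin \<N> V" "U = point ` V" by (elim exE conjE)
    have "U \<subseteq> Spc \<A>" unfolding V(2) range_point[symmetric] by (rule image_mono) simp
    moreover have "\<exists>S\<subseteq>Ob \<A>. Spc \<A> - U = Spc_closed \<A> S" unfolding V(2) * by (rule V(1))
    ultimately show "U \<subseteq> Spc \<A> \<and> (\<exists>S\<subseteq>Ob \<A>. Spc \<A> - U = Spc_closed \<A> S)" ..
  qed
qed

text \<open>The topology axioms are not checked on the side of prime ideals: by
  \<open>zariski_open_iff\<close> the candidate open sets are the images of open sets of
  \<open>\<N>\<close> under an injective map, and such a family inherits the axioms.\<close>

lemma openin_zariski: "openin (zariski \<A>) U \<longleftrightarrow> (\<exists>V. openin \<N> V \<and> U = point ` V)"
proof -
  have "istopology (\<lambda>U. \<exists>V. openin \<N> V \<and> U = point ` V)"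
    unfolding istopology_def
  proof (intro conjI allI impI)
    fix U U' assume "\<exists>V. openin \<N> V \<and> U = point ` V" "\<exists>V. openin \<N> V \<and> U' = point ` V"
    then obtain V V' where "openin \<N> V" "U = point ` V" "openin \<N> V'" "U' = point ` V'" by blast
    then show "\<exists>V. openin \<N> V \<and> U \<inter> U' = point ` V"
      using image_Int[OF inj_point, of V V'] openin_Int by metis
  next
    fix \<U> assume "\<forall>U\<in>\<U>. \<exists>V. openin \<N> V \<and> U = point ` V"
    then obtain v where v: "\<And>U. U \<in> \<U> \<Longrightarrow> openin \<N> (v U) \<and> U = point ` v U" by metis
    have "openin \<N> (\<Union>(v ` \<U>))" using v by (intro openin_Union) blast
    moreover have "\<Union>\<U> = point ` \<Union>(v ` \<U>)" using v by (auto simp: image_UN)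
    ultimately show "\<exists>V. openin \<N> V \<and> \<Union>\<U> = point ` V" by blast
  qed
  then show ?thesis
    unfolding zariski_def zariski_open_iff by (simp add: topology_inverse')
qed

lemma zariski_homeomorphic: "zariski \<A> homeomorphic_space \<N>"
proof -
  have top: "topspace \<N> = UNIV" by (auto simp: UNIV_option_conv)
  have open_point: "open_map \<N> (zariski \<A>) point" unfolding open_map_def openin_zariski by blast
  have topz: "topspace (zariski \<A>) = range point"
  proof
    show "topspace (zariski \<A>) \<subseteq> range point" unfolding topspace_def openin_zariski by blast
    show "range point \<subseteq> topspace (zariski \<A>)"
      by (rule openin_subset) (use openin_zariski openin_topspace[of \<N>] top in auto)
  qed
  have "continuous_map \<N> (zariski \<A>) point"
    unfolding continuous_map_def
  proof (intro conjI allI impI)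
    show "point \<in> topspace \<N> \<rightarrow> topspace (zariski \<A>)" unfolding topz by blast
    fix U assume "openin (zariski \<A>) U"
    then obtain V where V: "openin \<N> V" "U = point ` V" unfolding openin_zariski by blast
    have "{x \<in> topspace \<N>. point x \<in> U} = V" unfolding V(2) top using inj_point by (simp add: inj_image_mem_iff)
    then show "openin \<N> {x \<in> topspace \<N>. point x \<in> U}" using V(1) by simp
  qed
  then have "homeomorphic_map \<N> (zariski \<A>) point"
    by (rule bijective_open_imp_homeomorphic_map[OF _ open_point]) (use top topz inj_point in auto)
  then show ?thesis
    using homeomorphic_map_imp_homeomorphic_space homeomorphic_space_sym by blast
qed

end

theorem corollary5p9:
  fixes K :: "'k ring" and p :: nat
  assumes "field K"
    and "\<forall>n::nat. n > 0 \<longrightarrow> [n] \<cdot>\<^bsub>K\<^esub> \<one>\<^bsub>K\<^esub> \<noteq> \<zero>\<^bsub>K\<^esub>"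
    and "prime p"
  shows "zariski (VI_fg p K) homeomorphic_space
         Alexandroff_compactification (discrete_topology (UNIV :: nat set))"
proof -
  interpret VI_setting p K
    using assms(1,3) by (simp add: VI_setting_def VI_category_def)
  show ?thesis by (rule zariski_homeomorphic)
qed

end
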